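(* Let $k\ge3$ be odd, let $aL+\nu$ be a lattice coset on a positive definite quadratic space of dimension $k$, let $N_L$ be the level and $d_L$ the discriminant of $L$, and let $p$ be a prime. Write $(\Theta_{aL+\nu}|T(p^2))(z)=\sum_{n\ge0}b(n)q^n$. If $p\mid 4N_La^2$, then $b(n)=r(p^2n,aL+\nu)$. If $p\nmid 4N_La^2$, then $$b(n)=r(p^2n,aL+\nu)+\left(\frac{-1}{p}\right)^{\lambda}\left(\frac{4d_Ln}{p}\right)p^{\lambda-1}\,r(n,aL+\bar p\nu)+\left(\frac{4d_L}{p^2}\right)p^{k-2}\,r(n/p^2,aL+\bar p^2\nu),$$ where $\lambda=(k-1)/2$ and $\bar p$ is an integer inverse to $p$ modulo $a$.
   Context: $L$ is an integral lattice on a positive definite quadratic space $V$ over $\mathbb{Q}$ ($Q(x)=B(x,x)$, $B(L,L)\subseteq\mathbb{Z}$), with discriminant $d_L$ and level $N_L$ (smallest $N$ with $NA^{-1}$ integral, $A$ the Gram matrix); $a\ge1$, $\nu\in L$ with conductor $a$. $r(n,aK+\mu)=\#\{x\in aK+\mu:Q(x)=n\}$ (zero if $n\notin\mathbb{Z}$), and $\Theta_{aK+\mu}=\sum_n r(n,aK+\mu)q^n$, which lies in $M_{k/2}(\Gamma_0(4N_La^2)\cap\Gamma_1(a),\chi_{4d_L})=\bigoplus_{\chi\bmod a}M_{k/2}(\Gamma_0(4N_La^2),\chi\chi_{4d_L})$. The Hecke operator $T(p^2)$ on $M_{k/2}(\Gamma_0(N)\cap\Gamma_1(M),\psi)=\bigoplus_{\chi\bmod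 M}M_{k/2}(\Gamma_0(N),\chi\psi)$ ($M\mid N$) acts componentwise by Shimura's operator: for $f=\sum a(n)q^n\in M_{k/2}(\Gamma_0(N),\psi')$, $f|T(p^2)=\sum b(n)q^n$ with $b(n)=a(p^2n)+\psi'(p)\left(\frac{-1}{p}\right)^\lambda\left(\frac{n}{p}\right)p^{\lambda-1}a(n)+\psi'(p^2)p^{k-2}a(n/p^2)$, where $\psi'$ is viewed as a character modulo $N$. *)

theory Defs
  imports "HOL-Complex_Analysis.Complex_Analysis" "HOL-Number_Theory.Number_Theory"
begin

section \<open>Positive definite quadratic spaces and lattice cosets\<close>

locale pos_def_quadratic_space = vector_space smul
  for smul :: "rat \<Rightarrow> 'v::ab_group_add \<Rightarrow> 'v" +
  fixes B :: "'v \<Rightarrow> 'v \<Rightarrow> rat"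
  assumes B_sym: "B x y = B y x"
    and B_add: "B (x + y) z = B x z + B y z"
    and B_smul: "B (smul c x) y = c * B x y"
    and B_pos: "x \<noteq> 0 \<Longrightarrow> B x x > 0"

text \<open>The family \<open>e\<close> is a \<open>\<rat>\<close>-basis of the whole space and a \<open>\<int>\<close>-basis of \<open>L\<close>; in
  particular the space has dimension \<open>CARD('n)\<close>.\<close>

definition lattice_basis ::
    "(rat \<Rightarrow> 'v::ab_group_add \<Rightarrow> 'v) \<Rightarrow> ('n::finite \<Rightarrow> 'v) \<Rightarrow> 'v set \<Rightarrow> bool" where
  "lattice_basis smul e L \<longleftrightarrow>
     inj e \<and> \<not> module.dependent smul (range e) \<and> module.span smul (range e) = UNIV \<and>
     L = {\<Sum>i\<in>UNIV. smul (of_int (c i)) (e i) | c :: 'n \<Rightarrow> int. True}"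

definition integral_lattice :: "('v \<Rightarrow> 'v \<Rightarrow> rat) \<Rightarrow> 'v set \<Rightarrow> bool" where
  "integral_lattice B L \<longleftrightarrow> (\<forall>x\<in>L. \<forall>y\<in>L. B x y \<in> \<int>)"

definition gram_matrix :: "('v \<Rightarrow> 'v \<Rightarrow> rat) \<Rightarrow> ('n::finite \<Rightarrow> 'v) \<Rightarrow> rat ^ 'n ^ 'n" where
  "gram_matrix B e = (\<chi> i j. B (e i) (e j))"

text \<open>The floor only changes the type: the Gram matrix of an integral lattice has integer entries.
  The value does not depend on the choice of the \<open>\<int>\<close>-basis, and neither does the level.\<close>

definition lattice_disc :: "('v \<Rightarrow> 'v \<Rightarrow> rat) \<Rightarrow> ('n::finite \<Rightarrow> 'v) \<Rightarrow> int" where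
  "lattice_disc B e = \<lfloor>det (gram_matrix B e)\<rfloor>"

definition lattice_level :: "('v \<Rightarrow> 'v \<Rightarrow> rat) \<Rightarrow> ('n::finite \<Rightarrow> 'v) \<Rightarrow> nat" where
  "lattice_level B e =
     (LEAST N. N > 0 \<and> (\<forall>i j. of_nat N * matrix_inv (gram_matrix B e) $ i $ j \<in> \<int>))"

definition lattice_coset ::
    "(rat \<Rightarrow> 'v::ab_group_add \<Rightarrow> 'v) \<Rightarrow> nat \<Rightarrow> 'v set \<Rightarrow> 'v \<Rightarrow> 'v set" where
  "lattice_coset smul a L \<nu> = {smul (of_nat a) x + \<nu> | x. x \<in> L}"

text \<open>The coset \<open>aL + \<nu>\<close> is the rescaling by \<open>a\<close> of the coset \<open>L + \<nu>/a\<close>, whose conductor is the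
  smallest \<open>m > 0\<close> with \<open>m(\<nu>/a) \<in> L\<close>, that is, with \<open>m\<nu> \<in> aL\<close>.\<close>

definition coset_conductor ::
    "(rat \<Rightarrow> 'v::ab_group_add \<Rightarrow> 'v) \<Rightarrow> nat \<Rightarrow> 'v set \<Rightarrow> 'v \<Rightarrow> nat" where
  "coset_conductor smul a L \<nu> =
     (LEAST m. m > 0 \<and> smul (of_nat m) \<nu> \<in> lattice_coset smul a L 0)"

definition rep_num :: "('v \<Rightarrow> 'v \<Rightarrow> rat) \<Rightarrow> rat \<Rightarrow> 'v set \<Rightarrow> nat" where
  "rep_num B n S = (if n \<in> \<int> then card {x \<in> S. B x x = n} else 0)"


section \<open>Characters\<close>

definition kronecker_prime :: "int \<Rightarrow> int \<Rightarrow> int" where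
  "kronecker_prime m q =
     (if q = 2 then (if even m then 0 else if m mod 8 \<in> {1, 7} then 1 else -1)
      else Legendre m q)"

text \<open>The Kronecker symbol \<open>(m/n)\<close>. The sign in front of the product is \<open>(m/-1)\<close>, for negative \<open>n\<close>.\<close>

definition kronecker :: "int \<Rightarrow> int \<Rightarrow> int" where
  "kronecker m n =
     (if n = 0 then (if \<bar>m\<bar> = 1 then 1 else 0)
      else (if n < 0 \<and> m < 0 then -1 else 1) *
           (\<Prod>q\<in>#prime_factorization n. kronecker_prime m q))"

definition dirichlet_characters :: "nat \<Rightarrow> (int \<Rightarrow> complex) set" where
  "dirichlet_characters M = {\<phi>.
     (\<forall>m n. \<phi> (m * n) = \<phi> m * \<phi> n) \<and> (\<forall>n. \<phi> (n + int M) = \<phi> n) \<and>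
     (\<forall>n. \<phi> n \<noteq> 0 \<longleftrightarrow> coprime n (int M))}"

definition char_mod :: "nat \<Rightarrow> (int \<Rightarrow> complex) \<Rightarrow> int \<Rightarrow> complex" where
  "char_mod N \<psi> n = (if coprime n (int N) then \<psi> n else 0)"


section \<open>Modular forms of half-integral weight\<close>

abbreviation uhp :: "complex set" where
  "uhp \<equiv> {z. Im z > 0}"

definition q_pow :: "nat \<Rightarrow> complex \<Rightarrow> complex" where
  "q_pow n z = exp (2 * of_real pi * \<i> * of_nat n * z)"

definition has_q_expansion :: "(complex \<Rightarrow> complex) \<Rightarrow> (nat \<Rightarrow> complex) \<Rightarrow> bool" where
  "has_q_expansion f c \<longleftrightarrow> (\<forall>z\<in>uhp. (\<lambda>n. c n * q_pow n z) sums f z)"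

definition q_coeff :: "(complex \<Rightarrow> complex) \<Rightarrow> nat \<Rightarrow> complex" where
  "q_coeff f = (THE c. has_q_expansion f c)"

definition mobius :: "int \<Rightarrow> int \<Rightarrow> int \<Rightarrow> int \<Rightarrow> complex \<Rightarrow> complex" where
  "mobius a b c d z = (of_int a * z + of_int b) / (of_int c * z + of_int d)"

definition jacobi_theta :: "complex \<Rightarrow> complex" where
  "jacobi_theta z = (\<Sum>\<^sub>\<infinity>n::int. exp (2 * of_real pi * \<i> * of_int (n ^ 2) * z))"

text \<open>Shimura's automorphy factor of weight 1/2. The Jacobi theta function has no zeros on the
  upper half-plane.\<close>

definition theta_factor :: "int \<Rightarrow> int \<Rightarrow> int \<Rightarrow> int \<Rightarrow> complex \<Rightarrow> complex" where
  "theta_factor a b c d z = jacobi_theta (mobius a b c d z) / jacobi_theta z"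

text \<open>The space of modular forms of weight \<open>k/2\<close> on \<open>\<Gamma>\<^sub>0(N)\<close> with character \<open>\<phi>\<close>, for \<open>4\<close> dividing
  \<open>N\<close>. The last conjunct is holomorphy at all cusps; the branch of the square root is irrelevant
  there. Values of \<open>f\<close> outside the upper half-plane are unconstrained.\<close>

definition half_weight_forms :: "nat \<Rightarrow> nat \<Rightarrow> (int \<Rightarrow> complex) \<Rightarrow> (complex \<Rightarrow> complex) set" where
  "half_weight_forms k N \<phi> = {f.
     f holomorphic_on uhp \<and>
     (\<forall>a b c d. a * d - b * c = 1 \<and> int N dvd c \<longrightarrow>
        (\<forall>z\<in>uhp. f (mobius a b c d z) = \<phi> d * theta_factor a b c d z ^ k * f z)) \<and>
     (\<forall>a b c d. a * d - b * c = 1 \<longrightarrow>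
        (\<exists>C Y. \<forall>z\<in>uhp. Im z \<ge> Y \<longrightarrow>
           norm (f (mobius a b c d z) / csqrt (of_int c * z + of_int d) ^ k) \<le> C))}"


section \<open>The Hecke operator\<close>

text \<open>Shimura's formula for the coefficients of \<open>f|T(p\<^sup>2)\<close>, where \<open>f = \<Sum> c(n)q\<^sup>n\<close> has weight \<open>k/2\<close>
  and character \<open>\<psi>\<close>. The exponents \<open>lam - 1\<close> and \<open>k - 2\<close> are natural numbers, so that
  \<open>k \<ge> 3\<close> is required.\<close>

definition shimura_coeff ::
    "nat \<Rightarrow> (int \<Rightarrow> complex) \<Rightarrow> nat \<Rightarrow> (nat \<Rightarrow> complex) \<Rightarrow> nat \<Rightarrow> complex" where
  "shimura_coeff k \<psi> p c n =
     (let lam = (k - 1) div 2 in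
        c (p ^ 2 * n)
      + \<psi> (int p) * of_int (kronecker (-1) (int p)) ^ lam * of_int (kronecker (int n) (int p))
          * of_nat p ^ (lam - 1) * c n
      + \<psi> (int (p ^ 2)) * of_nat p ^ (k - 2) * (if p ^ 2 dvd n then c (n div p ^ 2) else 0))"

definition shimura_hecke ::
    "nat \<Rightarrow> (int \<Rightarrow> complex) \<Rightarrow> nat \<Rightarrow> (complex \<Rightarrow> complex) \<Rightarrow> complex \<Rightarrow> complex" where
  "shimura_hecke k \<psi> p f z = (\<Sum>n. shimura_coeff k \<psi> p (q_coeff f) n * q_pow n z)"

text \<open>The components of \<open>f\<close> under the decomposition of the forms on \<open>\<Gamma>\<^sub>0(N) \<inter> \<Gamma>\<^sub>1(M)\<close> with
  character \<open>\<psi>\<close> as the direct sum, over the characters \<open>\<phi>\<close> modulo \<open>M\<close>, of the forms on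
  \<open>\<Gamma>\<^sub>0(N)\<close> with character \<open>\<phi>\<psi>\<close>. They are unique as functions on the upper half-plane, and only
  their values there matter.\<close>

definition character_components ::
    "nat \<Rightarrow> nat \<Rightarrow> nat \<Rightarrow> (int \<Rightarrow> complex) \<Rightarrow> (complex \<Rightarrow> complex)
       \<Rightarrow> (int \<Rightarrow> complex) \<Rightarrow> complex \<Rightarrow> complex" where
  "character_components k N M \<psi> f = (SOME F.
     (\<forall>\<phi>\<in>dirichlet_characters M. F \<phi> \<in> half_weight_forms k N (char_mod N (\<lambda>n. \<phi> n * \<psi> n))) \<and>
     (\<forall>z\<in>uhp. f z = (\<Sum>\<phi>\<in>dirichlet_characters M. F \<phi> z)))"

definition hecke_T_sq ::
    "nat \<Rightarrow> nat \<Rightarrow> nat \<Rightarrow> (int \<Rightarrow> complex) \<Rightarrow> nat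
       \<Rightarrow> (complex \<Rightarrow> complex) \<Rightarrow> complex \<Rightarrow> complex" where
  "hecke_T_sq k N M \<psi> p f z =
     (\<Sum>\<phi>\<in>dirichlet_characters M.
        shimura_hecke k (char_mod N (\<lambda>n. \<phi> n * \<psi> n)) p (character_components k N M \<psi> f \<phi>) z)"


section \<open>Theta series\<close>

definition theta_series :: "('v \<Rightarrow> 'v \<Rightarrow> rat) \<Rightarrow> 'v set \<Rightarrow> complex \<Rightarrow> complex" where
  "theta_series B S z = (\<Sum>n. of_nat (rep_num B (of_nat n) S) * q_pow n z)"

end

theory Submission
  imports Defs "HOL-Probability.Probability" "HOL-Computational_Algebra.Squarefree"
begin

text \<open>The theta series of a coset is transformed under \<open>\<Gamma>\<^sub>0(4N a\<^sup>2)\<close> by writing \<open>\<gamma>z = \<beta>/\<delta> - 1/u\<close>: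
  splitting into cosets modulo \<open>\<delta>\<close>, applying Poisson summation, completing the square and applying
  Poisson summation once more, the coset of \<open>\<mu>\<close> becomes the coset of \<open>\<alpha>\<mu>\<close> times a Gauss sum. The Jacobi
  theta function obeys the same law in rank one, so the multiplier relative to its automorphy factor is
  a quotient of Gauss sums. This quotient does not change under \<open>\<gamma> \<rightarrow> \<gamma>T\<^sup>j\<close>, so \<open>\<delta>\<close> may be
  assumed coprime to the index of an orthogonal sublattice, where the quotient is a Kronecker symbol.
  Hence the component of the theta series at a character \<open>\<phi>\<close> modulo \<open>a\<close> is the average of
  \<open>\<phi>(m)\<close> times the theta series of \<open>aL + m\<nu>\<close> over the units \<open>m\<close>. Adding up Shimura's formula over all
  \<open>\<phi>\<close>, orthogonality of characters turns the factor \<open>\<phi>(p)\<close> into the passage from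
  \<open>\<nu>\<close> to \<open>p'\<nu>\<close>, where \<open>p'\<close> is inverse to \<open>p\<close> modulo \<open>a\<close>.\<close>

text \<open>Comparison with the Jacobi theta function makes every unknown quantity cancel: the
  constant of Poisson's formula enters once forwards and once backwards, and the roots of unity and
  square roots carried by Gauss sums drop out of the quotient. The price is a division by theta
  values, which is why the Jacobi theta function is shown to have no zeros. Since 4 divides
  \<open>c\<close>, the entry \<delta> is odd and hence non-zero, so the single decomposition with
  denominator \<delta> covers all matrices of the level. An integral form need not be diagonalisable
  over the integers. The orthogonal sublattice takes the place of a diagonalisation: Poisson
  summation on it is a product, and Gauss sums become products as soon as \<delta> is prime to
  \<open>den\<close>. The discriminant divides only a power of the level, whereas its squarefree
  part \<open>s\<close> divides the level itself. The symbol of \<open>s\<close> has the period that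
  the argument requires, and it agrees with that of 4d at every \<delta> that occurs. The components
  of a form are fixed by a choice operator, so uniqueness of the decomposition is part of the
  proof.\<close>

definition qexp :: "complex \<Rightarrow> complex" where
  "qexp x = exp (2 * of_real pi * \<i> * x)"

lemma qexp_add: "qexp (x + y) = qexp x * qexp y"
  by (simp add: qexp_def exp_add algebra_simps)

lemma qexp_0 [simp]: "qexp 0 = 1"
  by (simp add: qexp_def)

lemma qexp_nonzero [simp]: "qexp x \<noteq> 0"
  by (simp add: qexp_def)

lemma qexp_minus: "qexp (- x) = inverse (qexp x)"
  by (simp add: qexp_def exp_minus)

lemma qexp_diff: "qexp (x - y) = qexp x / qexp y"
  by (simp add: qexp_def exp_diff algebra_simps)

lemma norm_qexp: "norm (qexp x) = exp (- 2 * pi * Im x)"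
  by (simp add: qexp_def)

lemma qexp_of_real: "qexp (of_real x) = cis (2 * pi * x)"
  by (simp add: qexp_def cis_conv_exp mult_ac)

lemma qexp_of_int [simp]: "qexp (of_int n) = 1"
  unfolding qexp_def exp_eq_1 by (auto simp: mult_ac)

lemma qexp_eq_1_iff: "qexp (of_real x) = 1 \<longleftrightarrow> x \<in> \<int>"
proof
  assume "qexp (of_real x) = 1"
  then obtain n :: int where "2 * pi * x = of_int (2 * n) * pi"
    unfolding qexp_def exp_eq_1 by auto
  hence "x = of_int n" by simp
  thus "x \<in> \<int>" by simp
qed (auto elim!: Ints_cases)

lemma holomorphic_on_qexp [holomorphic_intros]:
  "f holomorphic_on A \<Longrightarrow> (\<lambda>z. qexp (f z)) holomorphic_on A"
  unfolding qexp_def by (intro holomorphic_intros)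

lemma continuous_on_qexp [continuous_intros]:
  "continuous_on A f \<Longrightarrow> continuous_on A (\<lambda>z. qexp (f z))"
  unfolding qexp_def by (intro continuous_intros)

subsection \<open>Uniqueness of Fourier coefficients\<close>

text \<open>On the unit circle a real linear form is a combination of the exponentials of h and -h,
  so multiplication by it only shifts \<open>m\<close> by one in either direction. \<open>D\<close>
  stays arbitrary in the induction because a product of \<open>f\<close> and \<open>g\<close> is
  treated by absorbing \<open>f\<close> into \<open>D\<close>.\<close>

lemma circle_polynomial_orthogonal:
  assumes "real_polynomial_function g"
    and "continuous_on {0..1} (D :: real \<Rightarrow> complex)"
    and "\<And>m :: int. integral {0..1} (\<lambda>h. D h * qexp (of_real (of_int m * h))) = 0"
  shows "integral {0..1} (\<lambda>h. (D h * of_real (g (qexp (of_real h)))) * qexp (of_real (of_int m * h))) = 0"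
  using assms
proof (induction g arbitrary: D m)
  case (linear f)
  have f: "f w = Re w * f 1 + Im w * f \<i>" for w
  proof -
    have "w = Re w *\<^sub>R 1 + Im w *\<^sub>R \<i>"
      by (simp add: complex_eq_iff)
    hence "f w = f (Re w *\<^sub>R 1 + Im w *\<^sub>R \<i>)"
      by simp
    also have "\<dots> = Re w * f 1 + Im w * f \<i>"
      using linear(1) by (simp add: linear_simps bounded_linear.linear)
    finally show ?thesis .
  qed
  \<comment> \<open>From Re w = (w + 1/w) / 2 and Im w = (w - 1/w) / (2i) on the unit
    circle.\<close>
  define A where "A = complex_of_real (f 1) / 2 + of_real (f \<i>) / (2 * \<i>)"
  define B where "B = complex_of_real (f 1) / 2 - of_real (f \<i>) / (2 * \<i>)"
  have eq: "of_real (f (qexp (of_real h))) = A * qexp (of_real h) + B * qexp (of_real (- h))" for h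
    unfolding f[of "qexp (of_real h)"] unfolding qexp_of_real A_def B_def by (auto simp: complex_eq_iff)
  have int: "(\<lambda>h. D h * qexp (of_real (of_int m * h))) integrable_on {0..1}" for m
    by (intro integrable_continuous_real continuous_intros linear)
  have "integral {0..1} (\<lambda>h. (D h * of_real (f (qexp (of_real h)))) * qexp (of_real (of_int m * h)))
     = integral {0..1} (\<lambda>h. A * (D h * qexp (of_real (of_int (m + 1) * h)))
         + B * (D h * qexp (of_real (of_int (m - 1) * h))))"
    unfolding eq by (intro integral_cong) (simp add: ring_distribs qexp_add qexp_diff qexp_minus divide_inverse mult_ac)
  also have "\<dots> = 0"
    using linear(3)[of "m + 1"] linear(3)[of "m - 1"]
    by (subst Henstock_Kurzweil_Integration.integral_add[OF integrable_on_mult_right[OF int] integrable_on_mult_right[OF int]]) simp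
  finally show ?case .
next
  case (const c)
  have "integral {0..1} (\<lambda>h. (D h * of_real c) * qexp (of_real (of_int m * h)))
    = integral {0..1} (\<lambda>h. of_real c * (D h * qexp (of_real (of_int m * h))))"
    by (simp add: mult_ac)
  thus ?case using const by simp
next
  case (add f g)
  have cont: "continuous_on {0..1} (\<lambda>x. f (qexp (complex_of_real x)))" if "real_polynomial_function f" for f
    by (rule continuous_on_compose2[of UNIV f])
       (auto intro!: continuous_on_qexp continuous_on_of_real continuous_on_id continuous_at_imp_continuous_on[of UNIV f] continuous_real_polymonial_function that)
  have int: "(\<lambda>h. D h * of_real (f (qexp (of_real h))) * qexp (of_real (of_int m * h))) integrable_on {0..1}"
    if "real_polynomial_function f" for f
    by (intro integrable_continuous_real continuous_intros add cont that)
  have "integral {0..1} (\<lambda>h. D h * of_real (f (qexp (of_real h)) + g (qexp (of_real h))) * qexp (of_real (of_int m * h)))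
    = integral {0..1} (\<lambda>h. D h * of_real (f (qexp (of_real h))) * qexp (of_real (of_int m * h))
       + D h * of_real (g (qexp (of_real h))) * qexp (of_real (of_int m * h)))"
    by (intro integral_cong) (simp add: algebra_simps)
  also have "\<dots> = 0"
    by (subst Henstock_Kurzweil_Integration.integral_add[OF int int])
       (use add.IH add.prems add.hyps in auto)
  finally show ?case .
next
  case (mult f g)
  have cont: "continuous_on {0..1} (\<lambda>x. f (qexp (complex_of_real x)))"
    by (rule continuous_on_compose2[of UNIV f])
       (auto intro!: continuous_on_qexp continuous_on_of_real continuous_on_id continuous_at_imp_continuous_on[of UNIV f] continuous_real_polymonial_function mult)
  have "integral {0..1} (\<lambda>h. (D h * of_real (f (qexp (of_real h)))) * of_real (g (qexp (of_real h))) * qexp (of_real (of_int m * h))) = 0"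
  proof (rule mult.IH(2))
    show "continuous_on {0..1} (\<lambda>h. D h * of_real (f (qexp (of_real h))))"
      by (intro continuous_intros mult.prems(1) cont)
    show "integral {0..1} (\<lambda>h. (D h * of_real (f (qexp (of_real h)))) * qexp (of_real (of_int m * h))) = 0" for m
      by (rule mult.IH(1)[OF mult.prems])
  qed
  thus ?case by (simp add: mult_ac)
qed

text \<open>Stone-Weierstrass on the circle: the conjugate of \<open>D\<close> is approximated
  within \<open>e\<close> by a polynomial \<open>g\<close>. As \<open>D\<close> is orthogonal to
  \<open>g\<close>, the integral of |D|^2 is at most \<open>e\<close> times the integral of
  |D|.\<close>

lemma fourier_uniqueness:
  fixes D :: "real \<Rightarrow> complex"
  assumes cont: "continuous_on {0..1} D" and per: "D 0 = D 1"
    and orth: "\<And>m :: int. integral {0..1} (\<lambda>h. D h * qexp (of_real (of_int m * h))) = 0"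
    and x: "x \<in> {0..1}"
  shows "D x = 0"
proof -
  define F where "F = (\<lambda>w. cnj (D (Arg2pi w / (2 * pi))))"
  \<comment> \<open>The constant homotopy serves to obtain continuity of \<open>D\<close> composed
    with the argument on the whole circle, in spite of the jump of the argument at 1.\<close>
  have "homotopic_loops UNIV D D"
    by (simp add: homotopic_loops_refl path_def cont pathstart_def pathfinish_def per)
  hence "homotopic_with_canon (\<lambda>h. True) (sphere 0 1) UNIV (D \<circ> (\<lambda>z. (Arg2pi z / (2 * pi)))) (D \<circ> (\<lambda>z. (Arg2pi z / (2 * pi))))"
    by (rule homotopic_loops_imp_homotopic_circlemaps)
  hence "continuous_on (sphere 0 1) (D \<circ> (\<lambda>z. (Arg2pi z / (2 * pi))))"
    by (rule homotopic_with_imp_continuous[THEN conjunct1])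
  hence contF: "continuous_on (sphere 0 1) F"
    unfolding F_def by (auto intro!: continuous_intros simp: o_def)
  have F: "F (qexp (of_real h)) = cnj (D h)" if "h \<in> {0..1}" for h
  proof (cases "h = 1")
    case True
    thus ?thesis using per qexp_of_int[of 1] Arg2pi_of_real[of 1] by (simp add: F_def)
  next
    case False
    have "Arg2pi (qexp (of_real h)) = 2 * pi * h"
      by (rule Arg2pi_unique[of 1]) (use that False in \<open>auto simp: qexp_def mult_ac\<close>)
    thus ?thesis by (simp add: F_def)
  qed
  define I where "I = integral {0..1} (\<lambda>h. norm (D h) ^ 2)"
  have intI: "(\<lambda>h. norm (D h) ^ 2) integrable_on {0..1}"
    by (intro integrable_continuous_real continuous_intros cont)
  define K where "K = integral {0..1} (\<lambda>h. norm (D h))"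
  have K: "K \<ge> 0" unfolding K_def by (intro integral_nonneg integrable_continuous_real continuous_intros cont) auto
  have "I \<le> e * K" if e: "e > 0" for e
  proof -
    obtain g where g: "polynomial_function g" "\<And>w. w \<in> sphere 0 1 \<Longrightarrow> norm (F w - g w) < e"
      using Stone_Weierstrass_polynomial_function[OF compact_sphere contF e] by auto
    have Re: "real_polynomial_function (\<lambda>w. Re (g w))" and Im: "real_polynomial_function (\<lambda>w. Im (g w))"
      using g(1) bounded_linear_Re bounded_linear_Im unfolding polynomial_function_def o_def by blast+
    have contg: "continuous_on {0..1} (\<lambda>x. g (qexp (complex_of_real x)))"
      by (rule continuous_on_compose2[OF continuous_on_polymonial_function[OF g(1), of UNIV]])
         (auto intro!: continuous_intros)
    have z: "integral {0..1} (\<lambda>h. D h * of_real (p (qexp (of_real h)))) = 0" if "real_polynomial_function p" for p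
      using circle_polynomial_orthogonal[OF that cont orth, of 0] by simp
    have contR: "continuous_on {0..1} (\<lambda>x. Re (g (qexp (complex_of_real x))))"
      "continuous_on {0..1} (\<lambda>x. Im (g (qexp (complex_of_real x))))"
      by (intro continuous_intros contg)+
    have "integral {0..1} (\<lambda>h. D h * g (qexp (of_real h)))
      = integral {0..1} (\<lambda>h. D h * of_real (Re (g (qexp (of_real h)))) + \<i> * (D h * of_real (Im (g (qexp (of_real h))))))"
      by (intro integral_cong) (simp add: complex_eq_iff algebra_simps)
    also have "\<dots> = integral {0..1} (\<lambda>h. D h * of_real (Re (g (qexp (of_real h))))) + \<i> * integral {0..1} (\<lambda>h. D h * of_real (Im (g (qexp (of_real h)))))"
      by (subst Henstock_Kurzweil_Integration.integral_add)
        (auto intro!: integrable_continuous_real continuous_intros cont contR)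
    also have "\<dots> = 0" using z[OF Re] z[OF Im] by simp
    finally have 0: "integral {0..1} (\<lambda>h. D h * g (qexp (of_real h))) = 0" .
    have "complex_of_real I = integral {0..1} (\<lambda>h. complex_of_real (norm (D h) ^ 2))"
      unfolding I_def
      using has_integral_of_real[OF integrable_integral[OF intI], where 'b = complex] by (simp add: integral_unique)
    also have "\<dots> = integral {0..1} (\<lambda>h. D h * cnj (D h)) - integral {0..1} (\<lambda>h. D h * g (qexp (of_real h)))"
      unfolding 0 by (simp only: complex_norm_square diff_0_right)
    also have "\<dots> = integral {0..1} (\<lambda>h. D h * cnj (D h) - D h * g (qexp (of_real h)))"
      by (rule Henstock_Kurzweil_Integration.integral_diff[symmetric])
        (auto intro!: integrable_continuous_real continuous_intros cont contg)
    finally have "norm (complex_of_real I) \<le> integral {0..1} (\<lambda>h. e * norm (D h))"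
    proof (elim ssubst, intro integral_norm_bound_integral)
      fix h :: real assume h: "h \<in> {0..1}"
      have "norm (D h * cnj (D h) - D h * g (qexp (of_real h))) = norm (D h) * norm (F (qexp (of_real h)) - g (qexp (of_real h)))"
        unfolding F[OF h] by (simp add: norm_mult[symmetric] algebra_simps)
      also have "\<dots> \<le> norm (D h) * e"
        by (intro mult_left_mono less_imp_le[OF g(2)]) (auto simp: norm_qexp)
      finally show "norm (D h * cnj (D h) - D h * g (qexp (of_real h))) \<le> e * norm (D h)" by (simp add: mult_ac)
    qed (auto intro!: integrable_continuous_real continuous_intros cont contg)
    thus "I \<le> e * K" by (simp add: K_def)
  qed
  hence "I \<le> 0"
  proof -
    assume *: "\<And>e. e > 0 \<Longrightarrow> I \<le> e * K"
    show ?thesis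
    proof (rule field_le_epsilon)
      fix e :: real assume e: "e > 0"
      \<comment> \<open>The summand 1 covers the case \<open>K = 0\<close>.\<close>
      have "I \<le> e / (K + 1) * K" by (rule *) (use e K in auto)
      also have "\<dots> \<le> e" using e K by (simp add: field_simps)
      finally show "I \<le> 0 + e" by simp
    qed
  qed
  moreover have "I \<ge> 0" unfolding I_def by (intro integral_nonneg intI) auto
  ultimately have "((\<lambda>h. norm (D h) ^ 2) has_integral 0) (cbox 0 1)"
    using intI unfolding I_def by (simp add: has_integral_integral)
  hence "norm (D x) ^ 2 = 0"
    by (rule has_integral_0_cbox_imp_0[rotated 2]) (use x in \<open>auto intro!: continuous_intros cont\<close>)
  thus ?thesis by simp
qed

subsection \<open>Poisson summation for Gaussians\<close>

lemma powr_abs_summable_int: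
  assumes "0 \<le> r" "r < (1 :: real)"
  shows "(\<lambda>n :: int. r ^ nat \<bar>n\<bar>) summable_on UNIV"
proof -
  have 1: "(\<lambda>n :: nat. r ^ n) summable_on UNIV"
    using assms by (simp add: summable_on_UNIV_nonneg_real_iff)
  have "(\<lambda>n :: int. r ^ nat \<bar>n\<bar>) summable_on (int ` UNIV)"
    using 1 by (subst summable_on_reindex) (auto simp: o_def)
  moreover have "(\<lambda>n :: int. r ^ nat \<bar>n\<bar>) summable_on ((\<lambda>n. - int n) ` UNIV)"
    using 1 by (subst summable_on_reindex) (auto simp: o_def inj_on_def)
  ultimately have "(\<lambda>n :: int. r ^ nat \<bar>n\<bar>) summable_on (int ` UNIV \<union> (\<lambda>n. - int n) ` UNIV)"
    by (rule summable_on_union)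
  also have "int ` UNIV \<union> (\<lambda>n. - int n) ` UNIV = (UNIV :: int set)"
  proof -
    have "x \<in> int ` UNIV \<union> (\<lambda>n. - int n) ` UNIV" for x :: int
      by (cases x rule: int_cases2) auto
    thus ?thesis by auto
  qed
  finally show ?thesis .
qed

text \<open>From (n + 2h)^2 \<ge> 0 follows (n + h)^2 + h^2 \<ge> n^2 / 2. The majorant depends on
  \<open>h\<close> only through the bound \<open>H\<close>, as the Weierstrass test
  requires.\<close>

lemma gaussian_le_geometric:
  fixes c h H :: real
  assumes "c \<ge> 0" and "\<bar>h\<bar> \<le> H"
  shows "exp (- c * (of_int n + h) ^ 2) \<le> exp (c * H ^ 2) * exp (- c / 2) ^ nat \<bar>n\<bar>"
proof -
  have "(of_int n + h) ^ 2 + h ^ 2 \<ge> (of_int n :: real) ^ 2 / 2"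
    using zero_le_power2[of "of_int n + 2 * h"] by (simp add: power2_eq_square algebra_simps)
  moreover have "(of_int n :: real) ^ 2 \<ge> of_int \<bar>n\<bar>"
  proof -
    have "\<bar>n\<bar> \<le> \<bar>n\<bar> ^ 2" by (cases "n = 0") (use self_le_power[of "\<bar>n\<bar>" 2] in auto)
    hence "\<bar>n\<bar> \<le> n ^ 2" by simp
    thus ?thesis by (metis of_int_le_iff of_int_power)
  qed
  moreover have "h ^ 2 \<le> H ^ 2" using assms(2) by (simp add: abs_le_square_iff[symmetric])
  ultimately have "(of_int n + h) ^ 2 + H ^ 2 \<ge> of_int \<bar>n\<bar> / 2" by linarith
  hence "c * ((of_int n + h) ^ 2 + H ^ 2) \<ge> c * (of_int \<bar>n\<bar> / 2)"
    by (rule mult_left_mono) (use assms in auto)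
  hence "- c * (of_int n + h) ^ 2 \<le> c * H ^ 2 + of_nat (nat \<bar>n\<bar>) * (- c / 2)"
    by (simp add: algebra_simps)
  hence "exp (- c * (of_int n + h) ^ 2) \<le> exp (c * H ^ 2 + of_nat (nat \<bar>n\<bar>) * (- c / 2))"
    by simp
  thus ?thesis by (simp only: exp_add exp_of_nat_mult)
qed

lemma gaussian_summable_bound:
  assumes "c > (0 :: real)"
  shows "(\<lambda>n :: int. exp (c * H ^ 2) * exp (- c / 2) ^ nat \<bar>n\<bar>) summable_on UNIV"
  by (intro summable_on_cmult_right powr_abs_summable_int) (use assms in auto)

lemma gaussian_summable:
  assumes "c > (0 :: real)"
  shows "(\<lambda>n :: int. exp (- c * (of_int n + h) ^ 2)) summable_on UNIV"
  by (rule summable_on_comparison_test[OF gaussian_summable_bound[OF assms, of "\<bar>h\<bar>"]])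
     (use gaussian_le_geometric[of c h "\<bar>h\<bar>"] assms in auto)

lemma gaussian_uniform_limit:
  assumes "c > (0 :: real)"
  shows "uniform_limit {-H..H} (\<lambda>N h. \<Sum>n\<in>N. of_real (exp (- c * (of_int n + h) ^ 2)) :: complex)
    (\<lambda>h. \<Sum>\<^sub>\<infinity>n. of_real (exp (- c * (of_int n + h) ^ 2))) (finite_subsets_at_top UNIV)"
  by (rule Weierstrass_m_test_general[OF _ gaussian_summable_bound[OF assms, of H]])
     (use gaussian_le_geometric[of c _ H] assms in auto)

text \<open>This is the characteristic function of the standard normal distribution at
  \<open>t\<close>, with the variable rescaled by \<open>k\<close>.\<close>

lemma gaussian_fourier:
  assumes c: "c > (0 :: real)"
  shows "has_bochner_integral lborel (\<lambda>x. of_real (exp (- (pi * c) * x ^ 2)) * qexp (of_real (w * x)))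
    (of_real (exp (- pi * w ^ 2 / c) / sqrt c))"
proof -
  define k where "k = sqrt (2 * pi * c)"
  have k: "k > 0" "k ^ 2 = 2 * pi * c" using c by (auto simp: k_def)
  define t where "t = 2 * pi * w / k"
  have "integrable std_normal_distribution (\<lambda>x. iexp (t * x))"
    by (rule prob_space.integrable_iexp) (auto intro!: prob_space_normal_density)
  hence int: "integrable lborel (\<lambda>x. std_normal_density x *\<^sub>R iexp (t * x))"
    by (subst (asm) integrable_density) (auto simp: normal_density_nonneg)
  have "(LINT x|lborel. std_normal_density x *\<^sub>R iexp (t * x)) = char std_normal_distribution t"
    unfolding char_def by (subst integral_density) (auto simp: normal_density_nonneg)
  hence "has_bochner_integral lborel (\<lambda>x. std_normal_density x *\<^sub>R iexp (t * x)) (of_real (exp (- (t ^ 2) / 2)))"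
    using int by (simp add: has_bochner_integral_iff char_std_normal_distribution)
  hence "has_bochner_integral lborel (\<lambda>x. std_normal_density (0 + k * x) *\<^sub>R iexp (t * (0 + k * x))) (of_real (exp (- (t ^ 2) / 2)) /\<^sub>R \<bar>k\<bar>)"
    by (subst (asm) lborel_has_bochner_integral_real_affine_iff[of k _ _ 0]) (use k in auto)
  hence "has_bochner_integral lborel (\<lambda>x. of_real (sqrt (2 * pi)) * (std_normal_density (0 + k * x) *\<^sub>R iexp (t * (0 + k * x))))
     (of_real (sqrt (2 * pi)) * (of_real (exp (- (t ^ 2) / 2)) /\<^sub>R \<bar>k\<bar>))"
    by (intro has_bochner_integral_mult_right)
  also have "(\<lambda>x. of_real (sqrt (2 * pi)) * (std_normal_density (0 + k * x) *\<^sub>R iexp (t * (0 + k * x))))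
     = (\<lambda>x. of_real (exp (- (pi * c) * x ^ 2)) * qexp (of_real (w * x)))"
  proof
    fix x
    have "t * (0 + k * x) = 2 * pi * (w * x)" using k by (simp add: t_def)
    hence "iexp (t * (0 + k * x)) = qexp (of_real (w * x))"
      by (simp only:) (simp add: qexp_def mult_ac)
    moreover have "(k * x) ^ 2 / 2 = pi * c * x ^ 2" using k by (simp add: power_mult_distrib)
    ultimately show "of_real (sqrt (2 * pi)) * (std_normal_density (0 + k * x) *\<^sub>R iexp (t * (0 + k * x)))
      = of_real (exp (- (pi * c) * x ^ 2)) * qexp (of_real (w * x))"
      by (simp only:) (simp add: std_normal_density_def scaleR_conv_of_real mult_ac)
  qed
  also have "of_real (sqrt (2 * pi)) * (of_real (exp (- (t ^ 2) / 2)) /\<^sub>R \<bar>k\<bar>) = complex_of_real (exp (- pi * w ^ 2 / c) / sqrt c)"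
  proof -
    have "t ^ 2 / 2 = pi * w ^ 2 / c" using k c by (simp add: t_def power_divide power_mult_distrib) (simp add: power2_eq_square)
    hence "- (t ^ 2) / 2 = - pi * w ^ 2 / c" by simp
    moreover have "k = sqrt (2 * pi) * sqrt c" unfolding k_def by (simp add: real_sqrt_mult)
    ultimately show ?thesis using k(1) c by (simp add: scaleR_conv_of_real field_simps)
  qed
  finally show ?thesis .
qed

lemma filterlim_symmetric_int_intervals:
  "filterlim (\<lambda>N. {- int N..int N}) (finite_subsets_at_top UNIV) sequentially"
  unfolding filterlim_finite_subsets_at_top
proof (safe, goal_cases)
  case (1 X)
  define M where "M = (\<Sum>x\<in>X. nat \<bar>x\<bar>)"
  have M: "nat \<bar>x\<bar> \<le> M" if "x \<in> X" for x
    unfolding M_def using 1 that by (intro member_le_sum) auto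
  show ?case
    using eventually_ge_at_top[of M] by eventually_elim (use M in fastforce)
qed

text \<open>Unfolding: a Fourier coefficient of the periodised Gaussian over one period is the
  Fourier transform of the Gaussian over the whole line.\<close>

lemma gaussian_periodization_fourier:
  assumes c: "c > (0 :: real)"
  shows "((\<lambda>h. (\<Sum>\<^sub>\<infinity>n :: int. of_real (exp (- (pi * c) * (of_int n + h) ^ 2))) * qexp (of_real (of_int m * h)))
    has_integral of_real (exp (- pi * of_int m ^ 2 / c) / sqrt c)) {0..1}"
proof -
  define \<phi> where "\<phi> = (\<lambda>x. complex_of_real (exp (- (pi * c) * x ^ 2)) * qexp (of_real (of_int m * x)))"
  have contphi: "continuous_on A \<phi>" for A unfolding \<phi>_def by (intro continuous_intros)
  have uni: "uniform_limit {0..1} (\<lambda>N h. (\<Sum>n\<in>N. of_real (exp (- (pi * c) * (of_int n + h) ^ 2))) * qexp (of_real (of_int m * h)))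
     (\<lambda>h. (\<Sum>\<^sub>\<infinity>n :: int. of_real (exp (- (pi * c) * (of_int n + h) ^ 2))) * qexp (of_real (of_int m * h))) (finite_subsets_at_top UNIV)"
  proof (rule uniform_limitI, goal_cases)
    case (1 e)
    have "uniform_limit {0..1} (\<lambda>N h. \<Sum>n\<in>N. of_real (exp (- (pi * c) * (of_int n + h) ^ 2)) :: complex)
      (\<lambda>h. \<Sum>\<^sub>\<infinity>n. of_real (exp (- (pi * c) * (of_int n + h) ^ 2))) (finite_subsets_at_top UNIV)"
      by (rule uniform_limit_on_subset[OF gaussian_uniform_limit[of "pi * c" 1]]) (use c in auto)
    from uniform_limitD[OF this 1] show ?case
      by eventually_elim (simp add: dist_norm norm_mult norm_qexp flip: left_diff_distrib)
  qed
  obtain I J where IJ: "\<And>N. ((\<lambda>h. (\<Sum>n\<in>N. of_real (exp (- (pi * c) * (of_int n + h) ^ 2))) * qexp (of_real (of_int m * h))) has_integral I N) {0..1}"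
    "((\<lambda>h. (\<Sum>\<^sub>\<infinity>n :: int. of_real (exp (- (pi * c) * (of_int n + h) ^ 2))) * qexp (of_real (of_int m * h))) has_integral J) {0..1}"
    "(I \<longlongrightarrow> J) (finite_subsets_at_top UNIV)"
    by (rule uniform_limit_integral[OF uni]) (auto intro!: continuous_intros)
  have shift: "((\<lambda>h. of_real (exp (- (pi * c) * (of_int n + h) ^ 2)) * qexp (of_real (of_int m * h))) has_integral
      integral {of_int n..of_int n + 1} \<phi>) {0..1}" for n
  proof -
    have "(\<phi> has_integral integral {of_int n..of_int n + 1} \<phi>) {of_int n..of_int n + 1}"
      by (intro integrable_integral integrable_continuous_real contphi)
    hence "(\<phi> has_integral integral {of_int n..of_int n + 1} \<phi>) (cbox (of_int n) (of_int n + 1))"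
      by simp
    from has_integral_affinity[OF this, of 1 "of_int n"]
    have "((\<lambda>x. \<phi> (x + of_int n)) has_integral integral {of_int n..of_int n + 1} \<phi>) {0..1}"
      by (simp add: image_minus_const_atLeastAtMost' flip: diff_conv_add_uminus)
    moreover have "\<phi> (x + of_int n) = of_real (exp (- (pi * c) * (of_int n + x) ^ 2)) * qexp (of_real (of_int m * x))" for x
      using qexp_of_int[of "m * n"] by (simp add: \<phi>_def ring_distribs qexp_add add_ac)
    ultimately show ?thesis by simp
  qed
  \<comment> \<open>The unit intervals starting at -N, ..., N fill [-N, N + 1], and these intervals
    exhaust the line.\<close>
  have IN: "I {- int N..int N} = integral {- of_nat N..of_nat N + 1} \<phi>" for N
  proof -
    have "((\<lambda>h. \<Sum>n\<in>{- int N..int N}. of_real (exp (- (pi * c) * (of_int n + h) ^ 2)) * qexp (of_real (of_int m * h))) has_integral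
      (\<Sum>n\<in>{- int N..int N}. integral {of_int n..of_int n + 1} \<phi>)) {0..1}"
      by (intro has_integral_sum shift) auto
    hence "I {- int N..int N} = (\<Sum>n\<in>{- int N..int N}. integral {of_int n..of_int n + 1} \<phi>)"
      using IJ(1)[of "{- int N..int N}"] by (simp add: sum_distrib_right has_integral_unique)
    also have "\<dots> = integral {- of_nat N..of_nat N + 1} \<phi>"
    proof (induction N)
      case (Suc N)
      have "{- int (Suc N)..int (Suc N)} = insert (- int (Suc N)) (insert (int (Suc N)) {- int N..int N})"
        by auto
      hence "(\<Sum>n\<in>{- int (Suc N)..int (Suc N)}. integral {of_int n..of_int n + 1} \<phi>) =
         integral {- of_nat (Suc N)..- of_nat N} \<phi> + integral {of_nat N + 1..of_nat N + 2} \<phi> + integral {- of_nat N..of_nat N + 1} \<phi>"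
        using Suc by (simp add: add_ac)
      also have "integral {- of_nat N..of_nat N + 1} \<phi> + integral {of_nat N + 1..of_nat N + 2} \<phi> = integral {- of_nat N..of_nat N + 2} \<phi>"
        by (rule Henstock_Kurzweil_Integration.integral_combine) (auto intro!: integrable_continuous_real contphi)
      hence "integral {- of_nat (Suc N)..- of_nat N} \<phi> + integral {of_nat N + 1..of_nat N + 2} \<phi> + integral {- of_nat N..of_nat N + 1} \<phi>
         = integral {- of_nat (Suc N)..- of_nat N} \<phi> + integral {- of_nat N..of_nat N + 2} \<phi>" by (simp add: add_ac)
      also have "\<dots> = integral {- of_nat (Suc N)..of_nat N + 2} \<phi>"
        by (rule Henstock_Kurzweil_Integration.integral_combine) (auto intro!: integrable_continuous_real contphi)
      finally show ?case by (simp add: add_ac)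
    qed simp
    finally show ?thesis .
  qed
  have hb: "has_bochner_integral lborel \<phi> (of_real (exp (- pi * of_int m ^ 2 / c) / sqrt c))"
    unfolding \<phi>_def by (rule gaussian_fourier[OF c])
  have int: "set_integrable lborel A \<phi>" if "A \<in> sets borel" for A
    using hb that by (auto simp: has_bochner_integral_iff set_integrable_def intro!: integrable_mult_indicator)
  have un: "(\<Union>N. {- real N..real N + 1}) = UNIV"
  proof -
    have "x \<in> (\<Union>N. {- real N..real N + 1})" for x
    proof -
      obtain N where "\<bar>x\<bar> \<le> real N" using real_arch_simple by blast
      hence "x \<in> {- real N..real N + 1}" by auto
      thus ?thesis by blast
    qed
    thus ?thesis by auto
  qed
  have "(\<lambda>N. LINT x:{- real N..real N + 1}|lborel. \<phi> x) \<longlonglongrightarrow> (LINT x:(\<Union>N. {- real N..real N + 1})|lborel. \<phi> x)"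
    by (rule set_integral_cont_up) (auto simp: un incseq_def intro!: int)
  also have "(\<lambda>N. LINT x:{- real N..real N + 1}|lborel. \<phi> x) = (\<lambda>N. I {- int N..int N})"
    by (subst set_borel_integral_eq_integral(2)) (auto simp: IN intro!: int)
  also have "(LINT x:(\<Union>N. {- real N..real N + 1})|lborel. \<phi> x) = of_real (exp (- pi * of_int m ^ 2 / c) / sqrt c)"
    using hb unfolding un set_lebesgue_integral_def by (simp add: has_bochner_integral_iff)
  finally have "(\<lambda>N. I {- int N..int N}) \<longlonglongrightarrow> of_real (exp (- pi * of_int m ^ 2 / c) / sqrt c)" .
  moreover have "(\<lambda>N. I {- int N..int N}) \<longlonglongrightarrow> J"
    by (rule filterlim_compose[OF IJ(3) filterlim_symmetric_int_intervals])
  ultimately have "J = of_real (exp (- pi * of_int m ^ 2 / c) / sqrt c)"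
    using LIMSEQ_unique by blast
  with IJ(2) show ?thesis by simp
qed

lemma has_integral_qexp_int:
  "((\<lambda>h. qexp (of_real (of_int m * h))) has_integral (if m = 0 then 1 else 0)) {0..1}"
proof (cases "m = 0")
  case True
  thus ?thesis using has_integral_const_real[of "1 :: complex" 0 1] by simp
next
  case False
  have "((\<lambda>h. qexp (of_real (of_int m * h))) has_integral
     (qexp (of_real (of_int m * 1)) / (2 * of_real pi * \<i> * of_int m) - qexp (of_real (of_int m * 0)) / (2 * of_real pi * \<i> * of_int m))) {0..1}"
  proof (intro fundamental_theorem_of_calculus)
    fix x :: real
    have "((\<lambda>z. qexp (of_int m * z) / (2 * of_real pi * \<i> * of_int m)) has_field_derivative qexp (of_int m * of_real x)) (at (of_real x))"
      unfolding qexp_def using False by (auto intro!: derivative_eq_intros)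
    from has_vector_derivative_real_field[OF this, of "{0..1}"]
    show "((\<lambda>h. qexp (of_real (of_int m * h)) / (2 * of_real pi * \<i> * of_int m)) has_vector_derivative qexp (of_real (of_int m * x))) (at x within {0..1})"
      by simp
  qed auto
  thus ?thesis using False by simp
qed

text \<open>Both sides are continuous in \<open>h\<close>, take equal values at 0 and 1, and have
  the same Fourier coefficients.\<close>

lemma poisson_gaussian_real:
  assumes c: "c > (0 :: real)" and h: "h \<in> {0..1}"
  shows "(\<Sum>\<^sub>\<infinity>n :: int. of_real (exp (- (pi * c) * (of_int n + h) ^ 2))) =
    (\<Sum>\<^sub>\<infinity>n :: int. of_real (exp (- pi * of_int n ^ 2 / c)) * qexp (of_real (of_int n * h))) / of_real (sqrt c)"
proof -
  define f where "f = (\<lambda>h. \<Sum>\<^sub>\<infinity>n :: int. complex_of_real (exp (- (pi * c) * (of_int n + h) ^ 2)))"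
  define g where "g = (\<lambda>h. \<Sum>\<^sub>\<infinity>n :: int. of_real (exp (- pi * of_int n ^ 2 / c)) * qexp (of_real (of_int n * h)))"
  have unif: "uniform_limit {0..1} (\<lambda>N h. \<Sum>n\<in>N. complex_of_real (exp (- (pi * c) * (of_int n + h) ^ 2))) f (finite_subsets_at_top UNIV)"
    unfolding f_def by (rule uniform_limit_on_subset[OF gaussian_uniform_limit[of "pi * c" 1]]) (use c in auto)
  have contf: "continuous_on {0..1} f"
    by (rule uniform_limit_theorem[OF _ unif]) (auto intro!: always_eventually continuous_intros)
  have unig: "uniform_limit {0..1} (\<lambda>N h. (\<Sum>n\<in>N. of_real (exp (- pi * of_int n ^ 2 / c)) * qexp (of_real (of_int n * h))) * qexp (of_real (of_int m * h)))
     (\<lambda>h. g h * qexp (of_real (of_int m * h))) (finite_subsets_at_top UNIV)" for m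
  proof (rule uniform_limitI, goal_cases)
    case (1 e)
    have "uniform_limit {0..1} (\<lambda>N h. \<Sum>n\<in>N. of_real (exp (- pi * of_int n ^ 2 / c)) * qexp (of_real (of_int n * h))) g (finite_subsets_at_top UNIV)"
      unfolding g_def
    proof (rule Weierstrass_m_test_general)
      show "(\<lambda>n :: int. exp (- (pi / c) * (of_int n + 0) ^ 2)) summable_on UNIV"
        by (rule gaussian_summable) (use c in auto)
    qed (auto simp: norm_mult norm_qexp)
    from uniform_limitD[OF this 1] show ?case
      by eventually_elim (simp add: dist_norm norm_mult norm_qexp flip: left_diff_distrib)
  qed
  have contg: "continuous_on {0..1} g"
  proof -
    have "continuous_on {0..1} (\<lambda>h. g h * qexp (of_real (of_int 0 * h)))"
      by (rule uniform_limit_theorem[OF _ unig[of 0]]) (auto intro!: always_eventually continuous_intros)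
    thus ?thesis by simp
  qed
  have intg: "((\<lambda>h. g h * qexp (of_real (of_int m * h))) has_integral of_real (exp (- pi * of_int m ^ 2 / c))) {0..1}" for m
  proof -
    obtain I J where IJ: "\<And>N. ((\<lambda>h. (\<Sum>n\<in>N. of_real (exp (- pi * of_int n ^ 2 / c)) * qexp (of_real (of_int n * h))) * qexp (of_real (of_int m * h))) has_integral I N) {0..1}"
      "((\<lambda>h. g h * qexp (of_real (of_int m * h))) has_integral J) {0..1}"
      "(I \<longlongrightarrow> J) (finite_subsets_at_top UNIV)"
      by (rule uniform_limit_integral[OF unig[of m]]) (auto intro!: continuous_intros)
    \<comment> \<open>By orthogonality only the term n = -m survives, so the integrals are constant
      once the finite set contains -m.\<close>
    have "I N = of_real (exp (- pi * of_int m ^ 2 / c))" if N: "finite N" "- m \<in> N" for N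
    proof -
      have "((\<lambda>h. \<Sum>n\<in>N. of_real (exp (- pi * of_int n ^ 2 / c)) * qexp (of_real (of_int (n + m) * h))) has_integral
        (\<Sum>n\<in>N. of_real (exp (- pi * of_int n ^ 2 / c)) * (if n + m = 0 then 1 else 0))) {0..1}"
        by (intro has_integral_sum has_integral_mult_right has_integral_qexp_int N)
      also have "(\<lambda>h. \<Sum>n\<in>N. of_real (exp (- pi * of_int n ^ 2 / c)) * qexp (of_real (of_int (n + m) * h)))
        = (\<lambda>h. (\<Sum>n\<in>N. of_real (exp (- pi * of_int n ^ 2 / c)) * qexp (of_real (of_int n * h))) * qexp (of_real (of_int m * h)))"
        by (simp add: sum_distrib_right sum_distrib_left qexp_add ring_distribs mult_ac)
      finally have "I N = (\<Sum>n\<in>N. of_real (exp (- pi * of_int n ^ 2 / c)) * (if n + m = 0 then 1 else 0))"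
        using IJ(1)[of N] has_integral_unique by blast
      also have "\<dots> = (\<Sum>n\<in>{- m}. of_real (exp (- pi * of_int n ^ 2 / c)) * (if n + m = 0 then 1 else 0))"
        by (rule sum.mono_neutral_right) (use N in auto)
      finally show ?thesis by simp
    qed
    hence "eventually (\<lambda>N. I N = of_real (exp (- pi * of_int m ^ 2 / c))) (finite_subsets_at_top UNIV)"
      unfolding eventually_finite_subsets_at_top by (intro exI[of _ "{- m}"]) auto
    hence "(I \<longlongrightarrow> of_real (exp (- pi * of_int m ^ 2 / c))) (finite_subsets_at_top UNIV)"
      by (rule tendsto_eventually)
    with IJ(3) have "J = of_real (exp (- pi * of_int m ^ 2 / c))"
      using tendsto_unique[OF finite_subsets_at_top_neq_bot] by blast
    thus ?thesis using IJ(2) by simp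
  qed
  have "f h - g h / of_real (sqrt c) = 0"
  proof (rule fourier_uniqueness[where D = "\<lambda>h. f h - g h / of_real (sqrt c)"])
    show "continuous_on {0..1} (\<lambda>h. f h - g h / of_real (sqrt c))"
      by (intro continuous_intros contf contg) (use c in auto)
    have "f 0 = f 1"
      unfolding f_def
      by (rule infsum_reindex_bij_witness[of _ "\<lambda>n. n + 1" "\<lambda>n. n - 1"]) auto
    moreover have "g 0 = g 1"
      unfolding g_def by simp
    ultimately show "f 0 - g 0 / of_real (sqrt c) = f 1 - g 1 / of_real (sqrt c)" by simp
    fix m :: int
    have "((\<lambda>h. f h * qexp (of_real (of_int m * h)) - (g h * qexp (of_real (of_int m * h))) / of_real (sqrt c)) has_integral
       (of_real (exp (- pi * of_int m ^ 2 / c) / sqrt c) - of_real (exp (- pi * of_int m ^ 2 / c)) / of_real (sqrt c))) {0..1}"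
      using gaussian_periodization_fourier[OF c, of m] intg[of m]
      by (intro has_integral_diff has_integral_divide) (auto simp: f_def)
    thus "integral {0..1} (\<lambda>h. (f h - g h / of_real (sqrt c)) * qexp (of_real (of_int m * h))) = 0"
      by (simp add: integral_unique ring_distribs)
  qed (rule h)
  thus ?thesis by (simp add: f_def g_def)
qed

subsection \<open>Holomorphic families of exponentials\<close>

text \<open>Near \<open>z0\<close> the imaginary part stays above half of its value at
  \<open>z0\<close>; summability at that height gives locally uniform convergence.\<close>

lemma holomorphic_qexp_sum:
  fixes a :: "'i \<Rightarrow> real" and w :: "'i \<Rightarrow> complex"
  assumes a: "\<And>i. i \<in> X \<Longrightarrow> a i \<ge> 0"
    and sum: "\<And>y. y > 0 \<Longrightarrow> (\<lambda>i. norm (w i) * exp (- 2 * pi * y * a i)) summable_on X"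
  shows "(\<lambda>z. \<Sum>\<^sub>\<infinity>i\<in>X. w i * qexp (z * of_real (a i))) holomorphic_on uhp"
proof -
  have "(\<lambda>z. \<Sum>\<^sub>\<infinity>i\<in>X. w i * qexp (z * of_real (a i))) holomorphic_on ball z0 (Im z0 / 2)" if z0: "Im z0 > 0" for z0
  proof -
    define r where "r = Im z0 / 2"
    have r: "r > 0" using z0 by (simp add: r_def)
    have unif: "uniform_limit (cball z0 r) (\<lambda>N z. \<Sum>i\<in>N. w i * qexp (z * of_real (a i)))
      (\<lambda>z. \<Sum>\<^sub>\<infinity>i\<in>X. w i * qexp (z * of_real (a i))) (finite_subsets_at_top X)"
    proof (rule Weierstrass_m_test_general[OF _ sum[OF r]])
      fix i z assume i: "i \<in> X" and z: "z \<in> cball z0 r"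
      have "\<bar>Im (z0 - z)\<bar> \<le> r" using z abs_Im_le_cmod[of "z0 - z"] by (auto simp: dist_norm)
      hence "Im z0 - Im z \<le> r" by (metis abs_ge_self minus_complex.simps(2) order_trans)
      hence "r \<le> Im z" by (simp add: r_def)
      hence "r * a i \<le> Im z * a i" using a[OF i] by (intro mult_right_mono)
      thus "norm (w i * qexp (z * of_real (a i))) \<le> norm (w i) * exp (- 2 * pi * r * a i)"
        by (auto simp: norm_mult norm_qexp mult.assoc intro!: mult_left_mono)
    qed
    have "continuous_on (cball z0 r) (\<lambda>z. \<Sum>\<^sub>\<infinity>i\<in>X. w i * qexp (z * of_real (a i))) \<and>
      (\<lambda>z. \<Sum>\<^sub>\<infinity>i\<in>X. w i * qexp (z * of_real (a i))) holomorphic_on ball z0 r"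
      by (rule holomorphic_uniform_limit[OF _ unif])
         (auto intro!: always_eventually continuous_intros holomorphic_intros)
    thus ?thesis by (simp add: r_def)
  qed
  hence "(\<lambda>z. \<Sum>\<^sub>\<infinity>i\<in>X. w i * qexp (z * of_real (a i))) analytic_on {z}" if "z \<in> uhp" for z
    using that unfolding analytic_on_def by (auto intro!: exI[of _ "Im z / 2"])
  hence "(\<lambda>z. \<Sum>\<^sub>\<infinity>i\<in>X. w i * qexp (z * of_real (a i))) analytic_on uhp"
    using analytic_on_analytic_at by blast
  thus ?thesis by (rule analytic_imp_holomorphic)
qed

text \<open>The branch of (-iz)^(-1/2) that is positive on the imaginary axis. As -iz has positive
  real part on the upper half-plane, the principal root is holomorphic there.\<close>

definition inv_sqrt_uhp :: "complex \<Rightarrow> complex" where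
  "inv_sqrt_uhp z = inverse (csqrt (- \<i> * z))"

lemma inv_sqrt_uhp_nonzero: "Im z > 0 \<Longrightarrow> inv_sqrt_uhp z \<noteq> 0"
  by (auto simp: inv_sqrt_uhp_def)

lemma csqrt_of_real_times:
  assumes "t > 0"
  shows "csqrt (of_real t * z) = of_real (sqrt t) * csqrt z"
proof (rule csqrt_unique)
  show "(of_real (sqrt t) * csqrt z)\<^sup>2 = of_real t * z"
    using assms by (simp add: power_mult_distrib flip: of_real_power)
  show "0 < Re (of_real (sqrt t) * csqrt z) \<or> Re (of_real (sqrt t) * csqrt z) = 0 \<and> 0 \<le> Im (of_real (sqrt t) * csqrt z)"
    using assms csqrt_principal[of z] by (auto simp: zero_less_mult_iff)
qed

lemma inv_sqrt_uhp_scale: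
  "t > 0 \<Longrightarrow> inv_sqrt_uhp (of_real t * z) = inv_sqrt_uhp z / of_real (sqrt t)"
  using csqrt_of_real_times[of t "- \<i> * z"]
  by (simp add: inv_sqrt_uhp_def mult_ac divide_inverse)

lemma norm_inv_sqrt_uhp: "norm (inv_sqrt_uhp z) = 1 / sqrt (norm z)"
  by (simp add: inv_sqrt_uhp_def norm_inverse norm_mult divide_inverse)

lemma holomorphic_inv_sqrt_uhp: "inv_sqrt_uhp holomorphic_on uhp"
  unfolding inv_sqrt_uhp_def
  by (intro holomorphic_intros) (auto simp: complex_nonpos_Reals_iff)

lemma uhp_minus_inverse: "Im z > 0 \<Longrightarrow> Im (- 1 / z) > 0"
  by (auto simp: Im_divide zero_less_divide_iff sum_power2_gt_zero_iff)

text \<open>At z = iy this is the real formula with c = 2yt; the identity theorem extends it to the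
  upper half-plane.\<close>

lemma poisson_gaussian:
  fixes t h :: real
  assumes z: "Im z > 0" and t: "t > 0"
  shows "(\<Sum>\<^sub>\<infinity>n :: int. qexp (z * of_real (t * (of_int n + h) ^ 2))) =
    inv_sqrt_uhp z / of_real (sqrt (2 * t)) *
    (\<Sum>\<^sub>\<infinity>m :: int. qexp (of_real (of_int m * h)) * qexp (- 1 / z * of_real (of_int m ^ 2 / (4 * t))))"
proof -
  define F where "F = (\<lambda>h z. \<Sum>\<^sub>\<infinity>n :: int. qexp (z * of_real (t * (of_int n + h) ^ 2)))"
  define G where "G = (\<lambda>h z. \<Sum>\<^sub>\<infinity>m :: int. qexp (of_real (of_int m * h)) * qexp (z * of_real (of_int m ^ 2 / (4 * t))))"
  \<comment> \<open>The real formula covers \<open>h\<close> in [0, 1]; both sides have period one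
    in \<open>h\<close>.\<close>
  define k where "k = frac h"
  have k: "k \<in> {0..1}" using frac_ge_0[of h] frac_lt_1[of h] by (simp add: k_def)
  have h: "h = k + of_int \<lfloor>h\<rfloor>" by (simp add: k_def frac_def)
  have Fk: "F h = F k"
    unfolding F_def
    by (intro ext infsum_reindex_bij_witness[of _ "\<lambda>n. n - \<lfloor>h\<rfloor>" "\<lambda>n. n + \<lfloor>h\<rfloor>"])
       (simp_all add: k_def frac_def algebra_simps)
  have Gk: "G h = G k"
  proof -
    have "qexp (of_real (of_int m * h)) = qexp (of_real (of_int m * k))" for m
      using qexp_of_int[of "m * \<lfloor>h\<rfloor>"] by (subst h) (simp add: ring_distribs qexp_add)
    thus ?thesis by (simp add: G_def)
  qed
  have F_holo: "F k holomorphic_on uhp"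
  proof -
    have "(\<lambda>z. \<Sum>\<^sub>\<infinity>n :: int. 1 * qexp (z * of_real (t * (of_int n + k) ^ 2))) holomorphic_on uhp"
    proof (rule holomorphic_qexp_sum)
      fix y :: real assume "y > 0"
      hence "(\<lambda>n :: int. exp (- (2 * pi * y * t) * (of_int n + k) ^ 2)) summable_on UNIV"
        using t by (intro gaussian_summable) auto
      thus "(\<lambda>n :: int. norm (1 :: complex) * exp (- 2 * pi * y * (t * (of_int n + k) ^ 2))) summable_on UNIV"
        by (simp add: mult_ac)
    qed (use t in auto)
    thus ?thesis by (simp add: F_def)
  qed
  have G_holo: "G k holomorphic_on uhp"
    unfolding G_def
  proof (rule holomorphic_qexp_sum)
    fix y :: real assume "y > 0"
    hence "(\<lambda>n :: int. exp (- (2 * pi * y / (4 * t)) * (of_int n + 0) ^ 2)) summable_on UNIV"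
      using t by (intro gaussian_summable) auto
    thus "(\<lambda>n :: int. norm (qexp (of_real (of_int n * k))) * exp (- 2 * pi * y * (of_int n ^ 2 / (4 * t)))) summable_on UNIV"
      by (simp add: norm_qexp mult.assoc)
  qed (use t in auto)
  define D where "D = (\<lambda>z. F k z - inv_sqrt_uhp z / of_real (sqrt (2 * t)) * G k (- 1 / z))"
  have "D z = 0"
  proof (rule analytic_continuation[of D uhp "(\<lambda>y. of_real y * \<i>) ` {0<..}" \<i>])
    have "(\<lambda>z. G k (- 1 / z)) holomorphic_on uhp"
    proof (rule holomorphic_on_compose_gen[OF _ G_holo, unfolded o_def])
      show "(\<lambda>z. - 1 / z) holomorphic_on uhp" by (intro holomorphic_intros) auto
      show "(\<lambda>z. - 1 / z) ` uhp \<subseteq> uhp" using uhp_minus_inverse by blast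
    qed
    thus "D holomorphic_on uhp"
      unfolding D_def using t by (intro holomorphic_intros F_holo holomorphic_inv_sqrt_uhp) auto
    show "open uhp" by (rule open_halfspace_Im_gt)
    show "connected uhp" by (intro convex_connected convex_halfspace_Im_gt)
    show "\<i> islimpt (\<lambda>y. of_real y * \<i>) ` {0<..}"
    proof (rule islimptI)
      fix T :: "complex set" assume T: "\<i> \<in> T" "open T"
      then obtain e where e: "e > 0" "ball \<i> e \<subseteq> T" by (auto simp: open_contains_ball)
      have "dist \<i> (of_real (1 + e / 2) * \<i>) = norm (of_real (e / 2) * \<i>)"
        by (simp add: dist_norm algebra_simps norm_minus_commute)
      also have "\<dots> < e" using e by (simp add: norm_mult)
      finally have "of_real (1 + e / 2) * \<i> \<in> T" using e by auto
      moreover have "of_real (1 + e / 2) * \<i> \<noteq> \<i>" using e by (simp add: complex_eq_iff)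
      ultimately show "\<exists>y\<in>(\<lambda>y. of_real y * \<i>) ` {0<..}. y \<in> T \<and> y \<noteq> \<i>"
        using e by (intro bexI[of _ "of_real (1 + e / 2) * \<i>"] image_eqI[of _ _ "1 + e / 2"]) auto
    qed
    show "D w = 0" if "w \<in> (\<lambda>y. of_real y * \<i>) ` {0<..}" for w
    proof -
      from that obtain y where y: "y > 0" "w = of_real y * \<i>" by auto
      have c: "2 * y * t > 0" using y t by simp
      have F: "F k w = (\<Sum>\<^sub>\<infinity>n :: int. of_real (exp (- (pi * (2 * y * t)) * (of_int n + k) ^ 2)))"
        unfolding F_def qexp_def y(2) by (simp add: algebra_simps flip: exp_of_real)
      have G: "G k (- 1 / w) = (\<Sum>\<^sub>\<infinity>n :: int. of_real (exp (- pi * of_int n ^ 2 / (2 * y * t))) * qexp (of_real (of_int n * k)))"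
        unfolding G_def
      proof (rule infsum_cong)
        fix n :: int
        have "qexp (- 1 / w * of_real (of_int n ^ 2 / (4 * t))) = of_real (exp (- pi * of_int n ^ 2 / (2 * y * t)))"
          unfolding qexp_def y(2) using y(1) t by (simp add: divide_simps mult_ac flip: exp_of_real)
        thus "qexp (of_real (of_int n * k)) * qexp (- 1 / w * of_real (of_int n ^ 2 / (4 * t))) =
          of_real (exp (- pi * of_int n ^ 2 / (2 * y * t))) * qexp (of_real (of_int n * k))" by simp
      qed
      have "inv_sqrt_uhp w / of_real (sqrt (2 * t)) = 1 / of_real (sqrt (2 * y * t))"
        unfolding inv_sqrt_uhp_def y(2) using y(1) t
        by (simp add: real_sqrt_mult divide_inverse mult_ac csqrt_of_real_nonneg)
      thus ?thesis
        unfolding D_def F G poisson_gaussian_real[OF c k] by simp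
    qed
  qed (use z in auto)
  hence "F h z = inv_sqrt_uhp z / of_real (sqrt (2 * t)) * G h (- 1 / z)"
    by (simp add: D_def Fk Gk)
  thus ?thesis unfolding F_def G_def .
qed

subsection \<open>The Jacobi theta function has no zeros\<close>

context
  fixes q :: complex
  assumes q: "norm q < 1"
begin

text \<open>The q-Pochhammer symbol (q^2; q^2)_j.\<close>

definition qprod :: "nat \<Rightarrow> complex" where
  "qprod j = (\<Prod>i<j. 1 - q ^ (2 * Suc i))"

text \<open>The terms of the finite form of the Jacobi triple product at \<open>z = 1\<close>. For \<open>N \<rightarrow> \<infinity>\<close> they tend to a non-zero multiple of \<open>q ^ m\<^sup>2\<close>.\<close>

definition gauss_coeff :: "nat \<Rightarrow> nat \<Rightarrow> complex" where
  "gauss_coeff N m = (if m \<le> N then q ^ (m ^ 2) * qprod (2 * N) / (qprod (N - m) * qprod (N + m)) else 0)"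

lemma power_q_ne_1: "n > 0 \<Longrightarrow> 1 - q ^ n \<noteq> 0"
proof
  assume "n > 0" "1 - q ^ n = 0"
  hence "norm q ^ n = 1" by (metis norm_one norm_power right_minus_eq)
  thus False using q \<open>n > 0\<close> power_Suc_less_one[of "norm q" "n - 1"] power_eq_1_iff[of "norm q" n] by auto
qed

lemma qprod_Suc: "qprod (Suc j) = qprod j * (1 - q ^ (2 * Suc j))"
  by (simp add: qprod_def)

lemma qprod_double_Suc:
  "qprod (2 * Suc N) = qprod (2 * N) * ((1 - q ^ (4 * N + 2)) * (1 - q ^ (4 * N + 4)))"
proof -
  have "2 * Suc N = Suc (Suc (2 * N))" "2 * Suc (2 * N) = 4 * N + 2" "2 * Suc (Suc (2 * N)) = 4 * N + 4"
    by simp_all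
  thus ?thesis by (simp only: qprod_Suc mult.assoc)
qed

lemma qprod_nonzero: "qprod j \<noteq> 0"
  unfolding qprod_def using power_q_ne_1 by (auto simp del: mult_Suc_right)

text \<open>The recursion for \<open>gauss_coeff\<close> with denominators cleared, where w =
  q^(m^2), c = q^2, a = q^(2(N-m)) and b = q^(2(N+m)).\<close>

lemma gauss_coeff_identity_aux:
  fixes a b c w :: complex
  shows "w * (1 - c * a * b) * (1 - c\<^sup>2 * a * b) =
     (1 + c * a * b) * (w * ((1 - c * a) * (1 - c * b)))
       + c * a * w * ((1 - c * b) * (1 - b)) + c * b * w * ((1 - a) * (1 - c * a))"
  by (simp add: algebra_simps power2_eq_square)

text \<open>\<open>gauss_coeff N m\<close> is the coefficient of z^m and of z^(-m) in the product of
  (1 + z q^(2n+1)) (1 + q^(2n+1) / z) over n < N. The next factor expands to 1 + q^(4N+2) + q^(2N+1)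
  (z + 1/z).\<close>

lemma gauss_coeff_Suc:
  assumes m: "m > 0"
  shows "gauss_coeff (Suc N) m = (1 + q ^ (4 * N + 2)) * gauss_coeff N m
     + q ^ (2 * N + 1) * (gauss_coeff N (m - 1) + gauss_coeff N (Suc m))"
proof -
  consider "m > Suc N" | "m = Suc N" | "m \<le> N" by linarith
  thus ?thesis
  proof cases
    case 1
    thus ?thesis by (simp add: gauss_coeff_def)
  next
    case 2
    have "q ^ (Suc N ^ 2) = q ^ (2 * N + 1) * q ^ (N ^ 2)"
      by (simp add: power2_eq_square mult_2 add_ac flip: power_add)
    thus ?thesis using 2 qprod_nonzero[of "2 * Suc N"] qprod_nonzero[of "2 * N"]
      by (simp add: gauss_coeff_def qprod_def[of 0] mult_2)
  next
    case 3
    define M where "M = N - m"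
    have N: "N = M + m" using 3 by (simp add: M_def)
    obtain l where l: "m = Suc l" using m by (cases m) auto
    define a b c w where "a = q ^ (2 * M)" and "b = q ^ (2 * (N + m))" and "c = q ^ 2" and "w = q ^ (m ^ 2)"
    \<comment> \<open>A common denominator of all four coefficients in the recursion.\<close>
    define D where "D = qprod (Suc M) * qprod (Suc N + m)"
    have D: "D \<noteq> 0" by (simp add: D_def qprod_nonzero)
    have p1: "qprod (Suc M) = qprod M * (1 - c * a)"
      by (simp add: qprod_Suc c_def a_def flip: power_add)
    have p2: "qprod (Suc N + m) = qprod (N + m) * (1 - c * b)"
      by (simp add: qprod_Suc c_def b_def flip: power_add)
    have p3: "qprod (N + m) = qprod (N + l) * (1 - b)"
      unfolding l b_def by (simp add: qprod_Suc)
    have p4: "M = Suc K \<Longrightarrow> qprod M = qprod K * (1 - a)" for K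
      by (simp add: qprod_Suc a_def)
    have cab: "q ^ (4 * N + 2) = c * a * b"
      unfolding a_def b_def c_def by (simp add: N algebra_simps flip: power_add)
    have e1: "q ^ (2 * N + 1) * q ^ (l ^ 2) = c * a * w"
      unfolding a_def w_def c_def by (simp add: N l power2_eq_square algebra_simps flip: power_add)
    have e2: "q ^ (2 * N + 1) * q ^ (Suc m ^ 2) = c * b * w"
      unfolding b_def w_def c_def by (simp add: power2_eq_square algebra_simps flip: power_add)
    have expand: "x * y / (k * n) = y * (x * v) / (k * (n * v))" if "v \<noteq> 0" for x y k n v :: complex
      using that by simp
    have r1: "gauss_coeff N m = qprod (2 * N) * (w * ((1 - c * a) * (1 - c * b))) / D"
    proof -
      have v: "(1 - c * a) * (1 - c * b) \<noteq> 0"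
        using D unfolding D_def p1 p2 by simp
      have De: "D = qprod M * (qprod (N + m) * ((1 - c * a) * (1 - c * b)))"
        unfolding D_def p1 p2 by (simp only: mult_ac)
      have "gauss_coeff N m = w * qprod (2 * N) / (qprod M * qprod (N + m))"
        using 3 by (simp add: gauss_coeff_def M_def w_def)
      also have "\<dots> = qprod (2 * N) * (w * ((1 - c * a) * (1 - c * b))) / D"
        unfolding De by (rule expand[OF v])
      finally show ?thesis .
    qed
    have r2: "q ^ (2 * N + 1) * gauss_coeff N (m - 1) = qprod (2 * N) * (c * a * w * ((1 - c * b) * (1 - b))) / D"
    proof -
      have v: "(1 - c * b) * (1 - b) \<noteq> 0"
        using D qprod_nonzero[of "N + m"] unfolding D_def p2 p3 by simp
      have De: "D = qprod (Suc M) * (qprod (N + l) * ((1 - c * b) * (1 - b)))"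
        unfolding D_def p2 p3 by (simp only: mult_ac)
      have "N - l = Suc M" using l 3 by (simp add: M_def)
      hence "q ^ (2 * N + 1) * gauss_coeff N (m - 1) = (q ^ (2 * N + 1) * q ^ (l ^ 2)) * qprod (2 * N) / (qprod (Suc M) * qprod (N + l))"
        using l 3 by (simp add: gauss_coeff_def)
      also have "\<dots> = qprod (2 * N) * (c * a * w * ((1 - c * b) * (1 - b))) / D"
        unfolding e1 De by (rule expand[OF v])
      finally show ?thesis .
    qed
    have r3: "q ^ (2 * N + 1) * gauss_coeff N (Suc m) = qprod (2 * N) * (c * b * w * ((1 - a) * (1 - c * a))) / D"
    proof (cases M)
      case 0
      hence "a = 1" "\<not> Suc m \<le> N" using N by (auto simp: a_def)
      thus ?thesis by (simp add: gauss_coeff_def)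
    next
      case (Suc K)
      have v: "(1 - a) * (1 - c * a) \<noteq> 0"
        using D unfolding D_def p1 p4[OF Suc] by simp
      have De: "D = qprod K * (qprod (Suc N + m) * ((1 - a) * (1 - c * a)))"
        unfolding D_def p1 p4[OF Suc] by (simp only: mult_ac)
      have "N - Suc m = K" "Suc m \<le> N" using N Suc by auto
      hence "q ^ (2 * N + 1) * gauss_coeff N (Suc m) = (q ^ (2 * N + 1) * q ^ (Suc m ^ 2)) * qprod (2 * N) / (qprod K * qprod (Suc N + m))"
        by (simp add: gauss_coeff_def)
      also have "\<dots> = qprod (2 * N) * (c * b * w * ((1 - a) * (1 - c * a))) / D"
        unfolding e2 De by (rule expand[OF v])
      finally show ?thesis .
    qed
    have "gauss_coeff (Suc N) m = w * qprod (2 * Suc N) / D"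
      using 3 by (simp add: gauss_coeff_def D_def w_def M_def Suc_diff_le)
    also have "qprod (2 * Suc N) = qprod (2 * N) * ((1 - c * a * b) * (1 - c\<^sup>2 * a * b))"
    proof -
      have "4 * N + 4 = 2 + (4 * N + 2)" by simp
      hence "q ^ (4 * N + 4) = c * q ^ (4 * N + 2)" by (simp only: c_def power_add)
      hence "q ^ (4 * N + 4) = c\<^sup>2 * a * b" unfolding cab by (simp add: power2_eq_square)
      thus ?thesis by (simp only: qprod_double_Suc cab)
    qed
    also have "w * (qprod (2 * N) * ((1 - c * a * b) * (1 - c\<^sup>2 * a * b))) =
      qprod (2 * N) * (w * (1 - c * a * b) * (1 - c\<^sup>2 * a * b))" by simp
    also have "\<dots> = (1 + c * a * b) * (qprod (2 * N) * (w * ((1 - c * a) * (1 - c * b))))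
        + qprod (2 * N) * (c * a * w * ((1 - c * b) * (1 - b))) + qprod (2 * N) * (c * b * w * ((1 - a) * (1 - c * a)))"
      unfolding gauss_coeff_identity_aux by (simp only: ring_distribs mult_ac)
    also have "\<dots> / D = (1 + c * a * b) * gauss_coeff N m + q ^ (2 * N + 1) * gauss_coeff N (m - 1) + q ^ (2 * N + 1) * gauss_coeff N (Suc m)"
      unfolding r1 r2 r3 by (simp only: add_divide_distrib times_divide_eq_right)
    finally show ?thesis unfolding cab by (simp add: ring_distribs)
  qed
qed

text \<open>For the constant coefficient the two neighbours coincide by the symmetry between z and
  1/z, hence the factor 2.\<close>

lemma gauss_coeff_Suc_0:
  "gauss_coeff (Suc N) 0 = (1 + q ^ (4 * N + 2)) * gauss_coeff N 0 + 2 * q ^ (2 * N + 1) * gauss_coeff N 1"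
proof -
  define a c where "a = q ^ (2 * N)" and "c = q ^ 2"
  have p1: "qprod (Suc N) = qprod N * (1 - c * a)"
    by (simp add: qprod_Suc c_def a_def flip: power_add)
  define D where "D = qprod (Suc N) * qprod (Suc N)"
  have D: "D \<noteq> 0" by (simp add: D_def qprod_nonzero)
  have caa: "q ^ (4 * N + 2) = c * a * a"
    unfolding a_def c_def by (simp add: algebra_simps flip: power_add)
  have expand: "x * y / (k * n) = y * (x * v) / (k * (n * v))" if "v \<noteq> 0" for x y k n v :: complex
    using that by simp
  have r1: "gauss_coeff N 0 = qprod (2 * N) * (1 * ((1 - c * a) * (1 - c * a))) / D"
  proof -
    have v: "(1 - c * a) * (1 - c * a) \<noteq> 0"
      using D unfolding D_def p1 by simp
    have De: "D = qprod N * (qprod N * ((1 - c * a) * (1 - c * a)))"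
      unfolding D_def p1 by (simp only: mult_ac)
    have "gauss_coeff N 0 = 1 * qprod (2 * N) / (qprod N * qprod N)"
      by (simp add: gauss_coeff_def)
    also have "\<dots> = qprod (2 * N) * (1 * ((1 - c * a) * (1 - c * a))) / D"
      unfolding De by (rule expand[OF v])
    finally show ?thesis .
  qed
  have r3: "q ^ (2 * N + 1) * gauss_coeff N 1 = qprod (2 * N) * (c * a * ((1 - a) * (1 - c * a))) / D"
  proof (cases N)
    case 0
    thus ?thesis by (simp add: gauss_coeff_def a_def)
  next
    case (Suc K)
    have p4: "qprod N = qprod K * (1 - a)" unfolding Suc by (simp add: qprod_Suc a_def Suc)
    have e: "q ^ (2 * N + 1) * q = c * a" by (simp add: c_def a_def power2_eq_square)
    have v: "(1 - a) * (1 - c * a) \<noteq> 0"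
      using D unfolding D_def p1 p4 by simp
    have De: "D = qprod K * (qprod (Suc N) * ((1 - a) * (1 - c * a)))"
    proof -
      have "D = qprod (Suc N) * (qprod K * (1 - a) * (1 - c * a))" unfolding D_def p1 p4 ..
      thus ?thesis by (simp only: mult_ac)
    qed
    have "q ^ (2 * N + 1) * gauss_coeff N 1 = (q ^ (2 * N + 1) * q) * qprod (2 * N) / (qprod K * qprod (Suc N))"
      using Suc by (simp add: gauss_coeff_def)
    also have "\<dots> = qprod (2 * N) * (c * a * ((1 - a) * (1 - c * a))) / D"
      unfolding e De by (rule expand[OF v])
    finally show ?thesis .
  qed
  have "gauss_coeff (Suc N) 0 = qprod (2 * Suc N) / D"
    by (simp add: gauss_coeff_def D_def)
  also have "qprod (2 * Suc N) = qprod (2 * N) * ((1 - c * a * a) * (1 - c\<^sup>2 * a * a))"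
  proof -
    have "4 * N + 4 = 2 + (4 * N + 2)" by simp
    hence "q ^ (4 * N + 4) = c * q ^ (4 * N + 2)" by (simp only: c_def power_add)
    hence "q ^ (4 * N + 4) = c\<^sup>2 * a * a" unfolding caa by (simp add: power2_eq_square)
    thus ?thesis by (simp only: qprod_double_Suc caa)
  qed
  also have "qprod (2 * N) * ((1 - c * a * a) * (1 - c\<^sup>2 * a * a)) =
    (1 + c * a * a) * (qprod (2 * N) * (1 * ((1 - c * a) * (1 - c * a)))) + 2 * (qprod (2 * N) * (c * a * ((1 - a) * (1 - c * a))))"
    by (simp add: algebra_simps power2_eq_square)
  also have "\<dots> / D = (1 + c * a * a) * gauss_coeff N 0 + 2 * (q ^ (2 * N + 1) * gauss_coeff N 1)"
    unfolding r1 r3 by (simp only: add_divide_distrib times_divide_eq_right)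
  finally show ?thesis unfolding caa by (simp only: mult.assoc)
qed

definition gauss_poly :: "nat \<Rightarrow> complex" where
  "gauss_poly N = gauss_coeff N 0 + 2 * (\<Sum>m<N. gauss_coeff N (Suc m))"

text \<open>The sum of all coefficients is the value of the Laurent polynomial at z = 1, and each
  further factor contributes (1 + q^(2N+1))^2.\<close>

lemma gauss_poly_eq_prod: "gauss_poly N = (\<Prod>n<N. 1 + q ^ (2 * n + 1)) ^ 2"
proof (induction N)
  case 0
  show ?case by (simp add: gauss_poly_def gauss_coeff_def qprod_def)
next
  case (Suc N)
  let ?g = "gauss_coeff N"
  have s1: "(\<Sum>m<Suc N. ?g (Suc m)) = (\<Sum>m<N. ?g (Suc m))"
    by (simp add: gauss_coeff_def)
  have s2: "(\<Sum>m<Suc N. ?g m) = ?g 0 + (\<Sum>m<N. ?g (Suc m))"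
    by (rule sum.lessThan_Suc_shift)
  have s3: "(\<Sum>m<Suc N. ?g (Suc (Suc m))) = (\<Sum>m<N. ?g (Suc m)) - ?g 1"
  proof -
    have "(\<Sum>m<Suc (Suc N). ?g (Suc m)) = ?g 1 + (\<Sum>m<Suc N. ?g (Suc (Suc m)))"
      by (subst sum.lessThan_Suc_shift) simp
    moreover have "(\<Sum>m<Suc (Suc N). ?g (Suc m)) = (\<Sum>m<N. ?g (Suc m))"
      by (simp add: gauss_coeff_def)
    ultimately show ?thesis by (metis add_diff_cancel_left')
  qed
  have "(\<Sum>m<Suc N. gauss_coeff (Suc N) (Suc m)) = (\<Sum>m<Suc N. (1 + q ^ (4 * N + 2)) * ?g (Suc m) + q ^ (2 * N + 1) * (?g m + ?g (Suc (Suc m))))"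
    by (intro sum.cong refl) (simp add: gauss_coeff_Suc)
  also have "\<dots> = (1 + q ^ (4 * N + 2)) * (\<Sum>m<Suc N. ?g (Suc m)) + q ^ (2 * N + 1) * ((\<Sum>m<Suc N. ?g m) + (\<Sum>m<Suc N. ?g (Suc (Suc m))))"
    by (simp only: sum.distrib distrib_left sum_distrib_left)
  finally have sum_Suc: "(\<Sum>m<Suc N. gauss_coeff (Suc N) (Suc m)) = (1 + q ^ (4 * N + 2)) * (\<Sum>m<N. ?g (Suc m))
      + q ^ (2 * N + 1) * (?g 0 + (\<Sum>m<N. ?g (Suc m)) + ((\<Sum>m<N. ?g (Suc m)) - ?g 1))"
    unfolding s1 s2 s3 .
  have "gauss_poly (Suc N) = (1 + q ^ (4 * N + 2) + 2 * q ^ (2 * N + 1)) * gauss_poly N"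
    unfolding gauss_poly_def sum_Suc gauss_coeff_Suc_0 by (simp add: algebra_simps)
  also have "1 + q ^ (4 * N + 2) + 2 * q ^ (2 * N + 1) = (1 + q ^ (2 * N + 1)) ^ 2"
    by (simp add: power2_eq_square algebra_simps flip: power_add)
  finally show ?case unfolding Suc.IH by (simp add: power_mult_distrib mult_ac)
qed

text \<open>Strict monotonicity gives f n \<ge> n, so a geometric series controls the product, and
  |q| < 1 keeps every factor away from 0. It is meant for the products of 1 - q^(2n+2) and of 1 +
  q^(2n+1).\<close>

lemma convergent_to_nonzero_prod:
  fixes c :: complex
  assumes "norm c = 1" and "strict_mono f" and "\<And>n. f n > 0"
  obtains l where "l \<noteq> 0" "(\<lambda>N. \<Prod>n<N. 1 + c * q ^ f n) \<longlonglongrightarrow> l"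
proof -
  have "summable (\<lambda>n. norm q ^ f n)"
  proof (rule summable_comparison_test')
    show "summable (\<lambda>n. norm q ^ n)" using q by (intro summable_geometric) auto
    show "norm (norm q ^ f n) \<le> norm q ^ n" for n
      using q strict_mono_imp_increasing[OF assms(2), of n] by (auto intro: power_decreasing)
  qed
  hence "summable (\<lambda>n. norm ((1 + c * q ^ f n) - 1))"
    by (simp add: norm_mult norm_power assms)
  hence "abs_convergent_prod (\<lambda>n. 1 + c * q ^ f n)"
    by (subst abs_convergent_prod_conv_summable) simp
  hence conv: "convergent_prod (\<lambda>n. 1 + c * q ^ f n)"
    by (rule abs_convergent_prod_imp_convergent_prod)
  have "1 + c * q ^ f n \<noteq> 0" for n
  proof
    assume "1 + c * q ^ f n = 0"
    hence "norm (c * q ^ f n) = norm (- 1 :: complex)" by (metis add_eq_0_iff norm_minus_cancel)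
    hence "norm q ^ f n = 1" by (simp add: norm_mult norm_power assms)
    thus False using q assms(3)[of n] power_eq_1_iff[of "norm q" "f n"] by auto
  qed
  hence "prodinf (\<lambda>n. 1 + c * q ^ f n) \<noteq> 0"
    by (rule prodinf_nonzero[OF conv])
  moreover have "(\<lambda>N. \<Prod>n<N. 1 + c * q ^ f n) \<longlonglongrightarrow> prodinf (\<lambda>n. 1 + c * q ^ f n)"
    using convergent_prod_LIMSEQ[OF conv] by (subst (asm) lessThan_Suc_atMost[symmetric]) (rule LIMSEQ_imp_Suc)
  ultimately show ?thesis using that by blast
qed

text \<open>As N tends to infinity in \<open>gauss_poly_eq_prod\<close>, Tannery's theorem turns the
  left side into the theta value divided by the limit \<open>L\<close> of \<open>qprod\<close>,
  while the right side tends to the square of a non-zero product.\<close>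

lemma theta_nat_nonzero: "2 * (\<Sum>m. q ^ (m ^ 2)) - 1 \<noteq> 0"
proof -
  obtain L where L: "L \<noteq> 0" "qprod \<longlonglongrightarrow> L"
  proof (rule convergent_to_nonzero_prod[of "- 1" "\<lambda>i. 2 * Suc i"])
    fix l assume "l \<noteq> 0" "(\<lambda>N. \<Prod>n<N. 1 + - 1 * q ^ (2 * Suc n)) \<longlonglongrightarrow> l"
    thus thesis using that by (simp add: qprod_def[abs_def])
  qed (auto simp: strict_mono_def)
  obtain M where M: "M \<noteq> 0" "(\<lambda>N. \<Prod>n<N. 1 + 1 * q ^ (2 * n + 1)) \<longlonglongrightarrow> M"
    by (rule convergent_to_nonzero_prod[of 1 "\<lambda>i. 2 * i + 1"]) (auto simp: strict_mono_def)
  have lim1: "gauss_poly \<longlonglongrightarrow> M ^ 2"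
    using tendsto_power[OF M(2), of 2] by (simp add: gauss_poly_eq_prod[abs_def])
  obtain K1 where K1: "\<And>j. norm (qprod j) \<le> K1" "K1 > 0"
    using L(2) convergentI convergent_imp_Bseq BseqE by metis
  have "(\<lambda>j. inverse (qprod j)) \<longlonglongrightarrow> inverse L" using L by (intro tendsto_intros)
  then obtain K2 where K2: "\<And>j. norm (inverse (qprod j)) \<le> K2" "K2 > 0"
    using convergentI convergent_imp_Bseq BseqE by metis
  have bound: "norm (gauss_coeff N m) \<le> K1 * K2 * K2 * norm q ^ m" for N m
  proof (cases "m \<le> N")
    case True
    have "norm (gauss_coeff N m) = norm q ^ (m ^ 2) * norm (qprod (2 * N)) * norm (inverse (qprod (N - m))) * norm (inverse (qprod (N + m)))"
      using True by (simp add: gauss_coeff_def norm_mult norm_divide norm_power norm_inverse divide_inverse)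
    also have "\<dots> \<le> norm q ^ m * K1 * K2 * K2"
      using q K1 K2 self_le_power[of m 2]
      by (intro mult_mono power_decreasing) (auto simp: power2_eq_square less_imp_le)
    finally show ?thesis by (simp add: mult_ac)
  qed (use K1 K2 in \<open>auto simp: gauss_coeff_def\<close>)
  have lim2: "(\<lambda>N. gauss_coeff N m) \<longlonglongrightarrow> q ^ (m ^ 2) / L" for m
  proof -
    have a: "(\<lambda>N. qprod (2 * N)) \<longlonglongrightarrow> L"
      by (rule filterlim_compose[OF L(2)]) (auto intro!: filterlim_subseq simp: strict_mono_def)
    have b: "(\<lambda>N. qprod (N - m)) \<longlonglongrightarrow> L"
      by (rule filterlim_compose[OF L(2)]) (rule filterlim_minus_const_nat_at_top)
    have c: "(\<lambda>N. qprod (N + m)) \<longlonglongrightarrow> L"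
      by (rule LIMSEQ_ignore_initial_segment[OF L(2)])
    have "(\<lambda>N. q ^ (m ^ 2) * qprod (2 * N) / (qprod (N - m) * qprod (N + m))) \<longlonglongrightarrow> q ^ (m ^ 2) * L / (L * L)"
      using L by (intro tendsto_intros a b c) auto
    also have "q ^ (m ^ 2) * L / (L * L) = q ^ (m ^ 2) / L" using L by simp
    finally show ?thesis
      by (rule Lim_transform_eventually)
         (use eventually_ge_at_top[of m] in eventually_elim, simp add: gauss_coeff_def)
  qed
  have "(\<lambda>N. \<Sum>m. gauss_coeff N m) \<longlonglongrightarrow> (\<Sum>m. q ^ (m ^ 2) / L)"
  proof (rule tannerys_theorem[THEN conjunct2, THEN conjunct2])
    show "eventually (\<lambda>(m, N). norm (gauss_coeff N m) \<le> K1 * K2 * K2 * norm q ^ m) (at_top \<times>\<^sub>F sequentially)"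
      by (rule always_eventually) (use bound in auto)
    show "summable (\<lambda>m. K1 * K2 * K2 * norm q ^ m)"
      using q by (intro summable_mult summable_geometric) auto
  qed (rule lim2, simp)
  hence "(\<lambda>N. 2 * (\<Sum>m. gauss_coeff N m) - gauss_coeff N 0) \<longlonglongrightarrow> 2 * (\<Sum>m. q ^ (m ^ 2) / L) - q ^ (0 ^ 2) / L"
    by (intro tendsto_intros lim2)
  also have "(\<lambda>N. 2 * (\<Sum>m. gauss_coeff N m) - gauss_coeff N 0) = gauss_poly"
  proof
    fix N
    have "(\<Sum>m. gauss_coeff N m) = (\<Sum>m<Suc N. gauss_coeff N m)"
      by (rule suminf_finite) (auto simp: gauss_coeff_def)
    also have "\<dots> = gauss_coeff N 0 + (\<Sum>m<N. gauss_coeff N (Suc m))"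
      by (rule sum.lessThan_Suc_shift)
    finally show "2 * (\<Sum>m. gauss_coeff N m) - gauss_coeff N 0 = gauss_poly N"
      by (simp add: gauss_poly_def)
  qed
  finally have "2 * (\<Sum>m. q ^ (m ^ 2) / L) - q ^ (0 ^ 2) / L = M ^ 2"
    using lim1 LIMSEQ_unique by blast
  moreover have "(\<Sum>m. q ^ (m ^ 2) / L) = (\<Sum>m. q ^ (m ^ 2)) / L"
  proof (rule suminf_divide)
    show "summable (\<lambda>m. q ^ (m ^ 2))"
    proof (rule summable_comparison_test')
      show "summable (\<lambda>m. norm q ^ m)" using q by (intro summable_geometric) auto
      show "norm (q ^ (m ^ 2)) \<le> norm q ^ m" for m
        using q self_le_power[of m 2] by (auto simp: norm_power power2_eq_square intro!: power_decreasing)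
    qed
  qed
  ultimately have "(2 * (\<Sum>m. q ^ (m ^ 2)) - 1) / L = M ^ 2"
    by (simp add: diff_divide_distrib)
  thus ?thesis using M by auto
qed

end

lemma jacobi_theta_nonzero:
  assumes z: "Im z > 0"
  shows "jacobi_theta z \<noteq> 0"
proof -
  define q where "q = qexp z"
  have q: "norm q < 1" using z by (simp add: q_def norm_qexp)
  have exp_eq: "exp (2 * of_real pi * \<i> * of_int (n ^ 2) * z) = q ^ (nat \<bar>n\<bar> ^ 2)" for n
  proof -
    have "q ^ (nat \<bar>n\<bar> ^ 2) = exp (of_nat (nat \<bar>n\<bar> ^ 2) * (2 * of_real pi * \<i> * z))"
      unfolding q_def qexp_def by (rule exp_of_nat_mult[symmetric])
    also have "complex_of_nat (nat \<bar>n\<bar> ^ 2) = of_int (n ^ 2)"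
      by (simp flip: of_int_power)
    finally show ?thesis by (simp add: mult_ac)
  qed
  have "(\<lambda>n :: int. q ^ (nat \<bar>n\<bar> ^ 2)) summable_on UNIV"
  proof (rule abs_summable_summable, rule summable_on_comparison_test[OF powr_abs_summable_int])
    show "0 \<le> norm q" "norm q < 1" using q by auto
    fix n :: int
    show "norm (q ^ (nat \<bar>n\<bar> ^ 2)) \<le> norm q ^ nat \<bar>n\<bar>"
      using q self_le_power[of "nat \<bar>n\<bar>" 2] by (auto simp: norm_power power2_eq_square intro!: power_decreasing)
  qed auto
  hence "((\<lambda>n :: int. q ^ (nat \<bar>n\<bar> ^ 2)) has_sum jacobi_theta z) UNIV"
    unfolding jacobi_theta_def exp_eq by (rule has_sum_infsum)
  hence "(\<lambda>N. \<Sum>n\<in>{- int N..int N}. q ^ (nat \<bar>n\<bar> ^ 2)) \<longlonglongrightarrow> jacobi_theta z"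
    unfolding has_sum_def by (rule filterlim_compose[OF _ filterlim_symmetric_int_intervals])
  \<comment> \<open>Folding the two halves together counts the term at 0 twice, hence the
    subtraction of 1.\<close>
  also have "(\<lambda>N. \<Sum>n\<in>{- int N..int N}. q ^ (nat \<bar>n\<bar> ^ 2)) = (\<lambda>N. 2 * (\<Sum>m<Suc N. q ^ (m ^ 2)) - 1)"
  proof
    fix N
    show "(\<Sum>n\<in>{- int N..int N}. q ^ (nat \<bar>n\<bar> ^ 2)) = 2 * (\<Sum>m<Suc N. q ^ (m ^ 2)) - 1"
    proof (induction N)
      case (Suc N)
      have "{- int (Suc N)..int (Suc N)} = insert (- int (Suc N)) (insert (int (Suc N)) {- int N..int N})"
        by auto
      moreover have "nat (1 + int N) = Suc N" "nat (int N + 1) = Suc N" by auto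
      ultimately have "(\<Sum>n\<in>{- int (Suc N)..int (Suc N)}. q ^ (nat \<bar>n\<bar> ^ 2)) = 2 * q ^ (Suc N ^ 2) + (\<Sum>n\<in>{- int N..int N}. q ^ (nat \<bar>n\<bar> ^ 2))"
        by simp
      thus ?case using Suc by (simp add: algebra_simps)
    qed simp
  qed
  finally have lim: "(\<lambda>N. 2 * (\<Sum>m<Suc N. q ^ (m ^ 2)) - 1) \<longlonglongrightarrow> jacobi_theta z" .
  have "summable (\<lambda>m. q ^ (m ^ 2))"
  proof (rule summable_comparison_test')
    show "summable (\<lambda>m. norm q ^ m)" using q by (intro summable_geometric) auto
    show "norm (q ^ (m ^ 2)) \<le> norm q ^ m" for m
      using q self_le_power[of m 2] by (auto simp: norm_power power2_eq_square intro!: power_decreasing)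
  qed
  hence "(\<lambda>N. \<Sum>m<N. q ^ (m ^ 2)) \<longlonglongrightarrow> (\<Sum>m. q ^ (m ^ 2))"
    by (rule summable_LIMSEQ)
  hence "(\<lambda>N. 2 * (\<Sum>m<Suc N. q ^ (m ^ 2)) - 1) \<longlonglongrightarrow> 2 * (\<Sum>m. q ^ (m ^ 2)) - 1"
    by (intro tendsto_intros LIMSEQ_Suc)
  hence "jacobi_theta z = 2 * (\<Sum>m. q ^ (m ^ 2)) - 1"
    using lim LIMSEQ_unique by blast
  thus ?thesis using theta_nat_nonzero[OF q] by simp
qed

subsection \<open>Gauss sums and the Kronecker symbol\<close>

text \<open>The denominator keeps its sign because it will be the matrix entry \<delta>, which may
  be negative; negating it amounts to negating \<open>b\<close>.\<close>

definition gauss_sum :: "int \<Rightarrow> int \<Rightarrow> complex" where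
  "gauss_sum b m = (\<Sum>x\<in>{0..<\<bar>m\<bar>}. qexp (of_real (of_int (b * x ^ 2) / of_int m)))"

lemma gauss_sum_uminus: "gauss_sum b (- m) = gauss_sum (- b) m"
  by (simp add: gauss_sum_def)

lemma qexp_of_int_divide_cong:
  assumes "[x = y] (mod m)" "m \<noteq> 0"
  shows "qexp (of_real (of_int x / of_int m)) = qexp (of_real (of_int y / of_int m))"
proof -
  obtain k where k: "x = y + m * k"
    using assms(1) by (metis cong_iff_lin cong_sym)
  have "complex_of_real (of_int x / of_int m) = of_real (of_int y / of_int m) + of_int k"
    using assms(2) by (simp add: k field_simps)
  thus ?thesis by (simp add: qexp_add)
qed

lemma sum_residues_reindex:
  fixes f :: "int \<Rightarrow> 'a :: comm_monoid_add"
  assumes m: "m > 0" and f: "\<And>x y. [x = y] (mod m) \<Longrightarrow> f x = f y"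
    and t: "coprime t m"
  shows "(\<Sum>x\<in>{0..<m}. f (t * x + c)) = (\<Sum>x\<in>{0..<m}. f x)"
proof -
  have inj: "inj_on (\<lambda>x. (t * x + c) mod m) {0..<m}"
  proof (rule inj_onI)
    fix x y assume xy: "x \<in> {0..<m}" "y \<in> {0..<m}" "(t * x + c) mod m = (t * y + c) mod m"
    hence "[t * x + c = t * y + c] (mod m)" by (simp add: cong_def)
    hence "[t * x = t * y] (mod m)" by (simp add: cong_add_rcancel)
    hence "[x = y] (mod m)" using t by (simp add: cong_mult_lcancel)
    thus "x = y" using xy by (simp add: cong_def)
  qed
  have "(\<lambda>x. (t * x + c) mod m) ` {0..<m} = {0..<m}"
    by (rule endo_inj_surj[OF _ _ inj]) (use m in auto)
  hence "bij_betw (\<lambda>x. (t * x + c) mod m) {0..<m} {0..<m}" using inj by (simp add: bij_betw_def)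
  hence "(\<Sum>x\<in>{0..<m}. f x) = (\<Sum>x\<in>{0..<m}. f ((t * x + c) mod m))"
    by (rule sum.reindex_bij_betw[symmetric])
  also have "\<dots> = (\<Sum>x\<in>{0..<m}. f (t * x + c))"
    by (intro sum.cong refl f) (simp add: cong_def)
  finally show ?thesis ..
qed

lemma bij_betw_residues_digits:
  assumes "m > 0" "n > (0 :: int)"
  shows "bij_betw (\<lambda>(y, j). y + m * j) ({0..<m} \<times> {0..<n}) {0..<m * n}"
proof (rule bij_betw_byWitness[where f' = "\<lambda>x. (x mod m, x div m)"])
  show "(\<lambda>(y, j). y + m * j) ` ({0..<m} \<times> {0..<n}) \<subseteq> {0..<m * n}"
  proof
    fix z assume "z \<in> (\<lambda>(y, j). y + m * j) ` ({0..<m} \<times> {0..<n})"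
    then obtain y j where *: "0 \<le> y" "y < m" "0 \<le> j" "j < n" and z: "z = y + m * j" by auto
    have "y + m * j < m + m * j" using * by simp
    also have "\<dots> = m * (j + 1)" by (simp add: algebra_simps)
    also have "\<dots> \<le> m * n" using * by (intro mult_left_mono) auto
    finally show "z \<in> {0..<m * n}" using * assms z by simp
  qed
  show "(\<lambda>x. (x mod m, x div m)) ` {0..<m * n} \<subseteq> {0..<m} \<times> {0..<n}"
  proof
    fix z assume "z \<in> (\<lambda>x. (x mod m, x div m)) ` {0..<m * n}"
    then obtain x where x: "0 \<le> x" "x < m * n" and z: "z = (x mod m, x div m)" by auto
    have "m * (x div m) \<le> x" using assms by (simp add: minus_mod_eq_mult_div [symmetric])
    hence "m * (x div m) < m * n" using x by linarith
    hence "x div m < n" using assms mult_less_cancel_left_pos[of m "x div m" n] by blast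
    thus "z \<in> {0..<m} \<times> {0..<n}" using assms x z by (simp add: pos_imp_zdiv_nonneg_iff)
  qed
qed (use assms in auto)

lemma sum_qexp_residues:
  assumes m: "m > (0 :: int)"
  shows "(\<Sum>j\<in>{0..<m}. qexp (of_real (of_int (c * j) / of_int m))) = (if m dvd c then of_int m else 0)"
proof (cases "m dvd c")
  case True
  then obtain k where "c = m * k" by auto
  hence "qexp (of_real (of_int (c * j) / of_int m)) = 1" for j
    using m qexp_of_int[of "k * j"] by simp
  thus ?thesis using True m by simp
next
  case False
  let ?S = "\<Sum>j\<in>{0..<m}. qexp (of_real (of_int (c * j) / of_int m))"
  let ?q = "qexp (of_real (of_int c / of_int m))"
  have "?S = (\<Sum>j\<in>{0..<m}. qexp (of_real (of_int (c * (1 * j + 1)) / of_int m)))"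
  proof (rule sum_residues_reindex[symmetric])
    fix x y assume "[x = y] (mod m)"
    thus "qexp (of_real (of_int (c * x) / of_int m)) = qexp (of_real (of_int (c * y) / of_int m))"
      using m by (intro qexp_of_int_divide_cong cong_mult) auto
  qed (use m in auto)
  also have "\<dots> = ?q * ?S"
    unfolding sum_distrib_left
  proof (rule sum.cong)
    fix j
    have "complex_of_real (of_int (c * (1 * j + 1)) / of_int m) = of_real (of_int c / of_int m) + of_real (of_int (c * j) / of_int m)"
      by (simp add: ring_distribs add_divide_distrib)
    thus "qexp (of_real (of_int (c * (1 * j + 1)) / of_int m)) = ?q * qexp (of_real (of_int (c * j) / of_int m))"
      by (simp only: qexp_add)
  qed simp
  finally have "(1 - ?q) * ?S = 0" by (simp add: algebra_simps)
  moreover have "?q \<noteq> 1"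
  proof
    assume "?q = 1"
    hence "real_of_int c / of_int m \<in> \<int>" using qexp_eq_1_iff[of "of_int c / of_int m"] by simp
    then obtain k where "real_of_int c / of_int m = of_int k" by (rule Ints_cases)
    hence "real_of_int c = of_int (k * m)" using m by (simp add: divide_eq_eq)
    hence "c = k * m" by (simp only: of_int_eq_iff)
    with False show False by simp
  qed
  ultimately show ?thesis using False by simp
qed

text \<open>Chinese remainder theorem: for x = m j + n y the mixed term of b x^2 / (m n) is the
  integer 2 b j y.\<close>

lemma gauss_sum_coprime_mult:
  assumes m: "m > 0" and n: "n > (0 :: int)" and cop: "coprime m n"
  shows "gauss_sum b (m * n) = gauss_sum (b * m) n * gauss_sum (b * n) m"
proof -
  let ?f = "\<lambda>x. qexp (of_real (of_int (b * x ^ 2) / of_int (m * n)))"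
  have f: "?f x = ?f y" if "[x = y] (mod (m * n))" for x y
    using m n that by (intro qexp_of_int_divide_cong cong_mult cong_pow) auto
  have "gauss_sum (b * m) n * gauss_sum (b * n) m = (\<Sum>j\<in>{0..<n}. \<Sum>y\<in>{0..<m}. ?f (m * j + n * y))"
    unfolding gauss_sum_def sum_product
  proof (intro sum.cong refl)
    fix j y
    have "complex_of_real (of_int (b * (m * j + n * y) ^ 2) / of_int (m * n)) =
      of_real (of_int (b * m * j ^ 2) / of_int n) + of_real (of_int (b * n * y ^ 2) / of_int m) + of_int (2 * b * j * y)"
      using m n by (simp add: field_simps power2_eq_square)
    thus "qexp (of_real (of_int (b * m * j ^ 2) / of_int n)) * qexp (of_real (of_int (b * n * y ^ 2) / of_int m)) = ?f (m * j + n * y)"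
      by (simp add: qexp_add del: of_int_mult)
  qed (use m n in auto)
  also have "\<dots> = (\<Sum>(y, j)\<in>{0..<m} \<times> {0..<n}. ?f (m * j + n * y))"
    by (subst sum.swap) (simp add: sum.cartesian_product)
  also have "\<dots> = (\<Sum>x\<in>{0..<m * n}. ?f x)"
  proof -
    have inj: "inj_on (\<lambda>(y, j). (m * j + n * y) mod (m * n)) ({0..<m} \<times> {0..<n})"
    proof (rule inj_onI, clarify)
      fix y j y' j' assume *: "y \<in> {0..<m}" "j \<in> {0..<n}" "y' \<in> {0..<m}" "j' \<in> {0..<n}"
        "(m * j + n * y) mod (m * n) = (m * j' + n * y') mod (m * n)"
      hence c: "[m * j + n * y = m * j' + n * y'] (mod (m * n))" by (simp add: cong_def)
      have "[m * j + n * y = m * j' + n * y'] (mod m)" using c by (rule cong_modulus_mult)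
      hence "[n * y = n * y'] (mod m)" by (simp add: cong_def)
      hence "[y = y'] (mod m)" using cop by (simp add: cong_mult_lcancel coprime_commute)
      moreover have "[m * j + n * y = m * j' + n * y'] (mod n)"
        using c by (metis cong_modulus_mult mult.commute)
      hence "[m * j = m * j'] (mod n)" by (simp add: cong_def)
      hence "[j = j'] (mod n)" using cop by (simp add: cong_mult_lcancel)
      ultimately show "y = y' \<and> j = j'" using * by (simp add: cong_def)
    qed
    have "(\<lambda>(y, j). (m * j + n * y) mod (m * n)) ` ({0..<m} \<times> {0..<n}) = {0..<m * n}"
    proof (rule card_subset_eq)
      have "card ((\<lambda>(y, j). (m * j + n * y) mod (m * n)) ` ({0..<m} \<times> {0..<n})) = card ({0..<m} \<times> {0..<n})"
        by (rule card_image[OF inj])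
      also have "\<dots> = card {0..<m * n}" using m n by (simp add: nat_mult_distrib)
      finally show "card ((\<lambda>(y, j). (m * j + n * y) mod (m * n)) ` ({0..<m} \<times> {0..<n})) = card {0..<m * n}" .
    qed (use m n in auto)
    with inj have "bij_betw (\<lambda>(y, j). (m * j + n * y) mod (m * n)) ({0..<m} \<times> {0..<n}) {0..<m * n}"
      by (simp add: bij_betw_def)
    hence "(\<Sum>x\<in>{0..<m * n}. ?f x) = (\<Sum>p\<in>{0..<m} \<times> {0..<n}. ?f (case p of (y, j) \<Rightarrow> (m * j + n * y) mod (m * n)))"
      by (rule sum.reindex_bij_betw[symmetric])
    also have "\<dots> = (\<Sum>(y, j)\<in>{0..<m} \<times> {0..<n}. ?f (m * j + n * y))"
    proof (intro sum.cong refl, clarsimp simp del: of_int_mult of_int_power of_real_divide, rule f)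
      fix y j show "[(m * j + n * y) mod (m * n) = m * j + n * y] (mod (m * n))" by (simp add: cong_def)
    qed
    finally show ?thesis ..
  qed
  finally show ?thesis using m n by (simp add: gauss_sum_def)
qed

text \<open>With x = y + p n j the inner sum over \<open>j\<close> is a character sum. As 2b is
  prime to \<open>p\<close>, it vanishes unless \<open>p\<close> divides \<open>y\<close>, and is
  \<open>p\<close> otherwise.\<close>

lemma gauss_sum_prime_square_mult:
  assumes p: "prime p" "odd p" and n: "n > (0 :: int)" and cop: "coprime b p"
  shows "gauss_sum b (p ^ 2 * n) = of_int p * gauss_sum b n"
proof -
  have p0: "p > 0" using p(1) prime_gt_0_int by blast
  let ?m = "p * n"
  let ?f = "\<lambda>x. qexp (of_real (of_int (b * x ^ 2) / of_int (p ^ 2 * n)))"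
  have eq: "p ^ 2 * n = (p * n) * p" by (simp add: power2_eq_square)
  have "gauss_sum b (p ^ 2 * n) = (\<Sum>x\<in>{0..<(p * n) * p}. ?f x)"
    unfolding gauss_sum_def using p0 n by (simp add: eq abs_mult)
  also have "\<dots> = (\<Sum>(y, j)\<in>{0..<p * n} \<times> {0..<p}. ?f (y + p * n * j))"
    using p0 n by (subst sum.reindex_bij_betw[OF bij_betw_residues_digits, symmetric]) (auto simp: case_prod_unfold)
  also have "\<dots> = (\<Sum>y\<in>{0..<p * n}. \<Sum>j\<in>{0..<p}. ?f (y + p * n * j))"
    by (simp add: sum.cartesian_product)
  also have "\<dots> = (\<Sum>y\<in>{0..<p * n}. ?f y * (if p dvd y then of_int p else 0))"
  proof (intro sum.cong refl)
    fix y
    have "?f (y + p * n * j) = ?f y * qexp (of_real (of_int ((2 * b * y) * j) / of_int p))" for j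
    proof -
      have "complex_of_real (of_int (b * (y + p * n * j) ^ 2) / of_int (p ^ 2 * n)) =
        of_real (of_int (b * y ^ 2) / of_int (p ^ 2 * n)) + of_real (of_int ((2 * b * y) * j) / of_int p) + of_int (b * n * j ^ 2)"
        using p0 n by (simp add: field_simps power2_eq_square)
      thus ?thesis by (simp add: qexp_add del: of_int_mult)
    qed
    hence "(\<Sum>j\<in>{0..<p}. ?f (y + p * n * j)) = ?f y * (\<Sum>j\<in>{0..<p}. qexp (of_real (of_int ((2 * b * y) * j) / of_int p)))"
      by (simp add: sum_distrib_left)
    also have "(\<Sum>j\<in>{0..<p}. qexp (of_real (of_int ((2 * b * y) * j) / of_int p))) = (if p dvd 2 * b * y then of_int p else 0)"
      by (rule sum_qexp_residues[OF p0])
    also have "p dvd 2 * b * y \<longleftrightarrow> p dvd y"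
    proof -
      have "coprime p (2 * b)"
        using p cop by (simp add: coprime_commute prime_imp_coprime odd_iff_mod_2_eq_one)
      thus ?thesis by (rule coprime_dvd_mult_right_iff)
    qed
    finally show "(\<Sum>j\<in>{0..<p}. ?f (y + p * n * j)) = ?f y * (if p dvd y then of_int p else 0)" .
  qed
  also have "\<dots> = (\<Sum>y\<in>{y \<in> {0..<p * n}. p dvd y}. ?f y * of_int p)"
    by (subst sum.inter_filter) (auto intro!: sum.cong)
  also have "\<dots> = (\<Sum>y\<in>{0..<n}. ?f (p * y) * of_int p)"
    by (rule sum.reindex_bij_witness[of _ "\<lambda>y. p * y" "\<lambda>y. y div p"]) (use p0 in \<open>auto simp: pos_imp_zdiv_nonneg_iff elim!: dvdE\<close>)
  also have "\<dots> = (\<Sum>y\<in>{0..<n}. of_int p * qexp (of_real (of_int (b * y ^ 2) / of_int n)))"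
    using p0 by (intro sum.cong) (auto simp: power_mult_distrib)
  also have "\<dots> = of_int p * gauss_sum b n"
    using n by (simp add: gauss_sum_def sum_distrib_left)
  finally show ?thesis .
qed

lemma coprime_prime_not_dvd:
  assumes "prime (p :: int)" "coprime c p"
  shows "\<not> p dvd c"
proof
  assume "p dvd c"
  hence "is_unit p" using assms(2) coprime_common_divisor[of c p p] by simp
  thus False using assms(1) not_prime_unit by blast
qed

text \<open>Euler's criterion gives the congruence modulo \<open>p\<close>; both sides lie between
  -1 and 1, so they differ by at most 2 < p.\<close>

lemma Legendre_mult:
  assumes p: "prime p" "p > 2"
  shows "Legendre (a * b) p = Legendre a p * Legendre b p"
proof -
  define n where "n = (nat p - 1) div 2"
  have ec: "[Legendre x p = x ^ n] (mod p)" for x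
  proof -
    have "prime (nat p)" using p by (simp add: prime_nat_iff_prime)
    hence "[Legendre x (int (nat p)) = x ^ n] (mod int (nat p))"
      unfolding n_def by (rule euler_criterion) (use p in auto)
    thus ?thesis using p by simp
  qed
  have "[Legendre (a * b) p = (a * b) ^ n] (mod p)" by (rule ec)
  moreover have "[Legendre a p * Legendre b p = a ^ n * b ^ n] (mod p)" by (intro cong_mult ec)
  ultimately have "[Legendre (a * b) p = Legendre a p * Legendre b p] (mod p)"
    by (simp add: power_mult_distrib cong_def)
  hence "p dvd Legendre (a * b) p - Legendre a p * Legendre b p" by (simp add: cong_iff_dvd_diff)
  moreover have "\<bar>Legendre (a * b) p - Legendre a p * Legendre b p\<bar> < p"
    using p(2) by (auto simp: Legendre_def)
  ultimately show ?thesis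
    using zdvd_not_zless[of "\<bar>Legendre (a * b) p - Legendre a p * Legendre b p\<bar>" p] by auto
qed

lemma Legendre_cong: "[a = b] (mod p) \<Longrightarrow> Legendre a p = Legendre b p"
  by (simp add: Legendre_def QuadRes_def cong_def)

lemma card_square_roots_mod:
  assumes p: "prime p" "p > 2"
  shows "int (card {x \<in> {0..<p}. [x ^ 2 = y] (mod p)}) = 1 + Legendre y p"
proof -
  let ?A = "{x \<in> {0..<p}. [x ^ 2 = y] (mod p)}"
  have p0: "p > 0" using p by simp
  consider "[y = 0] (mod p)" | "\<not> [y = 0] (mod p)" "QuadRes p y" | "\<not> [y = 0] (mod p)" "\<not> QuadRes p y"
    by blast
  thus ?thesis
  proof cases
    case 1
    have "?A = {0}"
    proof (intro equalityI subsetI)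
      fix x assume x: "x \<in> ?A"
      hence "[x ^ 2 = 0] (mod p)" using 1 cong_trans by blast
      hence "p dvd x" using p by (simp add: cong_0_iff prime_dvd_power_iff)
      thus "x \<in> {0}" using x by (auto simp: dvd_eq_mod_eq_0)
    qed (use 1 p0 in \<open>auto simp: cong_sym\<close>)
    thus ?thesis using 1 by (simp add: Legendre_def)
  next
    case 2
    then obtain w where w: "[w ^ 2 = y] (mod p)" by (auto simp: QuadRes_def)
    define u where "u = w mod p"
    have u: "u \<in> {0..<p}" "[u ^ 2 = y] (mod p)"
      using p0 w by (auto simp: u_def cong_def power_mod)
    have "u \<noteq> 0" using u 2 by (auto simp: cong_sym)
    have "?A = {u, p - u}"
    proof (intro equalityI subsetI)
      fix x assume x: "x \<in> ?A"
      hence "[x ^ 2 = u ^ 2] (mod p)" using u(2) by (auto intro: cong_trans cong_sym)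
      hence "p dvd (x - u) * (x + u)" by (simp add: cong_iff_dvd_diff power2_eq_square algebra_simps)
      hence "p dvd x - u \<or> p dvd x + u" using p by (simp add: prime_dvd_mult_iff)
      thus "x \<in> {u, p - u}"
      proof
        assume "p dvd x - u"
        hence "[x = u] (mod p)" by (simp add: cong_iff_dvd_diff)
        thus ?thesis using x u by (simp add: cong_def)
      next
        assume "p dvd x + u"
        then obtain k where k: "x + u = p * k" by auto
        have "0 < x + u" "x + u < 2 * p" using x u \<open>u \<noteq> 0\<close> by auto
        hence "0 < p * k" "p * k < p * 2" unfolding k by (simp_all add: mult.commute)
        hence "0 < k" "k < 2"
          using p0 mult_less_cancel_left_pos[of p k 2] zero_less_mult_iff[of p k] by simp_all
        hence "k = 1" by simp
        thus ?thesis using k by auto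
      qed
    next
      fix x assume "x \<in> {u, p - u}"
      moreover have "[(p - u) ^ 2 = u ^ 2] (mod p)"
        by (simp add: cong_iff_dvd_diff power2_eq_square algebra_simps)
      hence "[(p - u) ^ 2 = y] (mod p)" using u(2) cong_trans by blast
      ultimately show "x \<in> ?A" using u \<open>u \<noteq> 0\<close> by auto
    qed
    moreover have "u \<noteq> p - u"
    proof
      assume "u = p - u"
      hence "p = 2 * u" by simp
      hence "2 dvd p" by simp
      thus False using p prime_odd_int[of p] by simp
    qed
    ultimately show ?thesis using 2 by (simp add: Legendre_def)
  next
    case 3
    hence A: "?A = {}" by (auto simp: QuadRes_def)
    show ?thesis unfolding A using 3 by (simp add: Legendre_def)
  qed
qed

text \<open>Each y has 1 + (y/p) square roots modulo \<open>p\<close>, and the plain exponential sum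
  is zero, so the Gauss sum is the sum of the exponentials weighted by (y/p). The substitution of t
  y for y then pulls out the symbol of \<open>t\<close>.\<close>

lemma gauss_sum_prime:
  assumes p: "prime p" "p > 2" and cop: "coprime t p" "coprime b p"
  shows "gauss_sum (t * b) p = of_int (Legendre t p) * gauss_sum b p"
proof -
  have p0: "p > 0" using p(2) by simp
  let ?f = "\<lambda>c x. qexp (of_real (of_int (c * x) / of_int p))"
  define R where "R = (\<lambda>y. card {x \<in> {0..<p}. [x ^ 2 = y] (mod p)})"
  define S where "S = (\<lambda>c. \<Sum>y\<in>{0..<p}. of_int (Legendre y p) * ?f c y)"
  have gs: "gauss_sum c p = S c" if "coprime c p" for c
  proof -
    have ndvd: "\<not> p dvd c" by (rule coprime_prime_not_dvd[OF p(1) that])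
    have "gauss_sum c p = (\<Sum>x\<in>{0..<p}. ?f c (x ^ 2 mod p))"
      unfolding gauss_sum_def
      by (intro sum.cong qexp_of_int_divide_cong cong_mult) (use p0 in \<open>auto simp: cong_def\<close>)
    also have "\<dots> = (\<Sum>y\<in>{0..<p}. \<Sum>x\<in>{x \<in> {0..<p}. x ^ 2 mod p = y}. ?f c (x ^ 2 mod p))"
      by (rule sum.group[symmetric]) (use p0 in auto)
    also have "\<dots> = (\<Sum>y\<in>{0..<p}. of_nat (R y) * ?f c y)"
    proof (intro sum.cong refl)
      fix y assume "y \<in> {0..<p}"
      hence "{x \<in> {0..<p}. x ^ 2 mod p = y} = {x \<in> {0..<p}. [x ^ 2 = y] (mod p)}" by (auto simp: cong_def)
      moreover have "(\<Sum>x\<in>{x \<in> {0..<p}. x ^ 2 mod p = y}. ?f c (x ^ 2 mod p)) = (\<Sum>x\<in>{x \<in> {0..<p}. x ^ 2 mod p = y}. ?f c y)"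
        by (intro sum.cong) auto
      ultimately show "(\<Sum>x\<in>{x \<in> {0..<p}. x ^ 2 mod p = y}. ?f c (x ^ 2 mod p)) = of_nat (R y) * ?f c y"
        by (simp add: R_def)
    qed
    also have "\<dots> = (\<Sum>y\<in>{0..<p}. ?f c y) + S c"
    proof -
      have "complex_of_nat (R y) = 1 + of_int (Legendre y p)" for y
      proof -
        have "int (R y) = 1 + Legendre y p" unfolding R_def by (rule card_square_roots_mod[OF p])
        hence "complex_of_int (int (R y)) = of_int (1 + Legendre y p)" by (rule arg_cong)
        thus ?thesis by simp
      qed
      thus ?thesis by (simp add: S_def ring_distribs sum.distrib)
    qed
    also have "(\<Sum>y\<in>{0..<p}. ?f c y) = 0"
      using sum_qexp_residues[OF p0, of c] ndvd by simp
    finally show ?thesis by simp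
  qed
  have t0: "Legendre t p * Legendre t p = 1"
    using coprime_prime_not_dvd[OF p(1) cop(1)] by (simp add: Legendre_def cong_0_iff)
  have "S b = (\<Sum>y\<in>{0..<p}. of_int (Legendre (t * y + 0) p) * ?f b (t * y + 0))"
    unfolding S_def
  proof (rule sum_residues_reindex[symmetric])
    fix x y assume "[x = y] (mod p)"
    hence "Legendre x p = Legendre y p" by (rule Legendre_cong)
    moreover have "?f b x = ?f b y"
      by (rule qexp_of_int_divide_cong) (use \<open>[x = y] (mod p)\<close> p0 in \<open>auto intro: cong_mult\<close>)
    ultimately show "of_int (Legendre x p) * ?f b x = of_int (Legendre y p) * ?f b y" by simp
  qed (use p0 cop in auto)
  also have "\<dots> = of_int (Legendre t p) * S (t * b)"
    by (simp add: S_def Legendre_mult[OF p] sum_distrib_left mult_ac)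
  finally have "of_int (Legendre t p) * S b = of_int (Legendre t p * Legendre t p) * S (t * b)"
    by simp
  thus ?thesis using gs[of b] gs[of "t * b"] cop t0 by simp
qed

lemma kronecker_one_right [simp]: "kronecker t 1 = 1"
  by (simp add: kronecker_def)

lemma kronecker_prime_mult_right:
  assumes "prime p" "n > (0 :: int)"
  shows "kronecker t (p * n) = kronecker_prime t p * kronecker t n"
  using assms prime_gt_0_int[of p]
  by (simp add: kronecker_def prime_factorization_mult prime_factorization_prime mult_less_0_iff)

lemma kronecker_odd_prime_mult_right:
  assumes "prime p" "odd p" "n > (0 :: int)"
  shows "kronecker t (p * n) = Legendre t p * kronecker t n"
  using kronecker_prime_mult_right[OF assms(1,3)] assms(2) by (auto simp: kronecker_prime_def)

lemma int_less_mult_left: "1 < p \<Longrightarrow> 0 < n \<Longrightarrow> n < p * (n :: int)"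
  using mult_strict_right_mono[of 1 p n] by simp

text \<open>The hypothesis is available for all smaller odd numbers and not only for
  \<open>n\<close>, because the induction for Gauss sums removes p^2 at once when \<open>p\<close>
  divides \<open>n\<close>.\<close>

lemma odd_pos_int_induct [consumes 2, case_names one mult]:
  assumes "odd (m :: int)" "m > 0" and "P 1"
    and "\<And>p n. prime p \<Longrightarrow> p > 2 \<Longrightarrow> odd p \<Longrightarrow> n > 0 \<Longrightarrow> odd n \<Longrightarrow> (\<And>k. k > 0 \<Longrightarrow> odd k \<Longrightarrow> k < p * n \<Longrightarrow> P k) \<Longrightarrow> P (p * n)"
  shows "P m"
  using assms(1,2)
proof (induction "nat m" arbitrary: m rule: less_induct)
  case less
  show ?case
  proof (cases "m = 1")
    case False
    then obtain p where p: "prime p" "p dvd m"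
      using less.prems prime_divisor_exists[of m] by auto
    then obtain n where n: "m = p * n" by auto
    have p0: "p > 0" using p prime_gt_0_int by blast
    have "odd p" "odd n" using less.prems n by auto
    moreover have "p > 2" using \<open>odd p\<close> p prime_ge_2_int[of p] by (cases "p = 2") auto
    moreover have "n > 0" using less.prems n p0 by (auto simp: zero_less_mult_iff)
    ultimately show ?thesis unfolding n
    proof (intro assms(4)[OF p(1)])
      fix k assume k: "k > 0" "odd k" "k < p * n"
      show "P k" by (rule less.hyps) (use k n in auto)
    qed auto
  qed (simp add: assms(3))
qed

lemma kronecker_mult_left:
  assumes "odd (m :: int)" "m > 0"
  shows "kronecker (s * t) m = kronecker s m * kronecker t m"
  using assms
proof (induction m rule: odd_pos_int_induct)
  case (mult p n)
  have "n < p * n" using mult.hyps int_less_mult_left[of p n] by simp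
  hence "kronecker (s * t) n = kronecker s n * kronecker t n" by (intro mult.IH) (use mult.hyps in auto)
  thus ?case using mult.hyps by (simp add: kronecker_odd_prime_mult_right Legendre_mult)
qed simp

lemma kronecker_square_coprime:
  assumes "odd (m :: int)" "m > 0" "coprime t m"
  shows "kronecker t m * kronecker t m = 1"
  using assms
proof (induction m rule: odd_pos_int_induct)
  case (mult p n)
  have "n < p * n" using mult.hyps int_less_mult_left[of p n] by simp
  hence "kronecker t n * kronecker t n = 1" by (intro mult.IH) (use mult.hyps mult.prems in auto)
  moreover have "\<not> p dvd t" using mult.prems mult.hyps coprime_prime_not_dvd[of p t] by simp
  hence "Legendre t p * Legendre t p = 1" by (auto simp: Legendre_def cong_0_iff)
  moreover have "kronecker t (p * n) * kronecker t (p * n) = (Legendre t p * Legendre t p) * (kronecker t n * kronecker t n)"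
    using mult.hyps by (simp add: kronecker_odd_prime_mult_right)
  ultimately show ?case by simp
qed simp

text \<open>The square of a prime comes out of both sums alike, and the symbol of \<open>t\<close>
  does not see it. A prime that does not divide the cofactor is split off by the Chinese remainder
  theorem; this multiplies \<open>b\<close> by the cofactors, hence \<open>b\<close> is arbitrary in
  the induction.\<close>

lemma gauss_sum_kronecker_pos:
  assumes "odd (m :: int)" "m > 0" "coprime t m" "coprime b m"
  shows "gauss_sum (t * b) m = of_int (kronecker t m) * gauss_sum b m"
  using assms
proof (induction m arbitrary: b rule: odd_pos_int_induct)
  case one
  have "{0..<1 :: int} = {0}" by auto
  thus ?case by (simp add: gauss_sum_def)
next
  case (mult p n)
  have p0: "p > 0" using mult.hyps by simp
  have ct: "coprime t p" "coprime t n" and cb: "coprime b p" "coprime b n" using mult.prems by auto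
  show ?case
  proof (cases "p dvd n")
    case True
    then obtain l where l: "n = p * l" by auto
    have l0: "l > 0" "odd l" using mult.hyps l p0 by (auto simp: zero_less_mult_iff)
    have "l < n" using l l0 mult.hyps int_less_mult_left[of p l] by simp
    moreover have "n < p * n" using mult.hyps int_less_mult_left[of p n] by simp
    ultimately have "l < p * n" by linarith
    hence IH: "gauss_sum (t * b) l = of_int (kronecker t l) * gauss_sum b l"
      using ct cb l l0 by (intro mult.IH) auto
    have eq: "p * n = p ^ 2 * l" by (simp add: l power2_eq_square)
    have "\<not> p dvd t" using ct mult.hyps coprime_prime_not_dvd by blast
    hence "Legendre t p * Legendre t p = 1" by (auto simp: Legendre_def cong_0_iff)
    moreover have "kronecker t (p * n) = (Legendre t p * Legendre t p) * kronecker t l"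
      using mult.hyps l0 by (simp add: kronecker_odd_prime_mult_right l)
    ultimately have k: "kronecker t (p * n) = kronecker t l" by simp
    show ?thesis
      unfolding k unfolding eq using mult.hyps l0 ct cb IH
      by (simp add: gauss_sum_prime_square_mult)
  next
    case False
    hence cop: "coprime p n" using mult.hyps by (simp add: prime_imp_coprime)
    have "n < p * n" using mult.hyps int_less_mult_left[of p n] by simp
    hence IH: "gauss_sum (t * (b * p)) n = of_int (kronecker t n) * gauss_sum (b * p) n"
      using ct cb cop by (intro mult.IH) (use mult.hyps in auto)
    have "gauss_sum (t * (b * n)) p = of_int (Legendre t p) * gauss_sum (b * n) p"
      by (rule gauss_sum_prime) (use mult.hyps ct cb cop in \<open>auto simp: coprime_commute\<close>)
    moreover have "gauss_sum (t * b) (p * n) = gauss_sum (t * (b * p)) n * gauss_sum (t * (b * n)) p"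
      using gauss_sum_coprime_mult[OF p0 _ cop, of "t * b"] mult.hyps by (simp add: mult.assoc)
    moreover have "gauss_sum b (p * n) = gauss_sum (b * p) n * gauss_sum (b * n) p"
      using gauss_sum_coprime_mult[OF p0 _ cop, of b] mult.hyps by simp
    moreover have "kronecker t (p * n) = Legendre t p * kronecker t n"
      using mult.hyps by (simp add: kronecker_odd_prime_mult_right)
    ultimately show ?thesis using IH by simp
  qed
qed

lemma kronecker_uminus_right:
  assumes "t > 0" "n \<noteq> 0"
  shows "kronecker t (- n) = kronecker t n"
proof -
  have "prime_factorization (- n) = prime_factorization n"
    by (rule prime_factorization_cong) simp
  thus ?thesis using assms by (simp add: kronecker_def)
qed

lemma gauss_sum_kronecker:
  assumes m: "odd m" and "coprime t m" "coprime b m" "t > 0"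
  shows "gauss_sum (t * b) m = of_int (kronecker t m) * gauss_sum b m"
proof (cases "m > 0")
  case False
  hence m0: "m < 0" using m by (cases "m = 0") auto
  have "gauss_sum (t * (- b)) (- m) = of_int (kronecker t (- m)) * gauss_sum (- b) (- m)"
    by (rule gauss_sum_kronecker_pos) (use assms m0 in auto)
  thus ?thesis using m0 assms(4) by (simp add: gauss_sum_uminus kronecker_uminus_right)
qed (use assms gauss_sum_kronecker_pos in blast)

subsection \<open>Dirichlet characters\<close>

definition units_mod :: "nat \<Rightarrow> int set" where
  "units_mod M = {x \<in> {0..<int M}. coprime x (int M)}"

lemma finite_units_mod [simp]: "finite (units_mod M)"
  unfolding units_mod_def by (rule finite_subset[of _ "{0..<int M}"]) auto

lemma card_units_mod:
  assumes "M > 0"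
  shows "card (units_mod M) > 0"
proof -
  \<comment> \<open>For M = 1 the only residue is 0, hence \<open>1 mod int M\<close> in place of
    1.\<close>
  have "1 mod int M \<in> units_mod M"
    using assms by (auto simp: units_mod_def coprime_iff_gcd_eq_1)
  thus ?thesis by (auto simp: card_gt_0_iff)
qed

lemma sum_units_mod_reindex:
  fixes f :: "int \<Rightarrow> 'a :: comm_monoid_add"
  assumes M: "M > 0" and f: "\<And>x y. [x = y] (mod int M) \<Longrightarrow> f x = f y"
    and t: "coprime t (int M)"
  shows "(\<Sum>x\<in>units_mod M. f (t * x)) = (\<Sum>x\<in>units_mod M. f x)"
proof -
  let ?g = "\<lambda>x. if coprime x (int M) then f x else 0"
  have "(\<Sum>x\<in>units_mod M. f x) = (\<Sum>x\<in>{0..<int M}. ?g x)"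
    unfolding units_mod_def by (rule sum.inter_filter) simp
  also have "\<dots> = (\<Sum>x\<in>{0..<int M}. ?g (t * x + 0))"
  proof (rule sum_residues_reindex[symmetric])
    fix x y assume xy: "[x = y] (mod int M)"
    thus "?g x = ?g y" using f[OF xy] cong_imp_coprime[OF xy] cong_imp_coprime[OF cong_sym[OF xy]] by auto
  qed (use M t in auto)
  also have "\<dots> = (\<Sum>x\<in>{0..<int M}. if coprime x (int M) then f (t * x) else 0)"
    using t by (intro sum.cong) auto
  also have "\<dots> = (\<Sum>x\<in>units_mod M. f (t * x))"
    unfolding units_mod_def by (rule sum.inter_filter[symmetric]) simp
  finally show ?thesis ..
qed

lemma periodic_int_cong:
  fixes f :: "int \<Rightarrow> 'a"
  assumes per: "\<And>n. f (n + int M) = f n" and xy: "[x = y] (mod int M)"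
  shows "f x = f y"
proof -
  have 1: "f (n + int M * int k) = f n" for n k
    by (induction k) (use per in \<open>auto simp: algebra_simps\<close>, metis per add.assoc add.commute)
  have 2: "f (n + int M * k) = f n" for n k
  proof (cases "k \<ge> 0")
    case True thus ?thesis using 1[of n "nat k"] by simp
  next
    case False thus ?thesis using 1[of "n + int M * k" "nat (- k)"] by simp
  qed
  obtain k where "x = y + int M * k" using xy by (metis cong_iff_lin cong_sym)
  thus ?thesis using 2 by simp
qed

lemma dirichlet_characterD:
  assumes "\<phi> \<in> dirichlet_characters M"
  shows "\<phi> (m * n) = \<phi> m * \<phi> n" and "[x = y] (mod int M) \<Longrightarrow> \<phi> x = \<phi> y"
    and "\<phi> n \<noteq> 0 \<longleftrightarrow> coprime n (int M)" and "\<phi> 1 = 1"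
proof -
  show a: "\<phi> (m * n) = \<phi> m * \<phi> n" for m n using assms by (simp add: dirichlet_characters_def)
  show "[x = y] (mod int M) \<Longrightarrow> \<phi> x = \<phi> y"
    by (rule periodic_int_cong) (use assms in \<open>auto simp: dirichlet_characters_def\<close>)
  show b: "\<phi> n \<noteq> 0 \<longleftrightarrow> coprime n (int M)" for n using assms by (simp add: dirichlet_characters_def)
  show "\<phi> 1 = 1" using a[of 1 1] b[of 1] by simp
qed

lemma dirichlet_character_power: "\<phi> \<in> dirichlet_characters M \<Longrightarrow> \<phi> (x ^ n) = \<phi> x ^ n"
  by (induction n) (simp_all add: dirichlet_characterD)

lemma euler_theorem_int:
  assumes "coprime x (int M)"
  shows "[x ^ totient M = 1] (mod int M)"
proof (cases "M = 0")
  case False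
  define y where "y = nat (x mod int M)"
  have y: "[int y = x] (mod int M)" using False by (simp add: y_def cong_def)
  hence "coprime (int y) (int M)" using assms cong_imp_coprime cong_sym by blast
  hence "[y ^ totient M = 1] (mod M)" by (intro euler_theorem) auto
  hence "[int y ^ totient M = 1] (mod int M)" by (metis cong_int_iff of_nat_1 of_nat_power)
  thus ?thesis using cong_pow[OF y] cong_sym cong_trans by blast
qed auto

lemma dirichlet_character_root_of_unity:
  assumes "\<phi> \<in> dirichlet_characters M" "coprime x (int M)"
  shows "\<phi> x ^ totient M = 1"
  using dirichlet_characterD(2)[OF assms(1) euler_theorem_int[OF assms(2)]] assms(1)
  by (simp add: dirichlet_character_power dirichlet_characterD)

lemma norm_dirichlet_character:
  assumes "\<phi> \<in> dirichlet_characters M" "coprime x (int M)" "M > 0"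
  shows "norm (\<phi> x) = 1"
proof -
  have "norm (\<phi> x) ^ totient M = 1"
    using dirichlet_character_root_of_unity[OF assms(1,2)] by (simp flip: norm_power)
  thus ?thesis using assms(3) power_eq_1_iff[of "norm (\<phi> x)" "totient M"] by auto
qed

lemma dirichlet_character_mod: "\<phi> \<in> dirichlet_characters M \<Longrightarrow> \<phi> (x mod int M) = \<phi> x"
  using dirichlet_characterD(2)[of \<phi> M "x mod int M" x] by (simp add: cong_def)

text \<open>A character is determined by one period, where its values are 0 or roots of unity of
  order dividing \<open>totient M\<close>.\<close>

lemma finite_dirichlet_characters:
  assumes M: "M > 0"
  shows "finite (dirichlet_characters M)"
proof -
  let ?R = "{z :: complex. z ^ totient M = 1} \<union> {0}"
  let ?r = "\<lambda>\<phi> :: int \<Rightarrow> complex. restrict \<phi> {0..<int M}"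
  have "finite ?R" using finite_roots_unity[of "totient M"] M by (simp add: Suc_le_eq)
  hence "finite ({0..<int M} \<rightarrow>\<^sub>E ?R)" by (intro finite_PiE) auto
  moreover have "?r ` dirichlet_characters M \<subseteq> {0..<int M} \<rightarrow>\<^sub>E ?R"
  proof -
    have "\<phi> x \<in> ?R" if "\<phi> \<in> dirichlet_characters M" for \<phi> x
      using dirichlet_character_root_of_unity[OF that, of x] dirichlet_characterD(3)[OF that, of x]
      by (cases "coprime x (int M)") auto
    thus ?thesis unfolding image_subset_iff restrict_PiE_iff by blast
  qed
  ultimately have "finite (?r ` dirichlet_characters M)" by (rule rev_finite_subset)
  moreover have "inj_on ?r (dirichlet_characters M)"
  proof (rule inj_onI, rule ext)
    fix \<phi> \<psi> :: "int \<Rightarrow> complex" and x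
    assume *: "\<phi> \<in> dirichlet_characters M" "\<psi> \<in> dirichlet_characters M" "?r \<phi> = ?r \<psi>"
    have "x mod int M \<in> {0..<int M}" using M by auto
    hence "\<phi> (x mod int M) = \<psi> (x mod int M)" using *(3) by (metis restrict_apply')
    thus "\<phi> x = \<psi> x" using * by (simp add: dirichlet_character_mod)
  qed
  ultimately show ?thesis by (rule finite_imageD)
qed

text \<open>If the characters differ at \<open>s\<close>, substituting s x for x multiplies the sum
  by a number other than 1.\<close>

lemma dirichlet_character_orthogonal:
  assumes M: "M > 0" and \<phi>: "\<phi> \<in> dirichlet_characters M" and \<psi>: "\<psi> \<in> dirichlet_characters M"
  shows "(\<Sum>x\<in>units_mod M. \<phi> x * cnj (\<psi> x)) = (if \<phi> = \<psi> then of_nat (card (units_mod M)) else 0)"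
proof (cases "\<phi> = \<psi>")
  case True
  have "\<phi> x * cnj (\<psi> x) = 1" if "x \<in> units_mod M" for x
    using norm_dirichlet_character[OF \<phi>, of x] that M True
    by (simp add: units_mod_def complex_norm_square[symmetric])
  thus ?thesis using True by simp
next
  case False
  then obtain s where s: "\<phi> s \<noteq> \<psi> s" by blast
  hence cop: "coprime s (int M)" using dirichlet_characterD(3)[OF \<phi>] dirichlet_characterD(3)[OF \<psi>] by metis
  let ?S = "\<Sum>x\<in>units_mod M. \<phi> x * cnj (\<psi> x)"
  have "?S = (\<Sum>x\<in>units_mod M. \<phi> (s * x) * cnj (\<psi> (s * x)))"
    by (rule sum_units_mod_reindex[symmetric])
       (use M cop dirichlet_characterD(2)[OF \<phi>] dirichlet_characterD(2)[OF \<psi>] in metis)+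
  also have "\<dots> = (\<phi> s * cnj (\<psi> s)) * ?S"
    by (simp add: dirichlet_characterD(1)[OF \<phi>] dirichlet_characterD(1)[OF \<psi>] sum_distrib_left mult_ac)
  finally have "(\<phi> s * cnj (\<psi> s) - 1) * ?S = 0" by (simp add: algebra_simps)
  moreover have "\<phi> s * cnj (\<psi> s) \<noteq> 1"
  proof
    assume *: "\<phi> s * cnj (\<psi> s) = 1"
    have "\<psi> s * cnj (\<psi> s) = 1"
      using norm_dirichlet_character[OF \<psi> cop M] by (simp flip: complex_norm_square)
    hence "\<phi> s = \<phi> s * (\<psi> s * cnj (\<psi> s))" by simp
    also have "\<dots> = \<psi> s" using * by (simp add: mult_ac)
    finally show False using s by contradiction
  qed
  ultimately show ?thesis using False by simp
qed

lemma sum_int_lessThan: "(\<Sum>i\<in>{0..<int n}. f i) = (\<Sum>i<n. f (int i))"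
  by (rule sum.reindex_bij_witness[of _ int nat]) auto

text \<open>The operators that send g(x) to g(s x), for units s, commute and have finite order, so
  they can be diagonalised one after the other. A common eigenvector of all of them is a multiple of
  a character, which is how characters are produced here.\<close>

lemma unit_function_character_expansion:
  fixes g :: "int \<Rightarrow> complex"
  assumes M: "M > 0" and per: "\<And>x y. [x = y] (mod int M) \<Longrightarrow> g x = g y"
    and supp: "\<And>x. \<not> coprime x (int M) \<Longrightarrow> g x = 0"
  shows "\<exists>c. \<forall>x. g x = (\<Sum>\<phi>\<in>dirichlet_characters M. c \<phi> * \<phi> x)"
proof -
  let ?D = "dirichlet_characters M"
  have fin: "finite ?D" by (rule finite_dirichlet_characters[OF M])
  define t where "t = totient M"
  have t0: "t > 0" using M by (simp add: t_def)
  \<comment> \<open>\<open>S\<close> collects units for which \<open>g\<close> is already an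
    eigenvector; the induction enlarges it until it contains all units.\<close>
  have "\<exists>c. \<forall>x. g x = (\<Sum>\<phi>\<in>?D. c \<phi> * \<phi> x)"
    if "S \<subseteq> units_mod M" "\<And>s. s \<in> S \<Longrightarrow> \<exists>l. \<forall>x. g (s * x) = l * g x"
      "\<And>x y. [x = y] (mod int M) \<Longrightarrow> g x = g y" "\<And>x. \<not> coprime x (int M) \<Longrightarrow> g x = 0" for S g
    using that
  proof (induction "card (units_mod M - S)" arbitrary: S g rule: less_induct)
    case less
    note per = less.prems(3) and supp = less.prems(4)
    show ?case
    proof (cases "units_mod M \<subseteq> S")
      case True
      \<comment> \<open>The eigenvalue belonging to \<open>s\<close> is read off at x = 1.\<close>
      have eig: "g (s * x) * g 1 = g s * g x" if "coprime s (int M)" for s x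
      proof -
        have "s mod int M \<in> S" using True M that by (auto simp: units_mod_def coprime_mod_left_iff)
        then obtain l where l: "\<And>x. g ((s mod int M) * x) = l * g x" using less.prems(2) by blast
        have e: "g (s * x) = l * g x" for x
        proof -
          have "[s * x = (s mod int M) * x] (mod int M)" by (intro cong_mult) (auto simp: cong_def)
          thus ?thesis using l per by metis
        qed
        from e[of x] e[of 1] show ?thesis by simp
      qed
      show ?thesis
      proof (cases "g 1 = 0")
        case True
        have "g s = 0" for s
        proof (cases "coprime s (int M)")
          case cs: True
          then obtain y where "[s * y = 1] (mod int M)" using cong_solve_coprime_int by blast
          show ?thesis
          proof (rule ccontr)
            assume "g s \<noteq> 0"
            thus False using eig[OF cs, of s] True by simp
          qed
        qed (rule supp)
        thus ?thesis by (intro exI[of _ "\<lambda>_. 0"]) simp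
      next
        case g1: False
        define \<phi> where "\<phi> = (\<lambda>x. g x / g 1)"
        have mult: "\<phi> (m * n) = \<phi> m * \<phi> n" for m n
        proof (cases "coprime m (int M)")
          case True
          thus ?thesis using eig[OF True, of n] g1 by (simp add: \<phi>_def field_simps)
        next
          case False
          hence "\<not> coprime (m * n) (int M)" by simp
          thus ?thesis using supp False by (simp add: \<phi>_def)
        qed
        have nz: "\<phi> n \<noteq> 0 \<longleftrightarrow> coprime n (int M)" for n
        proof
          assume "\<phi> n \<noteq> 0" thus "coprime n (int M)" using supp by (auto simp: \<phi>_def)
        next
          assume "coprime n (int M)"
          then obtain y where "[n * y = 1] (mod int M)" using cong_solve_coprime_int by blast
          hence "\<phi> (n * y) = \<phi> 1" using per by (simp add: \<phi>_def)
          moreover have "\<phi> 1 = 1" using g1 by (simp add: \<phi>_def)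
          ultimately have "\<phi> n * \<phi> y = 1" using mult[of n y] by simp
          thus "\<phi> n \<noteq> 0" by auto
        qed
        have "\<phi> (n + int M) = \<phi> n" for n
          using per[of "n + int M" n] by (simp add: \<phi>_def cong_def)
        hence "\<phi> \<in> ?D" using mult nz by (simp add: dirichlet_characters_def)
        hence "(\<Sum>\<psi>\<in>?D. (if \<psi> = \<phi> then g 1 else 0) * \<psi> x) = g x" for x
          using fin g1 by (simp add: if_distrib[of "\<lambda>y. y * _"] sum.delta \<phi>_def cong: if_cong)
        thus ?thesis by metis
      qed
    next
      case False
      then obtain s where s: "s \<in> units_mod M" "s \<notin> S" by blast
      have cs: "coprime s (int M)" using s by (simp add: units_mod_def)
      \<comment> \<open>Weights of a discrete Fourier transform along the powers of
        \<open>s\<close>: \<open>G j\<close> is the projection of \<open>g\<close> to the eigenspace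
        with eigenvalue exp(2 pi i j / t), and the \<open>G j\<close> add up to
        \<open>g\<close>.\<close>
      define w where "w = (\<lambda>i j :: nat. qexp (of_real (of_int (- int j * int i) / of_int (int t))))"
      define G where "G = (\<lambda>j x. (\<Sum>i<t. w i j * g (s ^ i * x)) / of_nat t)"
      have wSuc: "w (Suc i) j * qexp (of_real (of_int (int j) / of_int (int t))) = w i j" for i j
        using t0 by (simp add: w_def qexp_add[symmetric] field_simps)
      have gt: "g (s ^ t * x) = g x" for x
        unfolding t_def by (rule per) (use cong_mult[OF euler_theorem_int[OF cs] cong_refl[of x]] in simp)
      have eig: "G j (s * x) = qexp (of_real (of_int (int j) / of_int (int t))) * G j x" for j x
      proof -
        let ?q = "qexp (of_real (of_int (int j) / of_int (int t)))"
        let ?f = "\<lambda>i. w i j * g (s ^ i * x)"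
        have "w t j = 1" using t0 qexp_of_int[of "- int j"] by (simp add: w_def)
        hence "?f t = ?f 0" using gt by (simp add: w_def)
        hence "(\<Sum>i<t. ?f (Suc i)) = (\<Sum>i<t. ?f i)"
          using sum.lessThan_Suc_shift[of ?f t] by simp
        moreover have "w i j * g (s ^ i * (s * x)) = ?q * ?f (Suc i)" for i
          using wSuc[of i j] by (simp add: mult_ac)
        ultimately show ?thesis by (simp add: G_def sum_distrib_left[symmetric])
      qed
      have eigS: "\<exists>l. \<forall>x. G j (u * x) = l * G j x" if u: "u \<in> insert s S" for u j
      proof (cases "u = s")
        case True thus ?thesis using eig by blast
      next
        case False
        then obtain l where l: "\<And>x. g (u * x) = l * g x" using less.prems(2) u by blast
        have gu: "w i j * g (s ^ i * (u * x)) = l * (w i j * g (s ^ i * x))" for i x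
          using l[of "s ^ i * x"] by (simp add: mult_ac)
        have "G j (u * x) = l * G j x" for x
          unfolding G_def gu sum_distrib_left[symmetric] by simp
        thus ?thesis by blast
      qed
      have "\<exists>c. \<forall>x. G j x = (\<Sum>\<phi>\<in>?D. c \<phi> * \<phi> x)" for j
      proof (rule less.hyps)
        show "card (units_mod M - insert s S) < card (units_mod M - S)"
          using s by (intro psubset_card_mono) auto
        show "insert s S \<subseteq> units_mod M" using s less.prems by simp
        show "\<exists>l. \<forall>x. G j (u * x) = l * G j x" if "u \<in> insert s S" for u using that by (rule eigS)
        show "G j x = G j y" if "[x = y] (mod int M)" for x y
          unfolding G_def by (intro arg_cong2[of _ _ _ _ "(/)"] sum.cong refl arg_cong2[of _ _ _ _ "(*)"] per cong_mult that cong_refl)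
        show "G j x = 0" if "\<not> coprime x (int M)" for x
        proof -
          have "\<not> coprime (s ^ i * x) (int M)" for i using that by simp
          thus ?thesis using supp by (simp add: G_def)
        qed
      qed
      then obtain c where c: "\<And>j x. G j x = (\<Sum>\<phi>\<in>?D. c j \<phi> * \<phi> x)" by metis
      have "g x = (\<Sum>j<t. G j x)" for x
      proof -
        have w: "(\<Sum>j<t. w i j) = (if i = 0 then of_nat t else 0)" if "i < t" for i
        proof -
          have "(\<Sum>j<t. w i j) = (\<Sum>j\<in>{0..<int t}. qexp (of_real (of_int (- int i * j) / of_int (int t))))"
            unfolding sum_int_lessThan w_def by (simp add: mult_ac)
          also have "\<dots> = (if int t dvd - int i then of_int (int t) else 0)"
            by (rule sum_qexp_residues) (use t0 in simp)
          finally show ?thesis using that by (auto dest: dvd_imp_le)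
        qed
        have "(\<Sum>j<t. G j x) = (\<Sum>i<t. (\<Sum>j<t. w i j) * g (s ^ i * x)) / of_nat t"
          unfolding G_def sum_divide_distrib[symmetric] by (subst sum.swap) (simp add: sum_distrib_right)
        also have "\<dots> = (\<Sum>i<t. if i = 0 then of_nat t * g x else 0) / of_nat t"
          by (intro arg_cong2[of _ _ _ _ "(/)"] sum.cong) (auto simp: w)
        also have "\<dots> = g x" using t0 by (simp add: sum.delta)
        finally show ?thesis ..
      qed
      also have "(\<Sum>j<t. G j x) = (\<Sum>\<phi>\<in>?D. (\<Sum>j<t. c j \<phi>) * \<phi> x)" for x
        unfolding c by (subst sum.swap) (simp add: sum_distrib_right)
      finally show ?thesis by (intro exI[of _ "\<lambda>\<phi>. \<Sum>j<t. c j \<phi>"]) simp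
    qed
  qed
  from this[of "{}" g] show ?thesis using per supp by blast
qed

text \<open>In the expansion of the indicator of the class of 1, orthogonality forces every
  coefficient to be the inverse of the number of units.\<close>

lemma sum_dirichlet_characters:
  assumes M: "M > 0" and x: "coprime x (int M)"
  shows "(\<Sum>\<phi>\<in>dirichlet_characters M. \<phi> x) = (if [x = 1] (mod int M) then of_nat (card (units_mod M)) else 0)"
proof -
  let ?D = "dirichlet_characters M" and ?c = "of_nat (card (units_mod M)) :: complex"
  define \<delta> where "\<delta> = (\<lambda>x. if [x = 1] (mod int M) then 1 else 0 :: complex)"
  have fin: "finite ?D" by (rule finite_dirichlet_characters[OF M])
  have "\<exists>c. \<forall>x. \<delta> x = (\<Sum>\<phi>\<in>?D. c \<phi> * \<phi> x)"
  proof (rule unit_function_character_expansion[OF M])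
    show "\<delta> x = \<delta> y" if "[x = y] (mod int M)" for x y
      using that by (auto simp: \<delta>_def dest: cong_trans cong_sym)
    show "\<delta> x = 0" if "\<not> coprime x (int M)" for x
      using that cong_imp_coprime[of 1 x "int M"] by (auto simp: \<delta>_def cong_sym)
  qed
  then obtain c where c: "\<And>x. \<delta> x = (\<Sum>\<phi>\<in>?D. c \<phi> * \<phi> x)" by blast
  have "c \<psi> * ?c = 1" if \<psi>: "\<psi> \<in> ?D" for \<psi>
  proof -
    have one: "1 mod int M \<in> units_mod M" using M by (auto simp: units_mod_def coprime_iff_gcd_eq_1)
    have "(\<Sum>x\<in>units_mod M. \<delta> x * cnj (\<psi> x)) = (\<Sum>x\<in>{1 mod int M}. \<delta> x * cnj (\<psi> x))"
    proof (rule sum.mono_neutral_right)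
      show "\<forall>x\<in>units_mod M - {1 mod int M}. \<delta> x * cnj (\<psi> x) = 0"
        by (auto simp: \<delta>_def units_mod_def cong_def)
    qed (use one in auto)
    also have "\<dots> = 1"
      using dirichlet_character_mod[OF \<psi>, of 1] dirichlet_characterD(4)[OF \<psi>] by (simp add: \<delta>_def cong_def)
    finally have "1 = (\<Sum>x\<in>units_mod M. \<delta> x * cnj (\<psi> x))" ..
    also have "\<dots> = (\<Sum>\<phi>\<in>?D. c \<phi> * (\<Sum>x\<in>units_mod M. \<phi> x * cnj (\<psi> x)))"
      unfolding c sum_distrib_right sum_distrib_left by (subst sum.swap) (simp add: mult_ac)
    also have "\<dots> = (\<Sum>\<phi>\<in>?D. if \<phi> = \<psi> then c \<phi> * ?c else 0)"
      by (intro sum.cong refl) (simp add: dirichlet_character_orthogonal[OF M _ \<psi>])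
    also have "\<dots> = c \<psi> * ?c" using fin \<psi> by (simp add: sum.delta)
    finally show ?thesis ..
  qed
  hence "(\<Sum>\<phi>\<in>?D. \<phi> x) = (\<Sum>\<phi>\<in>?D. ?c * (c \<phi> * \<phi> x))"
    by (intro sum.cong refl) (metis (no_types, lifting) mult.assoc mult.commute mult_1)
  also have "\<dots> = ?c * \<delta> x" unfolding c by (simp add: sum_distrib_left)
  finally show ?thesis by (simp add: \<delta>_def)
qed

subsection \<open>Lattices in quadratic spaces\<close>

context pos_def_quadratic_space
begin

lemma B_add_right: "B x (y + z) = B x y + B x z"
  using B_add[of y z x] by (simp add: B_sym)

lemma B_smul_right: "B x (smul c y) = c * B x y"
  using B_smul[of c y x] by (simp add: B_sym)

lemma B_zero_left [simp]: "B 0 x = 0"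
  using B_add[of 0 0 x] by simp

lemma B_zero_right [simp]: "B x 0 = 0"
  using B_zero_left[of x] by (simp add: B_sym)

lemma B_minus_left: "B (- x) y = - B x y"
  using B_add[of x "- x" y] by (simp add: add_eq_0_iff)

lemma B_minus_right: "B x (- y) = - B x y"
  using B_minus_left[of y x] by (simp add: B_sym)

lemma B_diff_left: "B (x - y) z = B x z - B y z"
  using B_add[of x "- y" z] by (simp add: B_minus_left)

lemma B_diff_right: "B x (y - z) = B x y - B x z"
  using B_add_right[of x y "- z"] by (simp add: B_minus_right)

lemma B_sum_left: "B (sum f A) y = (\<Sum>i\<in>A. B (f i) y)"
  by (induction A rule: infinite_finite_induct) (simp_all add: B_add)

lemma B_sum_right: "B x (sum f A) = (\<Sum>i\<in>A. B x (f i))"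
  by (induction A rule: infinite_finite_induct) (simp_all add: B_add_right)

lemmas B_bilinear = B_add B_add_right B_smul B_smul_right B_minus_left B_minus_right B_diff_left B_diff_right

lemma B_nonneg: "B x x \<ge> 0"
  by (cases "x = 0") (auto intro: less_imp_le B_pos)

lemma B_self_eq_0_iff [simp]: "B x x = 0 \<longleftrightarrow> x = 0"
  using B_pos[of x] by fastforce

text \<open>Gram-Schmidt; a vector that reduces to 0 is dropped, so that \<open>W\<close> keeps
  non-zero vectors only.\<close>

lemma orthogonal_spanning_set:
  assumes "finite S"
  shows "\<exists>W. finite W \<and> 0 \<notin> W \<and> (\<forall>x\<in>W. \<forall>y\<in>W. x \<noteq> y \<longrightarrow> B x y = 0) \<and> span W = span S"
  using assms
proof (induction S)
  case empty
  show ?case by (intro exI[of _ "{}"]) auto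
next
  case (insert v S)
  then obtain W where W: "finite W" "0 \<notin> W" "\<And>x y. x \<in> W \<Longrightarrow> y \<in> W \<Longrightarrow> x \<noteq> y \<Longrightarrow> B x y = 0" "span W = span S"
    by metis
  define p where "p = (\<Sum>t\<in>W. smul (B v t / B t t) t)"
  define w where "w = v - p"
  have p: "p \<in> span W" unfolding p_def by (intro span_sum span_scale span_base)
  have orth: "B w t = 0" if t: "t \<in> W" for t
  proof -
    have "B p t = (\<Sum>s\<in>W. B v s / B s s * B s t)"
      unfolding p_def by (simp add: B_sum_left B_smul)
    also have "\<dots> = (\<Sum>s\<in>{t}. B v s / B s s * B s t)"
      by (rule sum.mono_neutral_right) (use W t in auto)
    also have "\<dots> = B v t" using W(2) t by auto
    finally show ?thesis by (simp add: w_def B_diff_left)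
  qed
  have span: "span (insert w W) = span (insert v S)"
  proof -
    have "v \<in> span (insert w W)"
    proof -
      have "v = w + p" by (simp add: w_def)
      moreover have "w \<in> span (insert w W)" by (intro span_base) auto
      moreover have "p \<in> span (insert w W)" using p span_mono[of W "insert w W"] by auto
      ultimately show ?thesis using span_add by metis
    qed
    moreover have "S \<subseteq> span (insert w W)"
      using W(4) span_superset[of S] span_mono[of W "insert w W"] by auto
    moreover have "w \<in> span (insert v S)"
    proof -
      have "p \<in> span (insert v S)" using p W(4) span_mono[of S "insert v S"] by auto
      thus ?thesis unfolding w_def by (intro span_diff[OF span_base]) auto
    qed
    moreover have "W \<subseteq> span (insert v S)"
      using W(4) span_superset[of W] span_mono[of S "insert v S"] by auto
    ultimately show ?thesis by (intro span_eq[THEN iffD2] conjI) auto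
  qed
  show ?case
  proof (cases "w = 0")
    case True
    have "span (insert w W) = span W" using True span_insert_0 by simp
    thus ?thesis using W span by (intro exI[of _ W]) auto
  next
    case False
    have "B t w = 0" if "t \<in> W" for t using orth[OF that] by (simp add: B_sym)
    hence "\<forall>x\<in>insert w W. \<forall>y\<in>insert w W. x \<noteq> y \<longrightarrow> B x y = 0"
      using W(3) orth by auto
    thus ?thesis using W False span by (intro exI[of _ "insert w W"]) auto
  qed
qed

definition comb :: "('n \<Rightarrow> 'v) \<Rightarrow> ('n::finite \<Rightarrow> rat) \<Rightarrow> 'v" where
  "comb v c = (\<Sum>i\<in>UNIV. smul (c i) (v i))"

lemma comb_add: "comb v (\<lambda>i. c i + d i) = comb v c + comb v d"
  by (simp add: comb_def scale_left_distrib sum.distrib)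

lemma comb_diff: "comb v (\<lambda>i. c i - d i) = comb v c - comb v d"
  by (simp add: comb_def scale_left_diff_distrib sum_subtractf)

lemma comb_smul: "comb v (\<lambda>i. r * c i) = smul r (comb v c)"
  by (simp add: comb_def scale_sum_right)

lemma comb_0 [simp]: "comb v (\<lambda>i. 0) = 0"
  by (simp add: comb_def)

lemma comb_unit: "comb v (\<lambda>j. if j = i then 1 else 0) = v i"
  by (simp add: comb_def if_distrib[of "\<lambda>c. smul c _"] cong: if_cong)

lemma B_comb_left: "B (comb v c) y = (\<Sum>i\<in>UNIV. c i * B (v i) y)"
  by (simp add: comb_def B_sum_left B_smul)

lemma B_comb_right: "B y (comb v c) = (\<Sum>i\<in>UNIV. c i * B y (v i))"
  by (simp add: comb_def B_sum_right B_smul_right)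

definition lattice_of :: "('n::finite \<Rightarrow> 'v) \<Rightarrow> 'v set" where
  "lattice_of v = range (\<lambda>c :: 'n \<Rightarrow> int. comb v (\<lambda>i. of_int (c i)))"

lemma lattice_ofI: "comb v (\<lambda>i. of_int (c i)) \<in> lattice_of v"
  by (auto simp: lattice_of_def)

lemma lattice_of_add: "x \<in> lattice_of v \<Longrightarrow> y \<in> lattice_of v \<Longrightarrow> x + y \<in> lattice_of v"
  by (auto simp: lattice_of_def simp flip: comb_add of_int_add)

lemma lattice_of_smul: "x \<in> lattice_of v \<Longrightarrow> smul (of_int r) x \<in> lattice_of v"
  by (auto simp: lattice_of_def simp flip: comb_smul of_int_mult)

lemma lattice_of_diff: "x \<in> lattice_of v \<Longrightarrow> y \<in> lattice_of v \<Longrightarrow> x - y \<in> lattice_of v"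
  by (auto simp: lattice_of_def simp flip: comb_diff of_int_diff)

lemma lattice_of_0 [simp]: "0 \<in> lattice_of v"
  using lattice_ofI[of v "\<lambda>_. 0"] by simp

lemma lattice_of_base: "v i \<in> lattice_of v"
proof -
  have "comb v (\<lambda>j. of_int (if j = i then 1 else 0)) \<in> lattice_of v" by (rule lattice_ofI)
  also have "(\<lambda>j. of_int (if j = i then 1 else 0)) = (\<lambda>j. if j = i then 1 else 0 :: rat)" by auto
  finally show ?thesis by (simp add: comb_unit)
qed

lemma lattice_of_sum: "(\<And>i. i \<in> A \<Longrightarrow> f i \<in> lattice_of v) \<Longrightarrow> sum f A \<in> lattice_of v"
  by (induction A rule: infinite_finite_induct) (auto intro: lattice_of_add)

lemma lattice_of_subset:
  assumes "\<And>i. u i \<in> lattice_of v"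
  shows "lattice_of u \<subseteq> lattice_of v"
  using assms by (auto simp: lattice_of_def[of u] comb_def[of u] intro!: lattice_of_sum lattice_of_smul)

definition scaled :: "int \<Rightarrow> 'v set \<Rightarrow> 'v set" where
  "scaled m A = smul (of_int m) ` A"

end

lemma common_denominator:
  assumes "finite (A :: rat set)"
  obtains m :: int where "m > 0" "\<And>x. x \<in> A \<Longrightarrow> of_int m * x \<in> \<int>"
  using assms
proof (induction A arbitrary: thesis)
  case empty
  thus ?case by (metis empty_iff zero_less_one)
next
  case (insert x A)
  obtain m :: int where m: "m > 0" "\<And>x. x \<in> A \<Longrightarrow> of_int m * x \<in> \<int>"
    using insert.IH by blast
  obtain p q where pq: "quotient_of x = (p, q)" by fastforce
  have q: "q > 0" using quotient_of_denom_pos[OF pq] .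
  have x: "x = of_int p / of_int q" using quotient_of_div[OF pq] .
  have "of_int (m * q) * x = of_int (m * p)" using q by (simp add: x)
  moreover have "of_int (m * q) * y = of_int q * (of_int m * y)" for y :: rat by simp
  ultimately show ?case using m q insert.prems[of "m * q"]
    by (metis Ints_mult Ints_of_int insert_iff mult_pos_pos)
qed

subsection \<open>Transversals\<close>

definition transversal :: "'v::ab_group_add set \<Rightarrow> 'v set \<Rightarrow> 'v set \<Rightarrow> bool" where
  "transversal L M R \<longleftrightarrow> finite R \<and> R \<subseteq> L \<and> (\<forall>x\<in>L. \<exists>!r. r \<in> R \<and> x - r \<in> M)"

locale subgroup_pair =
  fixes L M :: "'v::ab_group_add set"
  assumes L0: "0 \<in> L" and L_diff: "\<And>x y. x \<in> L \<Longrightarrow> y \<in> L \<Longrightarrow> x - y \<in> L"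
    and M0: "0 \<in> M" and M_diff: "\<And>x y. x \<in> M \<Longrightarrow> y \<in> M \<Longrightarrow> x - y \<in> M"
    and M_subset: "M \<subseteq> L"
begin

lemma M_minus: "x \<in> M \<Longrightarrow> - x \<in> M"
  using M_diff[OF M0] by simp

lemma M_add: "x \<in> M \<Longrightarrow> y \<in> M \<Longrightarrow> x + y \<in> M"
  using M_diff[of x "- y"] M_minus by simp

lemma L_add: "x \<in> L \<Longrightarrow> y \<in> L \<Longrightarrow> x + y \<in> L"
  using L_diff[of x "- y"] L_diff[OF L0, of y] by simp

lemma transversal_exists:
  assumes F: "finite F" "F \<subseteq> L" "\<And>x. x \<in> L \<Longrightarrow> \<exists>f\<in>F. x - f \<in> M"
  shows "\<exists>R. transversal L M R"
proof -
  define sel where "sel = (\<lambda>x. SOME y. y \<in> F \<and> x - y \<in> M)"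
  have sel: "sel x \<in> F \<and> x - sel x \<in> M" if "x \<in> L" for x
    unfolding sel_def by (rule someI_ex) (use F(3)[OF that] in blast)
  \<comment> \<open>The chosen element depends on \<open>x\<close> only through its coset, because
    the predicates of the two choices coincide.\<close>
  have eq: "sel x = sel y" if "x - y \<in> M" for x y
  proof -
    have "x - z \<in> M \<longleftrightarrow> y - z \<in> M" for z
      using M_add[OF that, of "y - z"] M_diff[of "x - z" "x - y"] that by auto
    thus ?thesis by (simp add: sel_def)
  qed
  have "transversal L M (sel ` L)"
    unfolding transversal_def
  proof (intro conjI ballI)
    show "finite (sel ` L)" by (rule finite_subset[OF _ F(1)]) (use sel in auto)
    show "sel ` L \<subseteq> L" using sel F by auto
    fix x assume x: "x \<in> L"
    show "\<exists>!r. r \<in> sel ` L \<and> x - r \<in> M"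
    proof (rule ex1I[of _ "sel x"])
      show "sel x \<in> sel ` L \<and> x - sel x \<in> M" using sel x by auto
      fix r assume r: "r \<in> sel ` L \<and> x - r \<in> M"
      then obtain y where y: "y \<in> L" "r = sel y" by auto
      have "y - r \<in> M" using sel y by auto
      hence "x - y \<in> M" using M_diff[of "x - r" "y - r"] r by simp
      thus "r = sel x" using eq[of x y] y by simp
    qed
  qed
  thus ?thesis by blast
qed

lemma sum_transversal_eq:
  fixes f :: "'v \<Rightarrow> 'a::comm_monoid_add"
  assumes R: "transversal L M R" and R': "transversal L M R'"
    and f: "\<And>x y. x \<in> L \<Longrightarrow> y \<in> M \<Longrightarrow> f (x + y) = f x"
  shows "(\<Sum>r\<in>R. f r) = (\<Sum>r\<in>R'. f r)"
proof -
  define p where "p = (\<lambda>A x. THE r. r \<in> A \<and> x - r \<in> M)"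
  have p: "p A x \<in> A \<and> x - p A x \<in> M" if "transversal L M A" "x \<in> L" for A x
    unfolding p_def by (rule theI') (use that in \<open>auto simp: transversal_def\<close>)
  have pu: "p A x = r" if "transversal L M A" "x \<in> L" "r \<in> A" "x - r \<in> M" for A x r
    unfolding p_def by (rule the1_equality) (use that in \<open>auto simp: transversal_def\<close>)
  have sub: "R \<subseteq> L" "R' \<subseteq> L" using R R' by (auto simp: transversal_def)
  show ?thesis
  proof (rule sum.reindex_bij_witness[of _ "p R" "p R'"])
    fix r assume r: "r \<in> R"
    hence rL: "r \<in> L" using sub by blast
    have q: "p R' r \<in> R'" "r - p R' r \<in> M" using p[OF R' rL] by auto
    show "p R' r \<in> R'" by fact
    have m: "p R' r - r \<in> M" using M_minus[OF q(2)] by simp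
    show "p R (p R' r) = r" by (rule pu[OF R _ r m]) (use q sub in blast)
    show "f (p R' r) = f r" using f[OF rL m] by simp
  next
    fix r assume r: "r \<in> R'"
    hence rL: "r \<in> L" using sub by blast
    have q: "p R r \<in> R" "r - p R r \<in> M" using p[OF R rL] by auto
    show "p R r \<in> R" by fact
    have m: "p R r - r \<in> M" using M_minus[OF q(2)] by simp
    show "p R' (p R r) = r" by (rule pu[OF R' _ r m]) (use q sub in blast)
  qed
qed

lemma transversal_translate:
  assumes R: "transversal L M R" and s: "s \<in> L"
  shows "transversal L M ((\<lambda>r. r + s) ` R)"
  unfolding transversal_def
proof (intro conjI ballI)
  show "finite ((\<lambda>r. r + s) ` R)" using R by (simp add: transversal_def)
  show "(\<lambda>r. r + s) ` R \<subseteq> L" using R s by (auto simp: transversal_def intro: L_add)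
  fix x assume "x \<in> L"
  hence "x - s \<in> L" using s L_diff by blast
  then obtain r where r: "r \<in> R" "x - s - r \<in> M" "\<And>r'. r' \<in> R \<Longrightarrow> x - s - r' \<in> M \<Longrightarrow> r' = r"
    using R unfolding transversal_def by metis
  show "\<exists>!t. t \<in> (\<lambda>r. r + s) ` R \<and> x - t \<in> M"
  proof (rule ex1I[of _ "r + s"])
    have eq: "x - (q + s) = x - s - q" for q by (simp add: diff_diff_eq add.commute)
    show "r + s \<in> (\<lambda>r. r + s) ` R \<and> x - (r + s) \<in> M"
      using imageI[OF r(1), of "\<lambda>r. r + s"] r(2) by (simp only: eq simp_thms)
    fix t assume "t \<in> (\<lambda>r. r + s) ` R \<and> x - t \<in> M"
    then obtain r' where r': "r' \<in> R" "t = r' + s" "x - (r' + s) \<in> M" by blast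
    have "r' = r" by (rule r(3)[OF r'(1)]) (use r'(3) eq in simp)
    thus "t = r + s" using r'(2) by simp
  qed
qed

lemma sum_transversal_translate:
  fixes f :: "'v \<Rightarrow> 'a::comm_monoid_add"
  assumes R: "transversal L M R" and s: "s \<in> L"
    and f: "\<And>x y. x \<in> L \<Longrightarrow> y \<in> M \<Longrightarrow> f (x + y) = f x"
  shows "(\<Sum>r\<in>R. f (r + s)) = (\<Sum>r\<in>R. f r)"
proof -
  have "(\<Sum>r\<in>R. f (r + s)) = (\<Sum>r\<in>(\<lambda>r. r + s) ` R. f r)"
    using sum.reindex[of "\<lambda>r. r + s" R f] by (simp add: o_def)
  also have "\<dots> = (\<Sum>r\<in>R. f r)"
    using f by (intro sum_transversal_eq[OF transversal_translate[OF R s] R])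
  finally show ?thesis .
qed

lemma bij_betw_transversal:
  assumes R: "transversal L M R"
  shows "bij_betw (\<lambda>(r, x). x + r) (R \<times> M) L"
  unfolding bij_betw_def
proof (intro conjI equalityI subsetI)
  show "inj_on (\<lambda>(r, x). x + r) (R \<times> M)"
  proof (rule inj_onI, clarify)
    fix r x r' x' assume *: "r \<in> R" "x \<in> M" "r' \<in> R" "x' \<in> M" "x + r = x' + r'"
    have "x + r \<in> L" using * R M_subset by (auto simp: transversal_def intro!: L_add)
    moreover have "x + r - r \<in> M" using *(2) by (simp only: add_diff_cancel_right')
    moreover have "x + r - r' \<in> M" using *(4) unfolding *(5) by simp
    ultimately have "r = r'" using R * unfolding transversal_def by blast
    thus "r = r' \<and> x = x'" using * by simp
  qed
  fix y assume "y \<in> (\<lambda>(r, x). x + r) ` (R \<times> M)"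
  thus "y \<in> L" using R M_subset by (auto simp: transversal_def intro!: L_add)
next
  fix y assume "y \<in> L"
  then obtain r where "r \<in> R" "y - r \<in> M" using R unfolding transversal_def by blast
  thus "y \<in> (\<lambda>(r, x). x + r) ` (R \<times> M)"
    by (intro image_eqI[of _ _ "(r, y - r)"]) auto
qed

lemma infsum_transversal:
  fixes f :: "'v \<Rightarrow> complex"
  assumes R: "transversal L M R" and f: "f summable_on L"
  shows "(\<Sum>\<^sub>\<infinity>x\<in>L. f x) = (\<Sum>r\<in>R. \<Sum>\<^sub>\<infinity>x\<in>M. f (x + r))"
proof -
  have bij: "bij_betw (\<lambda>(r, x). x + r) (R \<times> M) L" by (rule bij_betw_transversal[OF R])
  have sm: "(\<lambda>p. f (case p of (r, x) \<Rightarrow> x + r)) summable_on (R \<times> M)"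
    using summable_on_reindex_bij_betw[OF bij, of f] f by simp
  have "(\<Sum>\<^sub>\<infinity>x\<in>L. f x) = (\<Sum>\<^sub>\<infinity>p\<in>R \<times> M. f (case p of (r, x) \<Rightarrow> x + r))"
    by (rule infsum_reindex_bij_betw[OF bij, symmetric])
  also have "\<dots> = (\<Sum>\<^sub>\<infinity>r\<in>R. \<Sum>\<^sub>\<infinity>x\<in>M. f (x + r))"
    using infsum_Sigma_banach[OF sm] by simp
  finally show ?thesis using R by (simp add: transversal_def)
qed

end

subsection \<open>Poisson summation on lattices\<close>

text \<open>A finite set of index functions lies in the box of its projections, over which the sum
  factors into one-dimensional partial sums.\<close>

lemma prod_functions_nonneg_summable:
  fixes f :: "'n::finite \<Rightarrow> 'b \<Rightarrow> real"
  assumes nn: "\<And>i x. f i x \<ge> 0" and sm: "\<And>i. f i summable_on UNIV"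
  shows "(\<lambda>c. \<Prod>i\<in>UNIV. f i (c i)) summable_on UNIV"
proof (rule nonneg_bdd_above_summable_on)
  show "bdd_above (sum (\<lambda>c. \<Prod>i\<in>UNIV. f i (c i)) ` {F. F \<subseteq> UNIV \<and> finite F})"
  proof (rule bdd_aboveI2)
    fix F :: "('n \<Rightarrow> 'b) set" assume "F \<in> {F. F \<subseteq> UNIV \<and> finite F}"
    hence F: "finite F" by simp
    define G where "G = (\<lambda>i. (\<lambda>c. c i) ` F)"
    have G: "finite (G i)" for i using F by (simp add: G_def)
    have "(\<Sum>c\<in>F. \<Prod>i\<in>UNIV. f i (c i)) \<le> (\<Sum>c\<in>PiE UNIV G. \<Prod>i\<in>UNIV. f i (c i))"
      by (rule sum_mono2) (auto simp: G_def G intro!: finite_PiE F prod_nonneg nn)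
    also have "\<dots> = (\<Prod>i\<in>UNIV. \<Sum>x\<in>G i. f i x)"
      by (rule prod_sum_PiE[symmetric]) (auto simp: G)
    also have "\<dots> \<le> (\<Prod>i\<in>UNIV. infsum (f i) UNIV)"
      by (intro prod_mono conjI sum_nonneg nn finite_sum_le_infsum sm) (auto simp: G nn)
    finally show "(\<Sum>c\<in>F. \<Prod>i\<in>UNIV. f i (c i)) \<le> (\<Prod>i\<in>UNIV. infsum (f i) UNIV)" .
  qed
qed (auto intro: prod_nonneg nn)

lemma infsum_prod_functions:
  fixes f :: "'n::finite \<Rightarrow> 'b \<Rightarrow> complex"
  assumes "\<And>i. (\<lambda>x. norm (f i x)) summable_on UNIV"
  shows "(\<Sum>\<^sub>\<infinity>c. \<Prod>i\<in>UNIV. f i (c i)) = (\<Prod>i\<in>UNIV. infsum (f i) UNIV)"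
proof -
  have "(\<Sum>\<^sub>\<infinity>c\<in>PiE UNIV (\<lambda>_. UNIV). \<Prod>i\<in>UNIV. f i (c i)) = (\<Prod>i\<in>UNIV. infsum (f i) UNIV)"
    by (rule infsum_prod_PiE_abs) (use assms in auto)
  thus ?thesis by (simp add: PiE_UNIV_domain)
qed

lemma qexp_sum: "qexp (sum f A) = (\<Prod>i\<in>A. qexp (f i))"
  by (induction A rule: infinite_finite_induct) (simp_all add: qexp_add)

lemma infsum_of_finite_sum:
  fixes f :: "'a \<Rightarrow> 'b \<Rightarrow> complex"
  assumes "finite A" "\<And>i. i \<in> A \<Longrightarrow> f i summable_on S"
  shows "(\<Sum>\<^sub>\<infinity>x\<in>S. \<Sum>i\<in>A. f i x) = (\<Sum>i\<in>A. infsum (f i) S)"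
proof -
  have "(\<lambda>x. \<Sum>i\<in>A. f i x) summable_on S \<and> (\<Sum>\<^sub>\<infinity>x\<in>S. \<Sum>i\<in>A. f i x) = (\<Sum>i\<in>A. infsum (f i) S)"
    using assms by (induction A) (simp_all add: infsum_add summable_on_add)
  thus ?thesis ..
qed

definition rexp :: "rat \<Rightarrow> complex" where
  "rexp x = qexp (of_real (of_rat x))"

definition gexp :: "complex \<Rightarrow> rat \<Rightarrow> complex" where
  "gexp z x = qexp (z * of_real (of_rat x))"

lemma rexp_add: "rexp (x + y) = rexp x * rexp y"
  by (simp add: rexp_def of_rat_add qexp_add)

lemma rexp_Ints: "x \<in> \<int> \<Longrightarrow> rexp x = 1"
  by (elim Ints_cases) (simp add: rexp_def)

lemma rexp_add_Ints: "y \<in> \<int> \<Longrightarrow> rexp (x + y) = rexp x"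
  by (simp add: rexp_add rexp_Ints)

lemma rexp_eq_1_iff: "rexp x = 1 \<longleftrightarrow> x \<in> \<int>"
proof
  assume "rexp x = 1"
  hence "real_of_rat x \<in> \<int>" using qexp_eq_1_iff unfolding rexp_def by blast
  then obtain n where "real_of_rat x = of_int n" by (rule Ints_cases)
  hence "real_of_rat x = real_of_rat (of_int n)" by simp
  hence "x = of_int n" by (simp only: of_rat_eq_iff)
  thus "x \<in> \<int>" by simp
qed (rule rexp_Ints)

lemma norm_rexp [simp]: "norm (rexp x) = 1"
  by (simp add: rexp_def norm_qexp)

lemma norm_gexp: "norm (gexp z x) = exp (- 2 * pi * Im z * of_rat x)"
  by (simp add: gexp_def norm_qexp)

text \<open>The orthogonal family \<open>T\<close> spans a sublattice of finite index, on which Poisson summation is a product of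
  one-dimensional summations; \<open>den\<close> is a multiple of the exponent of the quotient.\<close>

locale lattice_space = pos_def_quadratic_space smul B
  for smul :: "rat \<Rightarrow> 'v::ab_group_add \<Rightarrow> 'v" and B :: "'v \<Rightarrow> 'v \<Rightarrow> rat" +
  fixes e T :: "'n::finite \<Rightarrow> 'v" and den :: int
  assumes e_inj: "comb e c = comb e d \<Longrightarrow> c = d"
    and T_orth: "i \<noteq> j \<Longrightarrow> B (T i) (T j) = 0"
    and T_nonzero: "T i \<noteq> 0"
    and T_lattice: "T i \<in> lattice_of e"
    and T_expand: "x = comb T (\<lambda>i. B x (T i) / B (T i) (T i))"
    and integral: "x \<in> lattice_of e \<Longrightarrow> y \<in> lattice_of e \<Longrightarrow> B x y \<in> \<int>"
    and den_pos: "den > 0"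
    and den_lattice: "x \<in> lattice_of e \<Longrightarrow> smul (of_int den) x \<in> lattice_of T"
begin

abbreviation "LL \<equiv> lattice_of e"
abbreviation "MM \<equiv> lattice_of T"

definition tt :: "'n \<Rightarrow> rat" where "tt i = B (T i) (T i)"

definition dual_lattice :: "'v set" where
  "dual_lattice = {y. \<forall>x\<in>LL. B y x \<in> \<int>}"

text \<open>The dual of \<open>MM\<close>, tested on its basis; it contains
  \<open>dual_lattice\<close> because \<open>MM\<close> lies in \<open>LL\<close>.\<close>

definition dual_diag :: "'v set" where
  "dual_diag = {y. \<forall>i. B y (T i) \<in> \<int>}"

lemma tt_pos: "tt i > 0"
  using B_pos[OF T_nonzero] by (simp add: tt_def)

lemma tt_Ints: "tt i \<in> \<int>"
  unfolding tt_def by (intro integral T_lattice)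

lemma MM_subset: "MM \<subseteq> LL"
  by (rule lattice_of_subset) (rule T_lattice)

lemma LL_subset_dual: "LL \<subseteq> dual_lattice"
  using integral by (auto simp: dual_lattice_def)

lemma dual_subset_diag: "dual_lattice \<subseteq> dual_diag"
  using T_lattice by (auto simp: dual_lattice_def dual_diag_def)

lemma B_comb_T: "B (comb T c) (T j) = c j * tt j"
proof -
  have "B (comb T c) (T j) = (\<Sum>i\<in>UNIV. c i * B (T i) (T j))" by (rule B_comb_left)
  also have "\<dots> = (\<Sum>i\<in>{j}. c i * B (T i) (T j))"
    by (rule sum.mono_neutral_right) (auto simp: T_orth)
  finally show ?thesis by (simp add: tt_def)
qed

lemma comb_T_inj: "comb T c = comb T d \<Longrightarrow> c = d"
proof
  fix j assume "comb T c = comb T d"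
  hence "c j * tt j = d j * tt j" using B_comb_T by metis
  thus "c j = d j" using tt_pos[of j] by simp
qed

lemma B_comb_comb_T: "B (comb T c) (comb T d) = (\<Sum>i\<in>UNIV. c i * d i * tt i)"
  by (simp add: B_comb_right B_comb_T mult_ac)

lemma T_expand': "\<exists>c. x = comb T c"
  using T_expand by blast

lemma dual_diag_eq: "dual_diag = range (\<lambda>c. comb T (\<lambda>i. of_int (c i) / tt i))"
proof (intro equalityI subsetI)
  fix y assume y: "y \<in> dual_diag"
  define c where "c = (\<lambda>i. \<lfloor>B y (T i)\<rfloor>)"
  have "of_int (c i) = B y (T i)" for i
    using y by (auto simp: c_def dual_diag_def)
  hence "y = comb T (\<lambda>i. of_int (c i) / tt i)" using T_expand[of y] by (simp add: tt_def)
  thus "y \<in> range (\<lambda>c. comb T (\<lambda>i. of_int (c i) / tt i))" by blast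
next
  fix y assume "y \<in> range (\<lambda>c. comb T (\<lambda>i. of_int (c i) / tt i))"
  then obtain c where "y = comb T (\<lambda>i. of_int (c i) / tt i)" by blast
  thus "y \<in> dual_diag" using tt_pos by (simp add: dual_diag_def B_comb_T less_imp_neq[symmetric])
qed

lemma bij_dual_diag: "bij_betw (\<lambda>c :: 'n \<Rightarrow> int. comb T (\<lambda>i. of_int (c i) / tt i)) UNIV dual_diag"
proof -
  have "inj (\<lambda>c :: 'n \<Rightarrow> int. comb T (\<lambda>i. of_int (c i) / tt i))"
  proof (rule injI)
    fix c d :: "'n \<Rightarrow> int" assume "comb T (\<lambda>i. of_int (c i) / tt i) = comb T (\<lambda>i. of_int (d i) / tt i)"
    from comb_T_inj[OF this] have "of_int (c i) / tt i = of_int (d i) / tt i" for i by meson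
    thus "c = d" using tt_pos by (intro ext) (metis divide_cancel_right less_irrefl of_int_eq_iff)
  qed
  thus ?thesis by (simp add: bij_betw_def dual_diag_eq)
qed

lemma bij_MM: "bij_betw (\<lambda>c :: 'n \<Rightarrow> int. comb T (\<lambda>i. of_int (c i))) UNIV MM"
proof -
  have "inj (\<lambda>c :: 'n \<Rightarrow> int. comb T (\<lambda>i. of_int (c i)))"
  proof (rule injI)
    fix c d :: "'n \<Rightarrow> int" assume "comb T (\<lambda>i. of_int (c i)) = comb T (\<lambda>i. of_int (d i))"
    from comb_T_inj[OF this] have "(of_int (c i) :: rat) = of_int (d i)" for i by meson
    thus "c = d" by (intro ext) simp
  qed
  thus ?thesis by (simp add: bij_betw_def lattice_of_def)
qed

text \<open>Summability is settled on \<open>dual_diag\<close>, which contains \<open>MM\<close>,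
  \<open>LL\<close> and \<open>dual_lattice\<close> and in whose coordinates the form is a sum of
  squares.\<close>

lemma gauss_weight_summable:
  assumes y: "y > 0" and A: "A \<subseteq> dual_diag"
  shows "(\<lambda>x. exp (- 2 * pi * y * of_rat (B (x + h) (x + h)))) summable_on A"
proof (rule summable_on_subset_banach[OF _ A])
  obtain a where a: "h = comb T a" using T_expand' by blast
  let ?g = "\<lambda>x. exp (- 2 * pi * y * of_rat (B (x + h) (x + h)))"
  define C where "C = (\<lambda>i. 2 * pi * y / of_rat (tt i))"
  have C: "C i > 0" for i using y tt_pos[of i] by (simp add: C_def)
  have "(\<lambda>c. \<Prod>i\<in>UNIV. exp (- C i * (of_int (c i) + of_rat (tt i * a i)) ^ 2)) summable_on (UNIV :: ('n \<Rightarrow> int) set)"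
    by (rule prod_functions_nonneg_summable[OF exp_ge_zero gaussian_summable[OF C]])
  also have "(\<lambda>c. \<Prod>i\<in>UNIV. exp (- C i * (of_int (c i) + of_rat (tt i * a i)) ^ 2)) =
    (\<lambda>c :: 'n \<Rightarrow> int. ?g (comb T (\<lambda>i. of_int (c i) / tt i)))"
  proof
    fix c :: "'n \<Rightarrow> int"
    have 1: "comb T (\<lambda>i. of_int (c i) / tt i) + h = comb T (\<lambda>i. of_int (c i) / tt i + a i)"
      by (simp add: a comb_add)
    have "- 2 * pi * y * of_rat ((of_int (c i) / tt i + a i) * (of_int (c i) / tt i + a i) * tt i)
      = - C i * (of_int (c i) + of_rat (tt i * a i)) ^ 2" for i
    proof -
      have "(of_int (c i) / tt i + a i) * (of_int (c i) / tt i + a i) * tt i = (of_int (c i) + tt i * a i) ^ 2 / tt i"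
        using tt_pos[of i] by (simp add: field_simps power2_eq_square)
      hence "real_of_rat ((of_int (c i) / tt i + a i) * (of_int (c i) / tt i + a i) * tt i) = (of_int (c i) + of_rat (tt i * a i)) ^ 2 / of_rat (tt i)"
        by (simp add: of_rat_divide of_rat_power of_rat_add of_rat_mult)
      thus ?thesis by (simp add: C_def)
    qed
    thus "(\<Prod>i\<in>UNIV. exp (- C i * (of_int (c i) + of_rat (tt i * a i)) ^ 2)) = ?g (comb T (\<lambda>i. of_int (c i) / tt i))"
      unfolding 1 B_comb_comb_T by (simp add: of_rat_sum sum_distrib_left exp_sum)
  qed
  finally show "?g summable_on dual_diag"
    using summable_on_reindex_bij_betw[OF bij_dual_diag, of ?g] by simp
qed

lemma gexp_summable:
  assumes "Im z > 0" and "A \<subseteq> dual_diag"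
  shows "(\<lambda>x. norm (gexp z (B (x + h) (x + h)))) summable_on A"
  using gauss_weight_summable[OF assms, of h] by (simp add: norm_gexp)

lemma of_rat_tt_pos: "real_of_rat (tt i) > 0"
  using tt_pos by simp

text \<open>In orthogonal coordinates the summand factors. The dual index m in direction
  \<open>i\<close> belongs to the vector with coordinate m / tt i, of norm m^2 / tt i. The quarter
  arises because the exponent is B(x,x) and not B(x,x)/2; it is the origin of the factor 4 in the
  level.\<close>

lemma poisson_diag:
  assumes z: "Im z > 0"
  shows "(\<Sum>\<^sub>\<infinity>x\<in>MM. gexp z (B (x + h) (x + h))) =
    inv_sqrt_uhp z ^ CARD('n) / (\<Prod>i\<in>UNIV. of_real (sqrt (2 * of_rat (tt i)))) *
    (\<Sum>\<^sub>\<infinity>y\<in>dual_diag. rexp (B y h) * gexp (- 1 / z) (B y y / 4))"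
proof -
  obtain a where a: "h = comb T a" using T_expand' by blast
  let ?f = "\<lambda>i (n :: int). qexp (z * of_real (of_rat (tt i) * (of_int n + of_rat (a i)) ^ 2))"
  let ?g = "\<lambda>i (m :: int). qexp (of_real (of_int m * of_rat (a i))) * qexp (- 1 / z * of_real (of_int m ^ 2 / (4 * of_rat (tt i))))"
  have zi: "Im (- 1 / z) > 0" using uhp_minus_inverse[OF z] .
  have f_sum: "(\<lambda>n. norm (?f i n)) summable_on UNIV" for i
  proof -
    have "(\<lambda>n :: int. exp (- (2 * pi * Im z * of_rat (tt i)) * (of_int n + of_rat (a i)) ^ 2)) summable_on UNIV"
      using z of_rat_tt_pos by (intro gaussian_summable) auto
    thus ?thesis by (simp add: norm_qexp mult.assoc)
  qed
  have g_sum: "(\<lambda>n. norm (?g i n)) summable_on UNIV" for i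
  proof -
    have "(\<lambda>n :: int. exp (- (2 * pi * Im (- 1 / z) / (4 * of_rat (tt i))) * (of_int n + 0) ^ 2)) summable_on UNIV"
      by (intro gaussian_summable divide_pos_pos mult_pos_pos zi of_rat_tt_pos) simp_all
    moreover have "norm (?g i m) = exp (- (2 * pi * Im (- 1 / z) / (4 * of_rat (tt i))) * (of_int m + 0) ^ 2)" for m
    proof -
      have "Im (- 1 / z * of_real (of_int m ^ 2 / (4 * of_rat (tt i)))) = Im (- 1 / z) * (of_int m ^ 2 / (4 * of_rat (tt i)))"
        by (simp only: times_complex.simps Re_complex_of_real Im_complex_of_real mult_zero_right add_0_left)
      thus ?thesis by (simp add: norm_mult norm_qexp)
    qed
    ultimately show ?thesis by simp
  qed
  have "(\<Sum>\<^sub>\<infinity>x\<in>MM. gexp z (B (x + h) (x + h))) = (\<Sum>\<^sub>\<infinity>c :: 'n \<Rightarrow> int. gexp z (B (comb T (\<lambda>i. of_int (c i)) + h) (comb T (\<lambda>i. of_int (c i)) + h)))"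
    by (rule infsum_reindex_bij_betw[OF bij_MM, symmetric])
  also have "\<dots> = (\<Sum>\<^sub>\<infinity>c :: 'n \<Rightarrow> int. \<Prod>i\<in>UNIV. ?f i (c i))"
  proof (rule infsum_cong)
    fix c :: "'n \<Rightarrow> int"
    have 1: "comb T (\<lambda>i. of_int (c i)) + h = comb T (\<lambda>i. of_int (c i) + a i)"
      by (simp add: a comb_add)
    show "gexp z (B (comb T (\<lambda>i. of_int (c i)) + h) (comb T (\<lambda>i. of_int (c i)) + h)) = (\<Prod>i\<in>UNIV. ?f i (c i))"
      unfolding 1 B_comb_comb_T gexp_def qexp_sum[symmetric]
      by (simp add: of_rat_sum of_rat_mult of_rat_add sum_distrib_left power2_eq_square mult_ac)
  qed
  also have "\<dots> = (\<Prod>i\<in>UNIV. infsum (?f i) UNIV)"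
    by (rule infsum_prod_functions[OF f_sum])
  also have "\<dots> = (\<Prod>i\<in>UNIV. inv_sqrt_uhp z / of_real (sqrt (2 * of_rat (tt i))) * infsum (?g i) UNIV)"
    by (intro prod.cong refl poisson_gaussian z of_rat_tt_pos)
  also have "\<dots> = inv_sqrt_uhp z ^ CARD('n) / (\<Prod>i\<in>UNIV. of_real (sqrt (2 * of_rat (tt i)))) * (\<Prod>i\<in>UNIV. infsum (?g i) UNIV)"
    by (simp add: prod.distrib prod_dividef)
  also have "(\<Prod>i\<in>UNIV. infsum (?g i) UNIV) = (\<Sum>\<^sub>\<infinity>c :: 'n \<Rightarrow> int. \<Prod>i\<in>UNIV. ?g i (c i))"
    by (rule infsum_prod_functions[OF g_sum, symmetric])
  also have "\<dots> = (\<Sum>\<^sub>\<infinity>c :: 'n \<Rightarrow> int. (\<lambda>y. rexp (B y h) * gexp (- 1 / z) (B y y / 4)) (comb T (\<lambda>i. of_int (c i) / tt i)))"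
  proof (rule infsum_cong)
    fix c :: "'n \<Rightarrow> int"
    have 1: "B (comb T (\<lambda>i. of_int (c i) / tt i)) h = (\<Sum>i\<in>UNIV. of_int (c i) * a i)"
      unfolding a B_comb_comb_T using tt_pos by (intro sum.cong) (auto simp: less_imp_neq[symmetric])
    have 2: "B (comb T (\<lambda>i. of_int (c i) / tt i)) (comb T (\<lambda>i. of_int (c i) / tt i)) / 4 = (\<Sum>i\<in>UNIV. of_int (c i) ^ 2 / (4 * tt i))"
      unfolding B_comb_comb_T sum_divide_distrib using tt_pos
      by (intro sum.cong) (auto simp: less_imp_neq[symmetric] power2_eq_square)
    show "(\<Prod>i\<in>UNIV. ?g i (c i)) = (\<lambda>y. rexp (B y h) * gexp (- 1 / z) (B y y / 4)) (comb T (\<lambda>i. of_int (c i) / tt i))"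
      unfolding 1 2 rexp_def gexp_def prod.distrib qexp_sum[symmetric]
      by (simp add: of_rat_sum of_rat_mult of_rat_divide of_rat_power sum_distrib_left)
  qed
  also have "\<dots> = (\<Sum>\<^sub>\<infinity>y\<in>dual_diag. rexp (B y h) * gexp (- 1 / z) (B y y / 4))"
    by (rule infsum_reindex_bij_betw[OF bij_dual_diag])
  finally show ?thesis .
qed

sublocale LM: subgroup_pair LL MM
  by unfold_locales (auto intro: lattice_of_diff MM_subset[THEN subsetD])

lemma LM_transversal_exists: "\<exists>R. transversal LL MM R"
proof (rule LM.transversal_exists)
  let ?F = "(\<lambda>c :: 'n \<Rightarrow> int. comb e (\<lambda>i. of_int (c i))) ` (PiE UNIV (\<lambda>_. {0..<den}))"
  show "finite ?F" by (intro finite_imageI finite_PiE) auto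
  show "?F \<subseteq> LL" by (auto intro: lattice_ofI)
  fix x assume "x \<in> LL"
  then obtain c where c: "x = comb e (\<lambda>i. of_int (c i))" by (auto simp: lattice_of_def)
  have "x - comb e (\<lambda>i. of_int (c i mod den)) = smul (of_int den) (comb e (\<lambda>i. of_int (c i div den)))"
    unfolding c by (simp flip: comb_diff comb_smul of_int_diff of_int_mult add: minus_mod_eq_mult_div)
  hence "x - comb e (\<lambda>i. of_int (c i mod den)) \<in> MM"
    using den_lattice[OF lattice_ofI] by simp
  moreover have "comb e (\<lambda>i. of_int (c i mod den)) \<in> ?F"
    using den_pos by (intro image_eqI[of _ _ "\<lambda>i. c i mod den"]) auto
  ultimately show "\<exists>f\<in>?F. x - f \<in> MM" by blast
qed

text \<open>A vector of \<open>dual_diag\<close> induces a character of \<open>LL\<close> modulo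
  \<open>MM\<close>, which is trivial exactly on \<open>dual_lattice\<close>.\<close>

lemma transversal_character_sum:
  assumes R: "transversal LL MM R" and y: "y \<in> dual_diag"
  shows "(\<Sum>r\<in>R. rexp (B y r)) = (if y \<in> dual_lattice then of_nat (card R) else 0)"
proof (cases "y \<in> dual_lattice")
  case True
  have "rexp (B y r) = 1" if "r \<in> R" for r
    using that R True by (auto simp: transversal_def dual_lattice_def intro!: rexp_Ints)
  thus ?thesis using True by simp
next
  case False
  then obtain l where l: "l \<in> LL" "B y l \<notin> \<int>" by (auto simp: dual_lattice_def)
  have M: "B y x \<in> \<int>" if x: "x \<in> MM" for x
  proof -
    obtain c where c: "x = comb T (\<lambda>i. of_int (c i))" using x unfolding lattice_of_def by blast
    show ?thesis unfolding c B_comb_right using y by (auto simp: dual_diag_def intro!: Ints_sum Ints_mult)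
  qed
  have "(\<Sum>r\<in>R. rexp (B y (r + l))) = (\<Sum>r\<in>R. rexp (B y r))"
    by (rule LM.sum_transversal_translate[OF R l(1)]) (simp add: B_add_right rexp_add_Ints M)
  moreover have "(\<Sum>r\<in>R. rexp (B y (r + l))) = rexp (B y l) * (\<Sum>r\<in>R. rexp (B y r))"
    by (simp add: B_add_right rexp_add sum_distrib_left mult_ac)
  ultimately have "(rexp (B y l) - 1) * (\<Sum>r\<in>R. rexp (B y r)) = 0" by (simp add: algebra_simps)
  thus ?thesis using l(2) rexp_eq_1_iff False by auto
qed

lemma rexp_gexp_summable:
  assumes "Im z > 0" and "A \<subseteq> dual_diag" and "r > 0"
  shows "(\<lambda>y. norm (rexp (f y) * gexp z (B y y * r))) summable_on A"
proof -
  have "Im z * of_rat r > 0" using assms by simp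
  from gauss_weight_summable[OF this assms(2), of 0]
  show ?thesis by (simp add: norm_mult norm_gexp of_rat_mult mult_ac)
qed

text \<open>Adding up \<open>poisson_diag\<close> over the cosets of \<open>MM\<close> in
  \<open>LL\<close> produces a character sum that discards the part of \<open>dual_diag\<close>
  outside \<open>dual_lattice\<close>. Of the constant, what is recorded is that it is non-zero and
  independent of \<open>z\<close> and \<open>h\<close>.\<close>

theorem poisson_lattice:
  obtains C :: complex where "C \<noteq> 0"
    and "\<And>z h. Im z > 0 \<Longrightarrow> (\<Sum>\<^sub>\<infinity>x\<in>LL. gexp z (B (x + h) (x + h))) =
      C * inv_sqrt_uhp z ^ CARD('n) * (\<Sum>\<^sub>\<infinity>y\<in>dual_lattice. rexp (B y h) * gexp (- 1 / z) (B y y / 4))"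
proof -
  obtain R where R: "transversal LL MM R" using LM_transversal_exists by blast
  have finR: "finite R" using R by (simp add: transversal_def)
  define P where "P = (\<Prod>i\<in>UNIV. complex_of_real (sqrt (2 * of_rat (tt i))))"
  have P: "P \<noteq> 0" unfolding P_def using of_rat_tt_pos by (simp add: less_imp_neq[symmetric])
  have cardR: "card R > 0"
  proof -
    have "R \<noteq> {}" using R lattice_of_0[of e] unfolding transversal_def by blast
    thus ?thesis using finR by (simp add: card_gt_0_iff)
  qed
  show ?thesis
  proof (rule that)
    show "of_nat (card R) / P \<noteq> 0" using cardR P by simp
    fix z h assume z: "Im z > 0"
    have zi: "Im (- 1 / z) > 0" using uhp_minus_inverse[OF z] .
    let ?G = "\<lambda>h y. rexp (B y h) * gexp (- 1 / z) (B y y / 4)"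
    have sm: "(\<lambda>y. norm (?G h y)) summable_on A" if "A \<subseteq> dual_diag" for h A
      using rexp_gexp_summable[OF zi that, of "1 / 4" "\<lambda>y. B y h"] by simp
    have "(\<lambda>x. gexp z (B (x + h) (x + h))) summable_on LL"
      by (rule abs_summable_summable[OF gexp_summable[OF z]])
         (use LL_subset_dual dual_subset_diag in blast)
    hence "(\<Sum>\<^sub>\<infinity>x\<in>LL. gexp z (B (x + h) (x + h))) = (\<Sum>r\<in>R. \<Sum>\<^sub>\<infinity>x\<in>MM. gexp z (B (x + r + h) (x + r + h)))"
      by (rule LM.infsum_transversal[OF R])
    also have "\<dots> = (\<Sum>r\<in>R. inv_sqrt_uhp z ^ CARD('n) / P * (\<Sum>\<^sub>\<infinity>y\<in>dual_diag. ?G (r + h) y))"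
      by (intro sum.cong refl) (simp only: add.assoc poisson_diag[OF z] P_def)
    also have "\<dots> = inv_sqrt_uhp z ^ CARD('n) / P * (\<Sum>r\<in>R. \<Sum>\<^sub>\<infinity>y\<in>dual_diag. ?G (r + h) y)"
      by (simp only: sum_distrib_left)
    also have "(\<Sum>r\<in>R. \<Sum>\<^sub>\<infinity>y\<in>dual_diag. ?G (r + h) y) = (\<Sum>\<^sub>\<infinity>y\<in>dual_diag. \<Sum>r\<in>R. ?G (r + h) y)"
      by (rule infsum_of_finite_sum[OF finR, symmetric]) (rule abs_summable_summable[OF sm[OF order_refl]])
    also have "\<dots> = (\<Sum>\<^sub>\<infinity>y\<in>dual_diag. (if y \<in> dual_lattice then of_nat (card R) else 0) * ?G h y)"
    proof (rule infsum_cong)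
      fix y assume y: "y \<in> dual_diag"
      have "(\<Sum>r\<in>R. ?G (r + h) y) = (\<Sum>r\<in>R. rexp (B y r)) * ?G h y"
        by (simp only: B_add_right rexp_add sum_distrib_right mult.assoc)
      thus "(\<Sum>r\<in>R. ?G (r + h) y) = (if y \<in> dual_lattice then of_nat (card R) else 0) * ?G h y"
        by (simp only: transversal_character_sum[OF R y])
    qed
    also have "\<dots> = (\<Sum>\<^sub>\<infinity>y\<in>dual_lattice. of_nat (card R) * ?G h y)"
      by (rule infsum_cong_neutral) (use dual_subset_diag in auto)
    also have "\<dots> = of_nat (card R) * (\<Sum>\<^sub>\<infinity>y\<in>dual_lattice. ?G h y)"
      by (rule infsum_cmult_right) (rule abs_summable_summable[OF sm[OF dual_subset_diag]])
    finally show "(\<Sum>\<^sub>\<infinity>x\<in>LL. gexp z (B (x + h) (x + h))) =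
      of_nat (card R) / P * inv_sqrt_uhp z ^ CARD('n) * (\<Sum>\<^sub>\<infinity>y\<in>dual_lattice. ?G h y)"
      by simp
  qed
qed

end

subsection \<open>Transformation of theta series\<close>

lemma gexp_of_int_mult: "gexp z (of_int m * x) = gexp (of_int m * z) x"
  by (simp add: gexp_def of_rat_mult mult_ac)

lemma gexp_add_left: "gexp (z + w) x = gexp z x * gexp w x"
  by (simp add: gexp_def qexp_add ring_distribs)

lemma gexp_of_rat: "gexp (of_real (of_rat r)) x = rexp (r * x)"
  by (simp add: gexp_def rexp_def of_rat_mult)

lemma Im_of_int_times: "Im (of_int n * w) = of_int n * Im w"
  by simp

text \<open>Up to an integer translation, -1/z' is -1/z rescaled by \<delta>^2. After Poisson
  summation the translation is a mere phase, and the rescaling cancels against the finer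
  lattice.\<close>

lemma mobius_eq_shifted_inversion:
  assumes det: "\<alpha> * \<delta> - \<beta> * c = 1" and \<delta>: "\<delta> \<noteq> (0::int)" and z: "Im z > 0"
  defines "z' \<equiv> z / (of_int \<delta> * (of_int c * z + of_int \<delta>))"
  shows "mobius \<alpha> \<beta> c \<delta> z = of_real (of_rat (of_int \<beta> / of_int \<delta>)) + z'"
    and "- 1 / z' = of_int (\<delta> ^ 2) * (- 1 / z) - of_int (\<delta> * c)"
    and "Im z' > 0"
proof -
  have z0: "z \<noteq> 0" using z by auto
  have nz: "of_int c * z + of_int \<delta> \<noteq> 0"
  proof
    assume *: "of_int c * z + of_int \<delta> = 0"
    hence "Im (of_int c * z + of_int \<delta>) = 0" by simp
    hence "c = 0" using z by simp
    thus False using * \<delta> by simp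
  qed
  have det': "(of_int \<alpha> :: complex) * of_int \<delta> = 1 + of_int \<beta> * of_int c"
    using det by (metis add.commute diff_eq_eq of_int_1 of_int_add of_int_mult)
  have "(of_int \<alpha> * z + of_int \<beta>) * of_int \<delta> = of_int \<beta> * (of_int c * z + of_int \<delta>) + z"
  proof -
    have "(of_int \<alpha> * z + of_int \<beta>) * of_int \<delta> = (of_int \<alpha> * of_int \<delta>) * z + of_int \<beta> * of_int \<delta>"
      by (simp add: algebra_simps)
    thus ?thesis unfolding det' by (simp add: algebra_simps)
  qed
  hence "mobius \<alpha> \<beta> c \<delta> z = of_int \<beta> / of_int \<delta> + z'"
  proof -
    assume key: "(of_int \<alpha> * z + of_int \<beta>) * of_int \<delta> = of_int \<beta> * (of_int c * z + of_int \<delta>) + z"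
    have "mobius \<alpha> \<beta> c \<delta> z = ((of_int \<alpha> * z + of_int \<beta>) * of_int \<delta>) / (of_int \<delta> * (of_int c * z + of_int \<delta>))"
      using \<delta> by (simp add: mobius_def)
    also have "\<dots> = of_int \<beta> * (of_int c * z + of_int \<delta>) / (of_int \<delta> * (of_int c * z + of_int \<delta>)) + z'"
      by (simp only: key add_divide_distrib z'_def)
    also have "of_int \<beta> * (of_int c * z + of_int \<delta>) / (of_int \<delta> * (of_int c * z + of_int \<delta>)) = of_int \<beta> / of_int \<delta>"
      using nz by simp
    finally show ?thesis .
  qed
  thus "mobius \<alpha> \<beta> c \<delta> z = of_real (of_rat (of_int \<beta> / of_int \<delta>)) + z'"
    by (simp add: of_rat_divide)
  show e: "- 1 / z' = of_int (\<delta> ^ 2) * (- 1 / z) - of_int (\<delta> * c)"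
    unfolding z'_def using z0 nz \<delta> by (simp add: divide_simps) (simp add: algebra_simps power2_eq_square)
  have "Im (of_int (\<delta> ^ 2) * (- 1 / z)) > 0"
    unfolding Im_of_int_times using \<delta> by (intro mult_pos_pos uhp_minus_inverse[OF z]) simp
  hence "Im (- 1 / z') > 0" unfolding e by simp
  from uhp_minus_inverse[OF this] show "Im z' > 0" by simp
qed

context lattice_space
begin

section \<open>Residue systems of a lattice and their Gauss sums\<close>

definition box :: "('n \<Rightarrow> 'v) \<Rightarrow> int \<Rightarrow> 'v set" where
  "box v m = (\<lambda>c :: 'n \<Rightarrow> int. comb v (\<lambda>i. of_int (c i))) ` (PiE UNIV (\<lambda>_. {0..<\<bar>m\<bar>}))"

lemma scaled_pair: "subgroup_pair (lattice_of v) (scaled m (lattice_of v))"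
proof
  show "0 \<in> scaled m (lattice_of v)"
    unfolding scaled_def by (rule image_eqI[of _ _ 0]) auto
  show "x - y \<in> scaled m (lattice_of v)" if "x \<in> scaled m (lattice_of v)" "y \<in> scaled m (lattice_of v)" for x y
    using that unfolding scaled_def by (auto simp: image_iff scale_right_diff_distrib[symmetric] intro: lattice_of_diff)
  show "scaled m (lattice_of v) \<subseteq> lattice_of v" by (auto simp: scaled_def intro: lattice_of_smul)
qed (auto intro: lattice_of_diff)

lemma comb_of_int_inj:
  assumes "\<And>c d. comb v c = comb v d \<Longrightarrow> c = d"
  shows "inj (\<lambda>c :: 'n \<Rightarrow> int. comb v (\<lambda>i. of_int (c i)))"
proof (rule injI)
  fix c d :: "'n \<Rightarrow> int" assume "comb v (\<lambda>i. of_int (c i)) = comb v (\<lambda>i. of_int (d i))"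
  from assms[OF this] have "(of_int (c i) :: rat) = of_int (d i)" for i by meson
  thus "c = d" by (intro ext) simp
qed

lemma transversal_box:
  assumes inj: "\<And>c d. comb v c = comb v d \<Longrightarrow> c = d" and m: "m \<noteq> 0"
  shows "transversal (lattice_of v) (scaled m (lattice_of v)) (box v m)"
  unfolding transversal_def
proof (intro conjI ballI)
  show "finite (box v m)" unfolding box_def by (intro finite_imageI finite_PiE) auto
  show "box v m \<subseteq> lattice_of v" by (auto simp: box_def intro: lattice_ofI)
  fix x assume "x \<in> lattice_of v"
  then obtain c where c: "x = comb v (\<lambda>i. of_int (c i))" by (auto simp: lattice_of_def)
  define k where "k = \<bar>m\<bar>"
  have k: "k > 0" using m by (simp add: k_def)
  show "\<exists>!r. r \<in> box v m \<and> x - r \<in> scaled m (lattice_of v)"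
  proof (rule ex1I[of _ "comb v (\<lambda>i. of_int (c i mod k))"])
    \<comment> \<open>Digits are taken modulo |m| while multiples of \<open>m\<close> are split off;
      \<open>sgn m\<close> reconciles the two.\<close>
    have diff: "x - comb v (\<lambda>i. of_int (c i mod k)) = smul (of_int m) (comb v (\<lambda>i. of_int (sgn m * (c i div k))))"
      unfolding c by (simp flip: comb_diff comb_smul of_int_diff of_int_mult
        add: minus_mod_eq_mult_div mult.assoc[symmetric] k_def abs_sgn)
    have "comb v (\<lambda>i. of_int (c i mod k)) \<in> box v m"
      unfolding box_def using k by (intro image_eqI[of _ _ "\<lambda>i. c i mod k"]) (auto simp: k_def)
    thus "comb v (\<lambda>i. of_int (c i mod k)) \<in> box v m \<and> x - comb v (\<lambda>i. of_int (c i mod k)) \<in> scaled m (lattice_of v)"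
      unfolding diff scaled_def by (intro conjI imageI lattice_ofI)
    fix r assume r: "r \<in> box v m \<and> x - r \<in> scaled m (lattice_of v)"
    then obtain d where d: "r = comb v (\<lambda>i. of_int (d i))" "\<And>i. d i \<in> {0..<\<bar>m\<bar>}"
      unfolding box_def by (auto simp: PiE_def Pi_def)
    obtain w where "x - r = smul (of_int m) (comb v (\<lambda>i. of_int (w i)))"
      using r by (auto simp: scaled_def lattice_of_def)
    hence "comb v (\<lambda>i. of_int (c i - d i)) = comb v (\<lambda>i. of_int (m * w i))"
      unfolding c d(1) by (simp add: comb_diff comb_smul)
    from inj[OF this] have "(of_int (c i - d i) :: rat) = of_int (m * w i)" for i by meson
    hence cd: "c i - d i = m * w i" for i by (simp only: of_int_eq_iff)
    have "c i mod k = d i" for i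
    proof -
      have "k dvd c i - d i" unfolding cd k_def by simp
      hence "c i mod k = d i mod k" by (simp add: mod_eq_dvd_iff)
      also have "\<dots> = d i" using d(2)[of i] by (simp add: k_def)
      finally show ?thesis .
    qed
    thus "r = comb v (\<lambda>i. of_int (c i mod k))" unfolding d(1) by simp
  qed
qed

text \<open>As \<open>den\<close> maps \<open>LL\<close> into \<open>MM\<close>, Bezout's relation
  between \<open>m\<close> and \<open>den\<close> shows that \<open>MM\<close> meets every class of
  \<open>LL\<close> modulo \<open>m\<close>, and that classes modulo \<open>m\<close> in
  \<open>MM\<close> stay distinct in \<open>LL\<close>. Gauss sums can thus be computed in the
  orthogonal basis.\<close>

lemma transversal_box_diag:
  assumes m: "m \<noteq> 0" and cop: "coprime m den"
  shows "transversal LL (scaled m LL) (box T m)"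
proof -
  interpret S: subgroup_pair MM "scaled m MM" by (rule scaled_pair)
  obtain u w where uw: "u * den + w * m = 1"
    using cop by (metis bezout_int coprime_commute coprime_imp_gcd_eq_1)
  have split: "x = smul (of_int u) (smul (of_int den) x) + smul (of_int m) (smul (of_int w) x)" for x
  proof -
    have "smul (of_int u) (smul (of_int den) x) + smul (of_int m) (smul (of_int w) x) = smul (of_int (u * den + w * m)) x"
      by (simp add: scale_left_distrib mult.commute)
    thus ?thesis by (simp add: uw)
  qed
  have tr: "transversal MM (scaled m MM) (box T m)"
    by (rule transversal_box[OF comb_T_inj m])
  show ?thesis
    unfolding transversal_def
  proof (intro conjI ballI)
    show "finite (box T m)" using tr by (simp add: transversal_def)
    show "box T m \<subseteq> LL" using tr MM_subset by (auto simp: transversal_def)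
    fix x assume x: "x \<in> LL"
    define y where "y = smul (of_int u) (smul (of_int den) x)"
    have y: "y \<in> MM" unfolding y_def by (intro lattice_of_smul den_lattice x)
    have xy: "x - y \<in> scaled m LL"
    proof -
      have "x = y + smul (of_int m) (smul (of_int w) x)" unfolding y_def by (rule split)
      hence "x - y = smul (of_int m) (smul (of_int w) x)" by (metis add_diff_cancel_left')
      thus ?thesis unfolding scaled_def using lattice_of_smul[OF x] by blast
    qed
    interpret S': subgroup_pair LL "scaled m LL" by (rule scaled_pair)
    have sub: "scaled m MM \<subseteq> scaled m LL" using MM_subset by (auto simp: scaled_def)
    have inter: "d \<in> scaled m MM" if d: "d \<in> MM" "d \<in> scaled m LL" for d
    proof -
      obtain v where v: "v \<in> LL" "d = smul (of_int m) v" using d(2) by (auto simp: scaled_def)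
      have "v = smul (of_int u) (smul (of_int den) v) + smul (of_int w) d"
        using split[of v] v(2) by (simp add: mult.commute)
      moreover have "smul (of_int u) (smul (of_int den) v) + smul (of_int w) d \<in> MM"
        by (intro lattice_of_add lattice_of_smul den_lattice v d)
      ultimately show ?thesis using v(2) by (auto simp: scaled_def)
    qed
    obtain r where r: "r \<in> box T m" "y - r \<in> scaled m MM" using tr y unfolding transversal_def by blast
    show "\<exists>!r. r \<in> box T m \<and> x - r \<in> scaled m LL"
    proof (rule ex1I[of _ r])
      have "x - r = (x - y) + (y - r)" by simp
      also have "\<dots> \<in> scaled m LL" by (rule S'.M_add[OF xy]) (use r sub in blast)
      finally have xr: "x - r \<in> scaled m LL" .
      thus "r \<in> box T m \<and> x - r \<in> scaled m LL" using r by simp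
      fix r' assume r': "r' \<in> box T m \<and> x - r' \<in> scaled m LL"
      have rM: "r \<in> MM" "r' \<in> MM" using r r' tr by (auto simp: transversal_def)
      have "r - r' = (x - r') - (x - r)" by simp
      also have "\<dots> \<in> scaled m LL" using r' xr S'.M_diff[of "x - r'" "x - r"] by blast
      finally have "r - r' \<in> scaled m MM" using inter[of "r - r'"] rM by (simp add: lattice_of_diff)
      moreover have "r - r \<in> scaled m MM" using S.M0 by simp
      ultimately show "r' = r" using tr r(1) r' rM(1) unfolding transversal_def by blast
    qed
  qed
qed

definition lattice_gauss_sum :: "int \<Rightarrow> int \<Rightarrow> complex" where
  "lattice_gauss_sum b m = (\<Sum>r\<in>box e m. rexp (of_int b * B r r / of_int m))"

lemma rexp_divide_periodic:
  assumes "m \<noteq> 0" "x \<in> LL" "v \<in> scaled m LL"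
  shows "rexp (of_int b * B (x + v) (x + v) / of_int m) = rexp (of_int b * B x x / of_int m)"
proof -
  obtain w where w: "w \<in> LL" "v = smul (of_int m) w" using assms by (auto simp: scaled_def)
  have "of_int b * B (x + v) (x + v) / of_int m = of_int b * B x x / of_int m + of_int b * (2 * B x w + of_int m * B w w)"
    using assms(1) unfolding w(2) by (simp add: B_bilinear B_sym[of w x] field_simps)
  moreover have "of_int b * (2 * B x w + of_int m * B w w) \<in> \<int>"
    using integral[OF assms(2) w(1)] integral[OF w(1) w(1)] by (intro Ints_mult Ints_add) auto
  ultimately show ?thesis by (simp only: rexp_add_Ints)
qed

lemma lattice_gauss_sum_eq_prod:
  assumes m: "m \<noteq> 0" and cop: "coprime m den"
  shows "lattice_gauss_sum b m = (\<Prod>i\<in>UNIV. gauss_sum (b * \<lfloor>tt i\<rfloor>) m)"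
proof -
  interpret S: subgroup_pair LL "scaled m LL" by (rule scaled_pair)
  let ?P = "PiE UNIV (\<lambda>_ :: 'n. {0..<\<bar>m\<bar>})"
  let ?f = "\<lambda>i (x :: int). qexp (of_real (of_int ((b * \<lfloor>tt i\<rfloor>) * x ^ 2) / of_int m))"
  have tt: "of_int \<lfloor>tt i\<rfloor> = tt i" for i using tt_Ints[of i] by (auto elim: Ints_cases)
  have "lattice_gauss_sum b m = (\<Sum>r\<in>box T m. rexp (of_int b * B r r / of_int m))"
    unfolding lattice_gauss_sum_def
    by (rule S.sum_transversal_eq[OF transversal_box[OF _ m] transversal_box_diag[OF m cop]])
       (erule e_inj, rule rexp_divide_periodic[OF m])
  also have "\<dots> = (\<Sum>c\<in>?P. rexp (of_int b * B (comb T (\<lambda>i. of_int (c i))) (comb T (\<lambda>i. of_int (c i))) / of_int m))"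
    unfolding box_def
    by (subst sum.reindex) (auto simp: o_def intro: inj_on_subset[OF comb_of_int_inj[OF comb_T_inj]])
  also have "\<dots> = (\<Sum>c\<in>?P. \<Prod>i\<in>UNIV. ?f i (c i))"
  proof (rule sum.cong[OF refl])
    fix c :: "'n \<Rightarrow> int"
    have 1: "of_int b * B (comb T (\<lambda>i. of_int (c i))) (comb T (\<lambda>i. of_int (c i))) / of_int m
      = (\<Sum>i\<in>UNIV. of_int ((b * \<lfloor>tt i\<rfloor>) * c i ^ 2) / of_int m)"
      unfolding B_comb_comb_T sum_distrib_left sum_divide_distrib
      by (intro sum.cong) (simp_all add: tt power2_eq_square)
    have 2: "real_of_rat (of_int ((b * \<lfloor>tt i\<rfloor>) * c i ^ 2) / of_int m) = of_int ((b * \<lfloor>tt i\<rfloor>) * c i ^ 2) / of_int m" for i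
      by (simp only: of_rat_divide of_rat_of_int_eq)
    show "rexp (of_int b * B (comb T (\<lambda>i. of_int (c i))) (comb T (\<lambda>i. of_int (c i))) / of_int m) = (\<Prod>i\<in>UNIV. ?f i (c i))"
      unfolding 1 rexp_def of_rat_sum of_real_sum qexp_sum 2 ..
  qed
  also have "\<dots> = (\<Prod>i\<in>UNIV. \<Sum>x\<in>{0..<\<bar>m\<bar>}. ?f i x)"
    by (rule prod_sum_PiE[symmetric]) auto
  finally show ?thesis by (simp only: gauss_sum_def)
qed

text \<open>Fixed once for the lattice, so that Poisson summation and its reversal in
  \<open>coset_theta_transform\<close> carry the same constant.\<close>

definition poisson_const :: complex where
  "poisson_const = (SOME C. C \<noteq> 0 \<and> (\<forall>z h. Im z > 0 \<longrightarrow> (\<Sum>\<^sub>\<infinity>x\<in>LL. gexp z (B (x + h) (x + h))) =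
      C * inv_sqrt_uhp z ^ CARD('n) * (\<Sum>\<^sub>\<infinity>y\<in>dual_lattice. rexp (B y h) * gexp (- 1 / z) (B y y / 4))))"

lemma poisson_const:
  shows "poisson_const \<noteq> 0"
    and "Im z > 0 \<Longrightarrow> (\<Sum>\<^sub>\<infinity>x\<in>LL. gexp z (B (x + h) (x + h))) =
      poisson_const * inv_sqrt_uhp z ^ CARD('n) * (\<Sum>\<^sub>\<infinity>y\<in>dual_lattice. rexp (B y h) * gexp (- 1 / z) (B y y / 4))"
proof -
  have "poisson_const \<noteq> 0 \<and> (\<forall>z h. Im z > 0 \<longrightarrow> (\<Sum>\<^sub>\<infinity>x\<in>LL. gexp z (B (x + h) (x + h))) =
      poisson_const * inv_sqrt_uhp z ^ CARD('n) * (\<Sum>\<^sub>\<infinity>y\<in>dual_lattice. rexp (B y h) * gexp (- 1 / z) (B y y / 4)))"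
    unfolding poisson_const_def by (rule someI_ex) (rule poisson_lattice, blast)
  thus "poisson_const \<noteq> 0"
    and "Im z > 0 \<Longrightarrow> (\<Sum>\<^sub>\<infinity>x\<in>LL. gexp z (B (x + h) (x + h))) =
      poisson_const * inv_sqrt_uhp z ^ CARD('n) * (\<Sum>\<^sub>\<infinity>y\<in>dual_lattice. rexp (B y h) * gexp (- 1 / z) (B y y / 4))"
    by blast+
qed

definition coset_theta :: "int \<Rightarrow> 'v \<Rightarrow> complex \<Rightarrow> complex" where
  "coset_theta a \<mu> z = (\<Sum>\<^sub>\<infinity>x\<in>LL. gexp z (B (smul (of_int a) x + \<mu>) (smul (of_int a) x + \<mu>)))"

lemma coset_theta_weight:
  assumes "a \<noteq> 0"
  shows "B (smul (of_int a) x + \<mu>) (smul (of_int a) x + \<mu>) = of_int (a ^ 2) * B (x + smul (1 / of_int a) \<mu>) (x + smul (1 / of_int a) \<mu>)"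
  using assms by (simp add: B_bilinear B_sym[of \<mu> x] field_simps power2_eq_square)

lemma coset_theta_summable:
  assumes "a \<noteq> 0" "y > 0"
  shows "(\<lambda>x. exp (- 2 * pi * y * of_rat (B (smul (of_int a) x + \<mu>) (smul (of_int a) x + \<mu>)))) summable_on LL"
proof -
  have "y * of_int (a ^ 2) > 0" using assms by simp
  from gauss_weight_summable[OF this, of LL "smul (1 / of_int a) \<mu>"]
  show ?thesis using LL_subset_dual dual_subset_diag
    by (simp add: coset_theta_weight[OF assms(1)] of_rat_mult of_rat_power mult_ac)
qed

lemma poisson_coset:
  assumes a: "a \<noteq> 0" and z: "Im z > 0"
  shows "coset_theta a \<mu> z = poisson_const * inv_sqrt_uhp (of_int (a ^ 2) * z) ^ CARD('n) *
    (\<Sum>\<^sub>\<infinity>y\<in>dual_lattice. rexp (B y \<mu> / of_int a) * gexp (- 1 / z) (B y y / (4 * of_int (a ^ 2))))"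
proof -
  have z': "Im (of_int (a ^ 2) * z) > 0" using z a by (simp add: zero_less_mult_iff)
  have "gexp (- 1 / (of_int (a ^ 2) * z)) (q / 4) = gexp (- 1 / z) (q / (4 * of_int (a ^ 2)))" for q
    using a by (simp add: gexp_def of_rat_divide of_rat_mult of_rat_power mult_ac)
  thus ?thesis
    unfolding coset_theta_def coset_theta_weight[OF a] gexp_of_int_mult
    using poisson_const(2)[OF z', of "smul (1 / of_int a) \<mu>"] by (simp add: B_smul_right)
qed

text \<open>The shift by b/m multiplies the term at m x + r by a phase that depends only on r, and
  Poisson summation applies to each class with modulus a m. The formula serves both the
  transformation law and the bound at the cusps.\<close>

lemma coset_theta_shifted:
  assumes a: "a \<noteq> 0" and m: "m \<noteq> 0" and \<mu>: "\<mu> \<in> LL" and z: "Im z > 0"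
  shows "coset_theta a \<mu> (of_real (of_rat (of_int b / of_int m)) + z) =
    poisson_const * inv_sqrt_uhp (of_int ((a * m) ^ 2) * z) ^ CARD('n) *
    (\<Sum>\<^sub>\<infinity>y\<in>dual_lattice. (\<Sum>r\<in>box e m. rexp (of_int b * B (smul (of_int a) r + \<mu>) (smul (of_int a) r + \<mu>) / of_int m
       + B y (smul (of_int a) r + \<mu>) / of_int (a * m))) * gexp (- 1 / z) (B y y / (4 * of_int ((a * m) ^ 2))))"
proof -
  interpret S: subgroup_pair LL "scaled m LL" by (rule scaled_pair)
  define w where "w = of_real (of_rat (of_int b / of_int m)) + z"
  define q where "q = (\<lambda>x. B (smul (of_int a) x + \<mu>) (smul (of_int a) x + \<mu>))"
  have w: "Im w > 0" using z by (simp add: w_def)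
  have zi: "Im (- 1 / z) > 0" using uhp_minus_inverse[OF z] .
  have am: "a * m \<noteq> 0" using a m by simp
  have R: "transversal LL (scaled m LL) (box e m)" by (rule transversal_box[OF _ m]) (erule e_inj)
  have finR: "finite (box e m)" using R by (simp add: transversal_def)
  have bij: "bij_betw (smul (of_int m)) LL (scaled m LL)"
    unfolding bij_betw_def scaled_def using m by (auto simp: inj_on_def)
  have "(\<lambda>x. gexp w (q x)) summable_on LL"
    by (rule abs_summable_summable) (use coset_theta_summable[OF a w, of \<mu>] in \<open>simp add: norm_gexp q_def\<close>)
  hence "coset_theta a \<mu> w = (\<Sum>r\<in>box e m. \<Sum>\<^sub>\<infinity>x\<in>scaled m LL. gexp w (q (x + r)))"
    using S.infsum_transversal[OF R, of "\<lambda>x. gexp w (q x)"] unfolding coset_theta_def q_def by blast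
  also have "\<dots> = (\<Sum>r\<in>box e m. \<Sum>\<^sub>\<infinity>x\<in>LL. gexp w (q (smul (of_int m) x + r)))"
    by (intro sum.cong refl infsum_reindex_bij_betw[OF bij, symmetric])
  also have "\<dots> = (\<Sum>r\<in>box e m. rexp (of_int b * q r / of_int m) * coset_theta (a * m) (smul (of_int a) r + \<mu>) z)"
  proof (rule sum.cong[OF refl])
    fix r assume "r \<in> box e m"
    hence r: "r \<in> LL" using R by (auto simp: transversal_def)
    let ?g = "smul (of_int a) r + \<mu>"
    have g: "?g \<in> LL" using r \<mu> by (intro lattice_of_add lattice_of_smul)
    have "gexp w (q (smul (of_int m) x + r)) = rexp (of_int b * q r / of_int m) * gexp z (B (smul (of_int (a * m)) x + ?g) (smul (of_int (a * m)) x + ?g))"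
      if x: "x \<in> LL" for x
    proof -
      have e: "smul (of_int a) (smul (of_int m) x + r) + \<mu> = smul (of_int (a * m)) x + ?g"
        by (simp add: scale_right_distrib add.assoc)
      have "of_int b / of_int m * q (smul (of_int m) x + r) = of_int b * q r / of_int m + of_int b * (2 * of_int a * B x ?g + of_int (a * (a * m)) * B x x)"
        unfolding q_def e using m by (simp add: B_add B_add_right B_smul B_smul_right B_sym[of \<mu> x] B_sym[of r x] field_simps)
      moreover have "of_int b * (2 * of_int a * B x ?g + of_int (a * (a * m)) * B x x) \<in> \<int>"
        using integral[OF x g] integral[OF x x] by (intro Ints_mult Ints_add) auto
      ultimately have "rexp (of_int b / of_int m * q (smul (of_int m) x + r)) = rexp (of_int b * q r / of_int m)"
        by (simp only: rexp_add_Ints)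
      thus ?thesis unfolding w_def gexp_add_left gexp_of_rat by (simp only: q_def e)
    qed
    hence "(\<Sum>\<^sub>\<infinity>x\<in>LL. gexp w (q (smul (of_int m) x + r))) =
      (\<Sum>\<^sub>\<infinity>x\<in>LL. rexp (of_int b * q r / of_int m) * gexp z (B (smul (of_int (a * m)) x + ?g) (smul (of_int (a * m)) x + ?g)))"
      by (rule infsum_cong)
    also have "\<dots> = rexp (of_int b * q r / of_int m) * coset_theta (a * m) ?g z"
      unfolding coset_theta_def
      by (rule infsum_cmult_right, rule abs_summable_summable)
         (use coset_theta_summable[OF am z, of ?g] in \<open>simp add: norm_gexp\<close>)
    finally show "(\<Sum>\<^sub>\<infinity>x\<in>LL. gexp w (q (smul (of_int m) x + r))) = rexp (of_int b * q r / of_int m) * coset_theta (a * m) ?g z" .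
  qed
  also have "\<dots> = (\<Sum>r\<in>box e m. poisson_const * inv_sqrt_uhp (of_int ((a * m) ^ 2) * z) ^ CARD('n) *
      (\<Sum>\<^sub>\<infinity>y\<in>dual_lattice. rexp (of_int b * q r / of_int m + B y (smul (of_int a) r + \<mu>) / of_int (a * m)) * gexp (- 1 / z) (B y y / (4 * of_int ((a * m) ^ 2)))))"
  proof (rule sum.cong[OF refl])
    fix r
    let ?g = "smul (of_int a) r + \<mu>" and ?K = "poisson_const * inv_sqrt_uhp (of_int ((a * m) ^ 2) * z) ^ CARD('n)"
    let ?t = "\<lambda>y. gexp (- 1 / z) (B y y / (4 * of_int ((a * m) ^ 2)))"
    have "rexp (of_int b * q r / of_int m) * coset_theta (a * m) ?g z = ?K * (rexp (of_int b * q r / of_int m) * (\<Sum>\<^sub>\<infinity>y\<in>dual_lattice. rexp (B y ?g / of_int (a * m)) * ?t y))"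
      unfolding poisson_coset[OF am z] by (simp only: mult_ac)
    also have "rexp (of_int b * q r / of_int m) * (\<Sum>\<^sub>\<infinity>y\<in>dual_lattice. rexp (B y ?g / of_int (a * m)) * ?t y)
      = (\<Sum>\<^sub>\<infinity>y\<in>dual_lattice. rexp (of_int b * q r / of_int m) * (rexp (B y ?g / of_int (a * m)) * ?t y))"
    proof (rule infsum_cmult_right[symmetric], rule abs_summable_summable)
      have "1 / (4 * of_int ((a * m) ^ 2)) > (0 :: rat)" using am by simp
      from rexp_gexp_summable[OF zi dual_subset_diag this, of "\<lambda>y. B y ?g / of_int (a * m)"]
      show "(\<lambda>y. norm (rexp (B y ?g / of_int (a * m)) * ?t y)) summable_on dual_lattice" by simp
    qed
    finally show "rexp (of_int b * q r / of_int m) * coset_theta (a * m) ?g z = ?K *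
      (\<Sum>\<^sub>\<infinity>y\<in>dual_lattice. rexp (of_int b * q r / of_int m + B y ?g / of_int (a * m)) * ?t y)"
      by (simp only: rexp_add mult.assoc)
  qed
  also have "\<dots> = poisson_const * inv_sqrt_uhp (of_int ((a * m) ^ 2) * z) ^ CARD('n) *
      (\<Sum>r\<in>box e m. \<Sum>\<^sub>\<infinity>y\<in>dual_lattice. rexp (of_int b * q r / of_int m + B y (smul (of_int a) r + \<mu>) / of_int (a * m)) * gexp (- 1 / z) (B y y / (4 * of_int ((a * m) ^ 2))))"
    by (simp only: sum_distrib_left)
  also have "(\<Sum>r\<in>box e m. \<Sum>\<^sub>\<infinity>y\<in>dual_lattice. rexp (of_int b * q r / of_int m + B y (smul (of_int a) r + \<mu>) / of_int (a * m)) * gexp (- 1 / z) (B y y / (4 * of_int ((a * m) ^ 2))))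
    = (\<Sum>\<^sub>\<infinity>y\<in>dual_lattice. \<Sum>r\<in>box e m. rexp (of_int b * q r / of_int m + B y (smul (of_int a) r + \<mu>) / of_int (a * m)) * gexp (- 1 / z) (B y y / (4 * of_int ((a * m) ^ 2))))"
  proof (rule infsum_of_finite_sum[OF finR, symmetric], rule abs_summable_summable)
    fix r
    have "1 / (4 * of_int ((a * m) ^ 2)) > (0 :: rat)" using am by simp
    from rexp_gexp_summable[OF zi dual_subset_diag this, of "\<lambda>y. of_int b * q r / of_int m + B y (smul (of_int a) r + \<mu>) / of_int (a * m)"]
    show "(\<lambda>y. norm (rexp (of_int b * q r / of_int m + B y (smul (of_int a) r + \<mu>) / of_int (a * m)) * gexp (- 1 / z) (B y y / (4 * of_int ((a * m) ^ 2))))) summable_on dual_lattice" by simp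
  qed
  finally show ?thesis by (simp only: w_def q_def sum_distrib_right)
qed

end

text \<open>The quotient of the square root factors of the two Poisson summations. It involves
  neither the lattice nor \<open>a\<close>, so it is the same for the Jacobi theta function and
  cancels in the comparison.\<close>

definition inversion_factor :: "int \<Rightarrow> int \<Rightarrow> complex \<Rightarrow> complex" where
  "inversion_factor c \<delta> z =
     inv_sqrt_uhp (of_int (\<delta> ^ 2) * (z / (of_int \<delta> * (of_int c * z + of_int \<delta>)))) / inv_sqrt_uhp z"

lemma inv_sqrt_uhp_scale_square:
  assumes "a > (0 :: int)"
  shows "inv_sqrt_uhp (of_int (a ^ 2) * z) = inv_sqrt_uhp z / of_int a"
proof -
  have "inv_sqrt_uhp (of_real (of_int (a ^ 2)) * z) = inv_sqrt_uhp z / of_real (sqrt (of_int (a ^ 2)))"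
    by (rule inv_sqrt_uhp_scale) (use assms in simp)
  thus ?thesis using assms by simp
qed

context lattice_space
begin

text \<open>The shift \<open>s\<close> is chosen so that g = \<alpha> \<delta> \<mu> + a l + 2 a c'
  N y. All terms mixing \<open>l\<close> with \<mu> or \<open>y\<close> then become divisible by
  \<delta>; there remain the Gauss sum term in \<open>l\<close> and a phase in which \<mu> is
  multiplied by \<alpha>.\<close>

lemma completed_square:
  fixes a N c' \<alpha> \<beta> \<delta> :: int
  assumes rel: "4 * N * a ^ 2 * c' * \<beta> = \<alpha> * \<delta> - 1" and a: "a \<noteq> 0" and \<delta>: "\<delta> \<noteq> 0"
    and \<mu>: "\<mu> \<in> LL" and l: "l \<in> LL" and y: "y \<in> dual_lattice" and Y: "smul (of_int N) y \<in> LL"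
  defines "s \<equiv> smul (of_int (4 * N * a * c' * \<beta>)) \<mu> + smul (of_int (2 * c')) (smul (of_int N) y)"
  defines "g \<equiv> smul (of_int a) (l + s) + \<mu>"
  shows "rexp ((of_int \<beta> * B g g + B y g / of_int a - of_int (c' * N) * B y y) / of_int \<delta>)
    = rexp (of_int (\<beta> * a ^ 2) * B l l / of_int \<delta>) * rexp (of_int \<alpha> * B y \<mu> / of_int a)"
proof -
  define q1 q2 b1 b2 b3 b4 b5 where "q1 = B \<mu> \<mu>" and "q2 = B l l" and "b1 = B \<mu> l"
    and "b2 = B \<mu> (smul (of_int N) y)" and "b3 = B y l" and "b4 = B y (smul (of_int N) y)" and "b5 = B y \<mu>"
  define A N' C \<alpha>' \<beta>' \<delta>' :: rat where "A = of_int a" and "N' = of_int N" and "C = of_int c'"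
    and "\<alpha>' = of_int \<alpha>" and "\<beta>' = of_int \<beta>" and "\<delta>' = of_int \<delta>"
  have ints: "q1 \<in> \<int>" "b1 \<in> \<int>" "b2 \<in> \<int>" "b3 \<in> \<int>" "b4 \<in> \<int>"
    using integral \<mu> l y Y by (auto simp: q1_def b1_def b2_def b3_def b4_def dual_lattice_def)
  have A0: "A \<noteq> 0" "\<delta>' \<noteq> 0" using a \<delta> by (auto simp: A_def \<delta>'_def)
  have "(of_int (4 * N * a ^ 2 * c' * \<beta>) :: rat) = of_int (\<alpha> * \<delta> - 1)" by (simp only: rel)
  hence rel': "4 * N' * A ^ 2 * C * \<beta>' = \<alpha>' * \<delta>' - 1"
    by (simp add: A_def N'_def C_def \<alpha>'_def \<beta>'_def \<delta>'_def)
  have b2': "b2 = N' * b5" by (simp add: b2_def b5_def N'_def B_smul_right B_sym)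
  have b4': "b4 = N' * B y y" by (simp add: b4_def N'_def B_smul_right)
  have geq: "g = smul (\<alpha>' * \<delta>') \<mu> + smul A l + smul (2 * A * C) (smul N' y)"
  proof -
    have "g = smul (4 * N' * A ^ 2 * C * \<beta>' + 1) \<mu> + smul A l + smul (2 * A * C) (smul N' y)"
      unfolding g_def s_def
      by (simp add: scale_right_distrib scale_left_distrib A_def N'_def C_def \<beta>'_def power2_eq_square mult_ac add_ac)
    thus ?thesis unfolding rel' by simp
  qed
  have Bgg: "B g g = (\<alpha>' * \<delta>') ^ 2 * q1 + A ^ 2 * q2 + 4 * A ^ 2 * C ^ 2 * N' * b4 + 2 * \<alpha>' * \<delta>' * A * b1
      + 4 * \<alpha>' * \<delta>' * A * C * b2 + 4 * A ^ 2 * C * N' * b3"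
    unfolding geq q1_def q2_def b1_def b2_def b3_def b4_def
    by (simp add: B_bilinear B_sym[of l \<mu>] B_sym[of l y] B_sym[of y \<mu>] N'_def power2_eq_square algebra_simps)
  have Byg: "B y g / A = \<alpha>' * \<delta>' * b5 / A + b3 + 2 * C * b4"
    unfolding geq b5_def b3_def b4_def using A0
    by (simp add: B_bilinear N'_def field_simps)
  \<comment> \<open>The product 4 N a^2 c' \<beta> is kept together so that \<open>rel'\<close> can
    replace it by \<alpha> \<delta> - 1.\<close>
  have "\<beta>' * B g g + B y g / A - C * b4 = \<beta>' * (\<alpha>' * \<delta>') ^ 2 * q1 + \<beta>' * A ^ 2 * q2
      + (4 * N' * A ^ 2 * C * \<beta>') * (C * b4) + 2 * \<alpha>' * \<delta>' * A * \<beta>' * b1 + 4 * \<alpha>' * \<delta>' * A * C * \<beta>' * b2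
      + (4 * N' * A ^ 2 * C * \<beta>') * b3 + \<alpha>' * \<delta>' * b5 / A + b3 + 2 * C * b4 - C * b4"
    unfolding Bgg Byg by (simp add: algebra_simps power2_eq_square)
  also have "\<dots> = \<beta>' * A ^ 2 * q2 + \<delta>' * (\<alpha>' * b5 / A)
      + \<delta>' * (\<beta>' * \<alpha>' ^ 2 * \<delta>' * q1 + C * \<alpha>' * b4 + 2 * \<alpha>' * A * \<beta>' * b1 + 4 * \<alpha>' * A * C * \<beta>' * b2 + \<alpha>' * b3)"
    unfolding rel' by (simp add: algebra_simps power2_eq_square)
  finally have "(\<beta>' * B g g + B y g / A - C * b4) / \<delta>' = (\<beta>' * A ^ 2 * q2 / \<delta>' + \<alpha>' * b5 / A)
      + (\<beta>' * \<alpha>' ^ 2 * \<delta>' * q1 + C * \<alpha>' * b4 + 2 * \<alpha>' * A * \<beta>' * b1 + 4 * \<alpha>' * A * C * \<beta>' * b2 + \<alpha>' * b3)"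
    by (simp only: add_divide_distrib nonzero_mult_div_cancel_left[OF A0(2)])
  moreover have "\<beta>' * \<alpha>' ^ 2 * \<delta>' * q1 + C * \<alpha>' * b4 + 2 * \<alpha>' * A * \<beta>' * b1 + 4 * \<alpha>' * A * C * \<beta>' * b2 + \<alpha>' * b3 \<in> \<int>"
    using ints unfolding A_def C_def \<alpha>'_def \<beta>'_def \<delta>'_def by (intro Ints_add Ints_mult Ints_power) auto
  ultimately have "rexp ((\<beta>' * B g g + B y g / A - C * b4) / \<delta>') = rexp (\<beta>' * A ^ 2 * q2 / \<delta>' + \<alpha>' * b5 / A)"
    by (simp only: rexp_add_Ints)
  moreover have "C * b4 = of_int (c' * N) * B y y" unfolding b4' by (simp add: C_def N'_def)
  ultimately show ?thesis
    by (simp add: rexp_add A_def \<alpha>'_def \<beta>'_def \<delta>'_def q2_def b5_def)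
qed

text \<open>The summand is periodic modulo \<delta>, so translating all representatives by
  \<open>s\<close> leaves the sum unchanged; this is what permits completing the square.\<close>

lemma inner_gauss_sum:
  fixes a N c' \<alpha> \<beta> \<delta> :: int
  assumes rel: "4 * N * a ^ 2 * c' * \<beta> = \<alpha> * \<delta> - 1" and a: "a \<noteq> 0" and \<delta>: "\<delta> \<noteq> 0"
    and \<mu>: "\<mu> \<in> LL" and y: "y \<in> dual_lattice" and Y: "smul (of_int N) y \<in> LL"
  shows "(\<Sum>r\<in>box e \<delta>. rexp (of_int \<beta> * B (smul (of_int a) r + \<mu>) (smul (of_int a) r + \<mu>) / of_int \<delta>
       + B y (smul (of_int a) r + \<mu>) / of_int (a * \<delta>))) * rexp (- (of_int (c' * N) * B y y / of_int \<delta>))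
     = lattice_gauss_sum (\<beta> * a ^ 2) \<delta> * rexp (of_int \<alpha> * B y \<mu> / of_int a)"
proof -
  interpret S: subgroup_pair LL "scaled \<delta> LL" by (rule scaled_pair)
  have R: "transversal LL (scaled \<delta> LL) (box e \<delta>)" by (rule transversal_box[OF _ \<delta>]) (erule e_inj)
  define G where "G = (\<lambda>r. smul (of_int a) r + \<mu>)"
  define f where "f = (\<lambda>r. rexp ((of_int \<beta> * B (G r) (G r) + B y (G r) / of_int a - of_int (c' * N) * B y y) / of_int \<delta>))"
  define s where "s = smul (of_int (4 * N * a * c' * \<beta>)) \<mu> + smul (of_int (2 * c')) (smul (of_int N) y)"
  have s: "s \<in> LL" unfolding s_def by (intro lattice_of_add lattice_of_smul \<mu> Y)
  have per: "f (x + v) = f x" if x: "x \<in> LL" and v: "v \<in> scaled \<delta> LL" for x v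
  proof -
    obtain w where w: "w \<in> LL" "v = smul (of_int \<delta>) w" using v by (auto simp: scaled_def)
    have Gx: "G x \<in> LL" unfolding G_def by (intro lattice_of_add lattice_of_smul \<mu> x)
    have "G (x + v) = G x + smul (of_int (a * \<delta>)) w"
      unfolding G_def w(2) by (simp add: scale_right_distrib add_ac)
    hence "(of_int \<beta> * B (G (x + v)) (G (x + v)) + B y (G (x + v)) / of_int a - of_int (c' * N) * B y y) / of_int \<delta>
      = (of_int \<beta> * B (G x) (G x) + B y (G x) / of_int a - of_int (c' * N) * B y y) / of_int \<delta>
      + (of_int \<beta> * (2 * of_int a * B (G x) w + of_int (a * (a * \<delta>)) * B w w) + B y w)"
      using a \<delta> by (simp add: B_bilinear B_sym[of w "G x"] field_simps)
    moreover have "of_int \<beta> * (2 * of_int a * B (G x) w + of_int (a * (a * \<delta>)) * B w w) + B y w \<in> \<int>"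
      using integral[OF Gx w(1)] integral[OF w(1) w(1)] y w(1)
      by (intro Ints_add Ints_mult) (auto simp: dual_lattice_def)
    ultimately show ?thesis unfolding f_def by (simp only: rexp_add_Ints)
  qed
  have "(\<Sum>r\<in>box e \<delta>. rexp (of_int \<beta> * B (G r) (G r) / of_int \<delta> + B y (G r) / of_int (a * \<delta>))) * rexp (- (of_int (c' * N) * B y y / of_int \<delta>))
     = (\<Sum>r\<in>box e \<delta>. f r)"
    unfolding sum_distrib_right f_def rexp_add[symmetric]
    by (intro sum.cong refl arg_cong[of _ _ rexp]) (simp add: add_divide_distrib diff_divide_distrib)
  also have "\<dots> = (\<Sum>r\<in>box e \<delta>. f (r + s))"
    using per by (intro S.sum_transversal_translate[OF R s, symmetric])
  also have "\<dots> = (\<Sum>r\<in>box e \<delta>. rexp (of_int (\<beta> * a ^ 2) * B r r / of_int \<delta>) * rexp (of_int \<alpha> * B y \<mu> / of_int a))"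
  proof (rule sum.cong[OF refl])
    fix r assume "r \<in> box e \<delta>"
    hence r: "r \<in> LL" using R by (auto simp: transversal_def)
    show "f (r + s) = rexp (of_int (\<beta> * a ^ 2) * B r r / of_int \<delta>) * rexp (of_int \<alpha> * B y \<mu> / of_int a)"
      unfolding f_def G_def s_def by (rule completed_square[OF rel a \<delta> \<mu> r y Y])
  qed
  also have "\<dots> = lattice_gauss_sum (\<beta> * a ^ 2) \<delta> * rexp (of_int \<alpha> * B y \<mu> / of_int a)"
    by (simp only: lattice_gauss_sum_def sum_distrib_right)
  finally show ?thesis by (simp only: G_def)
qed

theorem coset_theta_transform:
  fixes a N \<alpha> \<beta> \<delta> c :: int
  assumes det: "\<alpha> * \<delta> - \<beta> * c = 1" and c: "4 * N * a ^ 2 dvd c" and a: "a > 0" and \<mu>: "\<mu> \<in> LL"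
    and N: "\<And>y. y \<in> dual_lattice \<Longrightarrow> smul (of_int N) y \<in> LL" and z: "Im z > 0"
  shows "coset_theta a \<mu> (mobius \<alpha> \<beta> c \<delta> z) =
    lattice_gauss_sum (\<beta> * a ^ 2) \<delta> * inversion_factor c \<delta> z ^ CARD('n) * coset_theta a (smul (of_int \<alpha>) \<mu>) z"
proof -
  obtain c' where c': "c = 4 * N * a ^ 2 * c'" using c by auto
  \<comment> \<open>Otherwise 4 would divide the determinant 1.\<close>
  have \<delta>: "\<delta> \<noteq> 0"
  proof
    assume "\<delta> = 0"
    hence "4 * (- \<beta> * N * a ^ 2 * c') = 1" using det by (simp add: c' mult_ac)
    thus False by presburger
  qed
  have a0: "a \<noteq> 0" using a by simp
  have rel: "4 * N * a ^ 2 * c' * \<beta> = \<alpha> * \<delta> - 1" using det by (simp add: c' mult_ac)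
  define z' where "z' = z / (of_int \<delta> * (of_int c * z + of_int \<delta>))"
  note z'_facts = mobius_eq_shifted_inversion[OF det \<delta> z, folded z'_def]
  have R: "inv_sqrt_uhp (of_int ((a * \<delta>) ^ 2) * z') = inversion_factor c \<delta> z * inv_sqrt_uhp (of_int (a ^ 2) * z)"
    using inv_sqrt_uhp_nonzero[OF z] inv_sqrt_uhp_scale_square[OF a, of z] inv_sqrt_uhp_scale_square[OF a, of "of_int (\<delta> ^ 2) * z'"]
    by (simp add: inversion_factor_def z'_def power_mult_distrib mult_ac)
  \<comment> \<open>The integer translation in -1/z' contributes exactly the phase with c' N B(y,y)
    / \<delta> that the completed square requires.\<close>
  have main: "(\<Sum>r\<in>box e \<delta>. rexp (of_int \<beta> * B (smul (of_int a) r + \<mu>) (smul (of_int a) r + \<mu>) / of_int \<delta>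
       + B y (smul (of_int a) r + \<mu>) / of_int (a * \<delta>))) * gexp (- 1 / z') (B y y / (4 * of_int ((a * \<delta>) ^ 2)))
     = lattice_gauss_sum (\<beta> * a ^ 2) \<delta> * (rexp (B y (smul (of_int \<alpha>) \<mu>) / of_int a) * gexp (- 1 / z) (B y y / (4 * of_int (a ^ 2))))"
    (is "?S * _ = _") if y: "y \<in> dual_lattice" for y
  proof -
    have "gexp (- 1 / z') (B y y / (4 * of_int ((a * \<delta>) ^ 2))) =
      gexp (of_int (\<delta> ^ 2) * (- 1 / z)) (B y y / (4 * of_int ((a * \<delta>) ^ 2))) * gexp (of_real (of_rat (- of_int (\<delta> * c)))) (B y y / (4 * of_int ((a * \<delta>) ^ 2)))"
      unfolding z'_facts(2) gexp_add_left[symmetric] by (simp add: of_rat_minus of_rat_mult)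
    also have "gexp (of_int (\<delta> ^ 2) * (- 1 / z)) (B y y / (4 * of_int ((a * \<delta>) ^ 2))) = gexp (- 1 / z) (B y y / (4 * of_int (a ^ 2)))"
      unfolding gexp_of_int_mult[symmetric] using a0 \<delta>
      by (intro arg_cong[of _ _ "gexp (- 1 / z)"]) (simp add: power_mult_distrib)
    also have "gexp (of_real (of_rat (- of_int (\<delta> * c)))) (B y y / (4 * of_int ((a * \<delta>) ^ 2))) = rexp (- (of_int (c' * N) * B y y / of_int \<delta>))"
      unfolding gexp_of_rat c' using a0 \<delta>
      by (intro arg_cong[of _ _ rexp]) (simp add: field_simps power2_eq_square)
    finally have "?S * gexp (- 1 / z') (B y y / (4 * of_int ((a * \<delta>) ^ 2))) =
      (?S * rexp (- (of_int (c' * N) * B y y / of_int \<delta>))) * gexp (- 1 / z) (B y y / (4 * of_int (a ^ 2)))"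
      by (simp only: mult_ac)
    also have "?S * rexp (- (of_int (c' * N) * B y y / of_int \<delta>)) = lattice_gauss_sum (\<beta> * a ^ 2) \<delta> * rexp (of_int \<alpha> * B y \<mu> / of_int a)"
      by (rule inner_gauss_sum[OF rel a0 \<delta> \<mu> y N[OF y]])
    finally show ?thesis by (simp only: B_smul_right mult.assoc)
  qed
  have "coset_theta a \<mu> (mobius \<alpha> \<beta> c \<delta> z) = poisson_const * inv_sqrt_uhp (of_int ((a * \<delta>) ^ 2) * z') ^ CARD('n) *
    (\<Sum>\<^sub>\<infinity>y\<in>dual_lattice. lattice_gauss_sum (\<beta> * a ^ 2) \<delta> * (rexp (B y (smul (of_int \<alpha>) \<mu>) / of_int a) * gexp (- 1 / z) (B y y / (4 * of_int (a ^ 2)))))"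
    unfolding z'_facts(1) coset_theta_shifted[OF a0 \<delta> \<mu> z'_facts(3)]
    by (intro arg_cong2[of _ _ _ _ "(*)"] refl infsum_cong main)
  also have "(\<Sum>\<^sub>\<infinity>y\<in>dual_lattice. lattice_gauss_sum (\<beta> * a ^ 2) \<delta> * (rexp (B y (smul (of_int \<alpha>) \<mu>) / of_int a) * gexp (- 1 / z) (B y y / (4 * of_int (a ^ 2)))))
    = lattice_gauss_sum (\<beta> * a ^ 2) \<delta> * (\<Sum>\<^sub>\<infinity>y\<in>dual_lattice. rexp (B y (smul (of_int \<alpha>) \<mu>) / of_int a) * gexp (- 1 / z) (B y y / (4 * of_int (a ^ 2))))"
  proof (rule infsum_cmult_right, rule abs_summable_summable)
    have "1 / (4 * of_int (a ^ 2)) > (0 :: rat)" using a by simp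
    from rexp_gexp_summable[OF uhp_minus_inverse[OF z] dual_subset_diag this, of "\<lambda>y. B y (smul (of_int \<alpha>) \<mu>) / of_int a"]
    show "(\<lambda>y. norm (rexp (B y (smul (of_int \<alpha>) \<mu>) / of_int a) * gexp (- 1 / z) (B y y / (4 * of_int (a ^ 2))))) summable_on dual_lattice" by simp
  qed
  \<comment> \<open>What is left is Poisson's formula for the coset of \<alpha> \<mu>, read from
    right to left.\<close>
  finally show ?thesis
    unfolding poisson_coset[OF a0 z] R
      power_mult_distrib[of "inversion_factor c \<delta> z" "inv_sqrt_uhp (of_int (a ^ 2) * z)"]
    by (simp only: mult_ac)
qed

section \<open>Boundedness at the cusps\<close>

lemma coset_theta_norm_le:
  assumes a: "a \<noteq> 0" and z: "Im z \<ge> 1"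
  shows "norm (coset_theta a \<mu> z) \<le> (\<Sum>\<^sub>\<infinity>x\<in>LL. exp (- 2 * pi * 1 * of_rat (B (smul (of_int a) x + \<mu>) (smul (of_int a) x + \<mu>))))"
proof -
  define q where "q = (\<lambda>x. B (smul (of_int a) x + \<mu>) (smul (of_int a) x + \<mu>))"
  have q0: "real_of_rat (q x) \<ge> 0" for x unfolding q_def using B_nonneg by simp
  have s: "(\<lambda>x. norm (gexp z (q x))) summable_on LL"
    using coset_theta_summable[OF a, of "Im z" \<mu>] z by (simp add: norm_gexp q_def)
  have "norm (coset_theta a \<mu> z) \<le> (\<Sum>\<^sub>\<infinity>x\<in>LL. norm (gexp z (q x)))"
    using norm_infsum_bound[OF s] by (simp only: coset_theta_def q_def)
  also have "\<dots> \<le> (\<Sum>\<^sub>\<infinity>x\<in>LL. exp (- 2 * pi * 1 * of_rat (q x)))"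
  proof (rule infsum_mono[OF s])
    show "(\<lambda>x. exp (- 2 * pi * 1 * of_rat (q x))) summable_on LL"
      using coset_theta_summable[OF a, of 1 \<mu>] by (simp add: q_def)
    fix x
    have "1 * real_of_rat (q x) \<le> Im z * of_rat (q x)" by (rule mult_right_mono[OF z q0])
    thus "norm (gexp z (q x)) \<le> exp (- 2 * pi * 1 * of_rat (q x))" by (simp add: norm_gexp mult.assoc)
  qed
  finally show ?thesis by (simp only: q_def)
qed

text \<open>Here \<open>c\<close> is arbitrary and absolute values suffice. For c \<noteq> 0 the
  image of z is \<alpha>/c + z' with -1/z' = c (c z + \<delta>), whose imaginary part is c^2 Im z.
  After one Poisson summation the dual series is dominated by a fixed convergent series, and the
  growth sits in the square root factor.\<close>

theorem coset_theta_cusp_bound: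
  fixes a \<alpha> \<beta> \<delta> c :: int
  assumes det: "\<alpha> * \<delta> - \<beta> * c = 1" and a: "a > 0" and \<mu>: "\<mu> \<in> LL"
  shows "\<exists>K. \<forall>z. Im z \<ge> 1 \<longrightarrow>
    norm (coset_theta a \<mu> (mobius \<alpha> \<beta> c \<delta> z)) \<le> K * sqrt (norm (of_int c * z + of_int \<delta>)) ^ CARD('n)"
proof (cases "c = 0")
  case True
  hence \<alpha>\<delta>: "\<alpha> * \<delta> = 1" using det by simp
  \<comment> \<open>For c = 0 the matrix is, up to sign, a translation.\<close>
  hence d: "\<delta> = 1 \<and> \<alpha> = 1 \<or> \<delta> = -1 \<and> \<alpha> = -1" using zmult_eq_1_iff by metis
  let ?K = "\<Sum>\<^sub>\<infinity>x\<in>LL. exp (- 2 * pi * 1 * of_rat (B (smul (of_int a) x + \<mu>) (smul (of_int a) x + \<mu>)))"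
  show ?thesis
  proof (intro exI[of _ ?K] allI impI)
    fix z assume z: "Im z \<ge> 1"
    have "Im (mobius \<alpha> \<beta> c \<delta> z) = Im z" using d True by (auto simp: mobius_def)
    hence "norm (coset_theta a \<mu> (mobius \<alpha> \<beta> c \<delta> z)) \<le> ?K"
      using z a by (intro coset_theta_norm_le) auto
    moreover have "sqrt (norm (of_int c * z + of_int \<delta>)) ^ CARD('n) = 1" using d True by auto
    ultimately show "norm (coset_theta a \<mu> (mobius \<alpha> \<beta> c \<delta> z)) \<le> ?K * sqrt (norm (of_int c * z + of_int \<delta>)) ^ CARD('n)"
      by simp
  qed
next
  case c: False
  have a0: "a \<noteq> 0" using a by simp
  have ac: "a * c \<noteq> 0" using a c by simp
  let ?r = "1 / (4 * of_int (a ^ 2)) :: rat"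
  have r: "?r > 0" using a by simp
  let ?m = "real (card (box e c))"
  let ?W = "\<Sum>\<^sub>\<infinity>y\<in>dual_lattice. norm (rexp 0 * gexp \<i> (B y y * ?r))"
  have W: "(\<lambda>y. norm (rexp 0 * gexp \<i> (B y y * ?r))) summable_on dual_lattice"
    by (rule rexp_gexp_summable[OF _ dual_subset_diag r]) simp
  define K where "K = norm poisson_const * (sqrt (of_int \<bar>c\<bar>) / of_int \<bar>a * c\<bar>) ^ CARD('n) * (?m * ?W)"
  show ?thesis
  proof (intro exI[of _ K] allI impI)
    fix z assume z: "Im z \<ge> 1"
    define j where "j = of_int c * z + of_int \<delta>"
    have Imj: "Im j = of_int c * Im z" by (simp add: j_def)
    have j0: "j \<noteq> 0"
    proof
      assume "j = 0"
      hence "of_int c * Im z = 0" using Imj by simp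
      thus False using c z by simp
    qed
    define z' where "z' = - 1 / (of_int c * j)"
    have inv: "- 1 / z' = of_int c * j" using c j0 by (simp add: z'_def)
    have Im_inv: "Im (- 1 / z') = of_int (c ^ 2) * Im z" unfolding inv by (simp add: Imj power2_eq_square)
    have "Im (of_int c * j) > 0" using Im_inv z c unfolding inv by (simp add: zero_less_mult_iff)
    hence z'0: "Im z' > 0" unfolding z'_def by (rule uhp_minus_inverse)
    have "mobius \<alpha> \<beta> c \<delta> z = of_int \<alpha> / of_int c + z'"
    proof -
      have det': "(of_int \<alpha> :: complex) * of_int \<delta> = 1 + of_int \<beta> * of_int c"
        using det by (metis add.commute diff_eq_eq of_int_1 of_int_add of_int_mult)
      have "(of_int \<alpha> * z + of_int \<beta>) * of_int c = of_int \<alpha> * j - 1"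
        unfolding j_def ring_distribs det'[symmetric] using det' by (simp add: algebra_simps)
      hence "(of_int \<alpha> * z + of_int \<beta>) / j = (of_int \<alpha> * j - 1) / (of_int c * j)"
        using c j0 by (simp add: divide_simps)
      also have "\<dots> = of_int \<alpha> / of_int c + z'"
        using c j0 by (simp add: z'_def divide_simps)
      finally show ?thesis by (simp only: mobius_def j_def)
    qed
    hence mob: "mobius \<alpha> \<beta> c \<delta> z = of_real (of_rat (of_int \<alpha> / of_int c)) + z'"
      by (simp add: of_rat_divide)
    let ?S = "\<lambda>y. \<Sum>r\<in>box e c. rexp (of_int \<alpha> * B (smul (of_int a) r + \<mu>) (smul (of_int a) r + \<mu>) / of_int c
       + B y (smul (of_int a) r + \<mu>) / of_int (a * c))"
    let ?g = "\<lambda>y. gexp (- 1 / z') (B y y / (4 * of_int ((a * c) ^ 2)))"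
    have S: "norm (?S y) \<le> ?m" for y
      by (rule order_trans[OF norm_sum]) simp
    have g: "norm (?g y) \<le> norm (rexp 0 * gexp \<i> (B y y * ?r))" for y
    proof -
      have "1 * real_of_rat (B y y * ?r) \<le> Im z * of_rat (B y y * ?r)"
        using B_nonneg[of y] r by (intro mult_right_mono z) auto
      also have "\<dots> = Im (- 1 / z') * of_rat (B y y / (4 * of_int ((a * c) ^ 2)))"
        unfolding Im_inv using a c by (simp add: of_rat_divide of_rat_mult of_rat_power power_mult_distrib)
      finally have le: "1 * real_of_rat (B y y * ?r) \<le> Im (- 1 / z') * of_rat (B y y / (4 * of_int ((a * c) ^ 2)))" .
      have mono: "exp (- 2 * pi * W * Y) \<le> exp (- 2 * pi * 1 * X)" if "1 * X \<le> W * Y" for W X Y :: real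
        using that by (simp add: mult.assoc)
      show ?thesis
        unfolding norm_mult norm_gexp norm_rexp using mono[OF le] by (simp only: imaginary_unit.simps mult_1_left)
    qed
    have sm: "(\<lambda>y. norm (?S y * ?g y)) summable_on dual_lattice"
    proof (rule summable_on_comparison_test[OF summable_on_cmult_right[OF W, of ?m]])
      fix y
      show "norm (?S y * ?g y) \<le> ?m * norm (rexp 0 * gexp \<i> (B y y * ?r))"
        unfolding norm_mult[of "?S y"] by (intro mult_mono S g) auto
    qed auto
    have bound: "norm (\<Sum>\<^sub>\<infinity>y\<in>dual_lattice. ?S y * ?g y) \<le> ?m * ?W"
    proof -
      have "norm (\<Sum>\<^sub>\<infinity>y\<in>dual_lattice. ?S y * ?g y) \<le> (\<Sum>\<^sub>\<infinity>y\<in>dual_lattice. norm (?S y * ?g y))"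
        by (rule norm_infsum_bound[OF sm])
      also have "\<dots> \<le> (\<Sum>\<^sub>\<infinity>y\<in>dual_lattice. ?m * norm (rexp 0 * gexp \<i> (B y y * ?r)))"
      proof (rule infsum_mono[OF sm summable_on_cmult_right[OF W]])
        fix y
        show "norm (?S y * ?g y) \<le> ?m * norm (rexp 0 * gexp \<i> (B y y * ?r))"
          unfolding norm_mult[of "?S y"] by (intro mult_mono S g) auto
      qed
      also have "\<dots> = ?m * ?W" by (rule infsum_cmult_right[OF W])
      finally show ?thesis .
    qed
    have "norm (inv_sqrt_uhp (of_int ((a * c) ^ 2) * z')) = sqrt (of_int \<bar>c\<bar>) / of_int \<bar>a * c\<bar> * sqrt (norm j)"
    proof -
      have "norm (of_int ((a * c) ^ 2) * z') = of_int \<bar>a * c\<bar> ^ 2 / (of_int \<bar>c\<bar> * norm j)"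
      proof -
        have "norm (of_int ((a * c) ^ 2) :: complex) = of_int \<bar>a * c\<bar> ^ 2"
          by (simp only: norm_of_int) (simp add: power2_eq_square abs_mult)
        thus ?thesis unfolding norm_mult z'_def norm_divide by (simp add: norm_mult)
      qed
      thus ?thesis unfolding norm_inv_sqrt_uhp
        by (simp add: real_sqrt_divide real_sqrt_mult)
    qed
    hence "norm (coset_theta a \<mu> (mobius \<alpha> \<beta> c \<delta> z)) = norm poisson_const * (sqrt (of_int \<bar>c\<bar>) / of_int \<bar>a * c\<bar> * sqrt (norm j)) ^ CARD('n)
       * norm (\<Sum>\<^sub>\<infinity>y\<in>dual_lattice. ?S y * ?g y)"
      unfolding mob coset_theta_shifted[OF a0 c \<mu> z'0] by (simp only: norm_mult norm_power)
    also have "\<dots> \<le> norm poisson_const * (sqrt (of_int \<bar>c\<bar>) / of_int \<bar>a * c\<bar> * sqrt (norm j)) ^ CARD('n) * (?m * ?W)"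
      by (intro mult_left_mono bound) auto
    also have "\<dots> = K * sqrt (norm j) ^ CARD('n)"
      unfolding K_def power_mult_distrib by (simp only: mult_ac)
    finally show "norm (coset_theta a \<mu> (mobius \<alpha> \<beta> c \<delta> z)) \<le> K * sqrt (norm (of_int c * z + of_int \<delta>)) ^ CARD('n)"
      by (simp only: j_def)
  qed
qed

end

subsection \<open>The theta multiplier\<close>

text \<open>With \<open>j\<close> the product of the primes of \<open>W\<close> that do not divide
  \<delta>, every prime of \<open>W\<close> divides exactly one of \<delta> and j c.\<close>

lemma exists_coprime_translate:
  fixes \<delta> c W :: int
  assumes cop: "coprime \<delta> c" and W: "W \<noteq> 0"
  shows "\<exists>j. coprime (\<delta> + j * c) W"
proof -
  define S where "S = {p \<in> prime_factors W. \<not> p dvd \<delta>}"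
  have S: "finite S" unfolding S_def by simp
  define j where "j = \<Prod>S"
  have "coprime (\<delta> + j * c) W"
  proof (rule ccontr)
    assume "\<not> coprime (\<delta> + j * c) W"
    then obtain d where d: "d dvd \<delta> + j * c" "d dvd W" "\<not> is_unit d" by (auto simp: coprime_def)
    have "d \<noteq> 0" using d(2) W by auto
    then obtain p where p: "prime p" "p dvd d" using d(3) prime_divisor_exists by blast
    have pd: "p dvd \<delta> + j * c" "p dvd W" using p d dvd_trans by blast+
    hence pW: "p \<in> prime_factors W" using p W by (simp add: in_prime_factors_iff)
    show False
    proof (cases "p dvd \<delta>")
      case True
      hence "p dvd j * c" using pd(1) by (simp add: dvd_add_right_iff)
      moreover have "\<not> p dvd c" using True cop p(1) coprime_common_divisor not_prime_unit by blast
      ultimately have "p dvd j" using p(1) prime_dvd_mult_iff by blast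
      then obtain r where r: "r \<in> S" "p dvd r" using p(1) S unfolding j_def by (auto simp: prime_dvd_prod_iff)
      have "prime r" using r(1) by (auto simp: S_def)
      hence "p = r" using p(1) r(2) primes_dvd_imp_eq by blast
      thus False using r(1) True by (simp add: S_def)
    next
      case False
      hence "p \<in> S" using pW by (simp add: S_def)
      hence "p dvd j" unfolding j_def using S by (intro dvd_prodI)
      hence "p dvd \<delta>" using pd(1) by (simp add: dvd_add_left_iff)
      thus False using False by contradiction
    qed
  qed
  thus ?thesis by blast
qed

text \<open>The form s x^2 on the integers, through which the general law reaches the Jacobi theta
  function at s z.\<close>

lemma rank_one_lattice_space:
  assumes s: "s > (0 :: int)"
  shows "lattice_space (*) (\<lambda>x y. of_int s * x * y) (\<lambda>_ :: unit. 1) (\<lambda>_. 1) 1"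
proof -
  interpret pos_def_quadratic_space "(*)" "\<lambda>x y :: rat. of_int s * x * y"
  proof unfold_locales
    fix x :: rat assume "x \<noteq> 0"
    hence "x * x > 0" by (auto simp: zero_less_mult_iff neq_iff)
    hence "of_int s * (x * x) > 0" using s mult_pos_pos[of "of_int s" "x * x"] by simp
    thus "of_int s * x * x > 0" by (simp only: mult.assoc)
  qed (simp_all add: algebra_simps)
  have comb: "comb v c = c () * v ()" for v c
    by (simp add: comb_def UNIV_unit)
  have L: "lattice_of (\<lambda>_ :: unit. 1) = \<int>"
    unfolding lattice_of_def comb by (auto simp: Ints_def image_iff intro: exI[of _ "\<lambda>_. _"])
  show ?thesis
  proof
    fix x y :: rat assume "x \<in> lattice_of (\<lambda>_ :: unit. 1)" "y \<in> lattice_of (\<lambda>_ :: unit. 1)"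
    thus "of_int s * x * y \<in> \<int>" unfolding L by (intro Ints_mult) auto
  qed (use s in \<open>auto simp: comb L\<close>)
qed

lemma jacobi_theta_translate: "jacobi_theta (z + of_int j) = jacobi_theta z"
proof -
  have "exp (2 * of_real pi * \<i> * of_int (n ^ 2) * (z + of_int j)) = exp (2 * of_real pi * \<i> * of_int (n ^ 2) * z)" for n
    using qexp_of_int[of "n ^ 2 * j"] unfolding qexp_def
    by (simp add: ring_distribs exp_add mult_ac)
  thus ?thesis by (simp add: jacobi_theta_def)
qed

lemma odd_of_unimodular:
  fixes \<alpha> \<beta> c \<delta> :: int
  assumes "\<alpha> * \<delta> - \<beta> * c = 1" "4 dvd c"
  shows "odd \<delta>"
proof
  assume "even \<delta>"
  hence "even (\<alpha> * \<delta> - \<beta> * c)" using assms(2) by (auto elim!: dvdE)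
  thus False using assms(1) by simp
qed

lemma coprime_of_unimodular:
  fixes \<alpha> \<beta> c \<delta> :: int
  assumes "\<alpha> * \<delta> - \<beta> * c = 1"
  shows "coprime \<delta> c" "coprime \<beta> \<delta>"
proof -
  show "coprime \<delta> c"
    by (rule coprimeI) (metis assms dvd_diff dvd_mult)
  show "coprime \<beta> \<delta>"
    by (rule coprimeI) (metis assms dvd_diff dvd_mult dvd_mult2)
qed

text \<open>The general law for s x^2 with a = 1 and \<mu> = 0. The dual of the integers for this
  form is (1/s) Z, so \<open>s\<close> plays the part of the level.\<close>

lemma theta_rank_one_transform:
  assumes s: "s > 0" and det: "\<alpha> * \<delta> - \<beta> * c = 1" and c: "4 * s dvd c" and z: "Im z > 0"
  shows "jacobi_theta (of_int s * mobius \<alpha> \<beta> c \<delta> z) =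
    gauss_sum (\<beta> * s) \<delta> * inversion_factor c \<delta> z * jacobi_theta (of_int s * z)"
proof -
  let ?B = "\<lambda>x y :: rat. of_int s * x * y"
  interpret lattice_space "(*)" ?B "\<lambda>_ :: unit. 1" "\<lambda>_. 1" 1 by (rule rank_one_lattice_space[OF s])
  have comb: "comb v c = c () * v ()" for v :: "unit \<Rightarrow> rat" and c
    by (simp add: comb_def UNIV_unit)
  have L: "lattice_of (\<lambda>_ :: unit. 1) = range of_int"
    unfolding lattice_of_def comb by (auto simp: image_iff intro: exI[of _ "\<lambda>_. _"])
  have theta: "coset_theta 1 0 w = jacobi_theta (of_int s * w)" for w
  proof -
    have "coset_theta 1 0 w = (\<Sum>\<^sub>\<infinity>x\<in>range of_int. gexp w (of_int s * x * x))"
      unfolding coset_theta_def L by simp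
    also have "\<dots> = (\<Sum>\<^sub>\<infinity>n :: int. gexp w (of_int s * of_int n * of_int n))"
      by (subst infsum_reindex) (auto simp: o_def inj_on_def)
    also have "\<dots> = jacobi_theta (of_int s * w)"
      unfolding jacobi_theta_def gexp_def qexp_def
      by (intro infsum_cong) (simp add: of_rat_mult power2_eq_square mult_ac)
    finally show ?thesis .
  qed
  have \<delta>: "\<delta> \<noteq> 0" using odd_of_unimodular[OF det] c by (auto intro: dvd_trans)
  have "lattice_gauss_sum (\<beta> * 1 ^ 2) \<delta> = gauss_sum (\<beta> * s) \<delta>"
    by (subst lattice_gauss_sum_eq_prod[OF \<delta>]) (simp_all add: tt_def UNIV_unit)
  moreover have "coset_theta 1 0 (mobius \<alpha> \<beta> c \<delta> z) =
    lattice_gauss_sum (\<beta> * 1 ^ 2) \<delta> * inversion_factor c \<delta> z ^ CARD(unit) * coset_theta 1 (of_int \<alpha> * 0) z"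
  proof (rule coset_theta_transform[OF det _ _ _ _ z])
    show "4 * s * 1 ^ 2 dvd c" using c by simp
    fix y assume "y \<in> dual_lattice"
    moreover have "(1 :: rat) \<in> lattice_of (\<lambda>_ :: unit. 1)" unfolding L by (metis of_int_1 rangeI)
    ultimately have "of_int s * y * 1 \<in> \<int>" unfolding dual_lattice_def by blast
    thus "of_int s * y \<in> lattice_of (\<lambda>_ :: unit. 1)" unfolding L by (simp add: Ints_def)
  qed auto
  ultimately show ?thesis by (simp add: theta)
qed

lemma Im_mobius_pos:
  assumes "\<alpha> * \<delta> - \<beta> * c = 1" "\<delta> \<noteq> 0" "Im z > 0"
  shows "Im (mobius \<alpha> \<beta> c \<delta> z) > 0"
  using mobius_eq_shifted_inversion(1,3)[OF assms] by simp

lemma mobius_translate: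
  "mobius \<alpha> (\<beta> + j * \<alpha>) c (\<delta> + j * c) z = mobius \<alpha> \<beta> c \<delta> (z + of_int j)"
  by (simp add: mobius_def algebra_simps)

lemma theta_factor_translate:
  "theta_factor \<alpha> (\<beta> + j * \<alpha>) c (\<delta> + j * c) z = theta_factor \<alpha> \<beta> c \<delta> (z + of_int j)"
  by (simp add: theta_factor_def mobius_translate jacobi_theta_translate)

text \<open>The case s = 1 of the rank-one law. The Gauss sum is non-zero because the theta values
  on both sides are.\<close>

lemma theta_factor_eq:
  assumes det: "\<alpha> * \<delta> - \<beta> * c = 1" and c: "4 dvd c" and z: "Im z > 0"
  shows "theta_factor \<alpha> \<beta> c \<delta> z = gauss_sum \<beta> \<delta> * inversion_factor c \<delta> z" and "theta_factor \<alpha> \<beta> c \<delta> z \<noteq> 0"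
    and "gauss_sum \<beta> \<delta> \<noteq> 0"
proof -
  have \<delta>: "\<delta> \<noteq> 0" using odd_of_unimodular[OF det c] by auto
  show eq: "theta_factor \<alpha> \<beta> c \<delta> z = gauss_sum \<beta> \<delta> * inversion_factor c \<delta> z"
    using theta_rank_one_transform[of 1, OF _ det _ z] c jacobi_theta_nonzero[OF z] by (simp add: theta_factor_def)
  show nz: "theta_factor \<alpha> \<beta> c \<delta> z \<noteq> 0"
    using jacobi_theta_nonzero[OF z] jacobi_theta_nonzero[OF Im_mobius_pos[OF det \<delta> z]] by (simp add: theta_factor_def)
  show "gauss_sum \<beta> \<delta> \<noteq> 0" using nz eq by auto
qed

text \<open>Quadratic reciprocity, in the form of the periodicity of the Kronecker symbol in its lower
  argument, is read off the theta series of the form \<open>s x\<^sup>2\<close>, which is invariant under translations.\<close>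

lemma kronecker_translate:
  assumes s: "s > 0" and det: "\<alpha> * \<delta> - \<beta> * c = 1" and c: "4 * s dvd c"
  shows "kronecker s (\<delta> + j * c) = kronecker s \<delta>"
proof -
  have c4: "4 dvd c" using c by (metis dvd_mult_left)
  have law: "jacobi_theta (of_int s * mobius \<alpha> \<beta> c \<delta> z) = of_int (kronecker s \<delta>) * theta_factor \<alpha> \<beta> c \<delta> z * jacobi_theta (of_int s * z)"
    if det: "\<alpha> * \<delta> - \<beta> * c = 1" and z: "Im z > 0" for \<beta> \<delta> z
  proof -
    have "coprime s \<delta>"
      using coprime_of_unimodular(1)[OF det] c by (metis coprime_commute coprime_divisors dvd_mult_right dvd_refl)
    hence "gauss_sum (s * \<beta>) \<delta> = of_int (kronecker s \<delta>) * gauss_sum \<beta> \<delta>"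
      by (intro gauss_sum_kronecker odd_of_unimodular[OF det c4] coprime_of_unimodular[OF det] s)
    thus ?thesis
      using theta_rank_one_transform[OF s det c z] theta_factor_eq(1)[OF det c4 z] by (simp add: mult_ac)
  qed
  have det': "\<alpha> * (\<delta> + j * c) - (\<beta> + j * \<alpha>) * c = 1" using det by (simp add: algebra_simps)
  have i: "Im (\<i> + of_int j) > 0" by simp
  have "of_int (kronecker s (\<delta> + j * c)) * (theta_factor \<alpha> \<beta> c \<delta> (\<i> + of_int j) * jacobi_theta (of_int s * \<i>)) =
     jacobi_theta (of_int s * mobius \<alpha> \<beta> c \<delta> (\<i> + of_int j))"
    using law[OF det', of \<i>] by (simp add: mobius_translate theta_factor_translate mult.assoc)
  also have "\<dots> = of_int (kronecker s \<delta>) * (theta_factor \<alpha> \<beta> c \<delta> (\<i> + of_int j) * jacobi_theta (of_int s * \<i>))"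
    using law[OF det i] jacobi_theta_translate[of "of_int s * \<i>" "s * j"] by (simp add: ring_distribs mult_ac)
  finally have "complex_of_int (kronecker s (\<delta> + j * c)) = of_int (kronecker s \<delta>)"
    using theta_factor_eq(2)[OF det c4 i] jacobi_theta_nonzero[of "of_int s * \<i>"] s by simp
  thus ?thesis by (simp only: of_int_eq_iff)
qed

section \<open>Kronecker symbols of products and squares\<close>

lemma kronecker_mult_left_pos:
  assumes "odd m" "s > 0" "t > 0"
  shows "kronecker (s * t) m = kronecker s m * kronecker t m"
proof (cases "m > 0")
  case False
  hence "m < 0" using assms(1) by (cases "m = 0") auto
  thus ?thesis
    using kronecker_mult_left[of "- m" s t] assms kronecker_uminus_right[of _ "- m"] by simp
qed (use assms kronecker_mult_left in blast)

lemma kronecker_square_pos: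
  assumes "odd m" "coprime t m" "t \<noteq> 0"
  shows "kronecker (t ^ 2) m = 1"
proof -
  have *: "kronecker (t ^ 2) m = 1" if "m > 0" "odd m" "coprime t m" for m
    using kronecker_mult_left[of m t t] kronecker_square_coprime[of m t] that by (simp add: power2_eq_square)
  show ?thesis
  proof (cases "m > 0")
    case False
    hence "m < 0" using assms(1) by (cases "m = 0") auto
    thus ?thesis using *[of "- m"] assms kronecker_uminus_right[of "t ^ 2" "- m"] by simp
  qed (use * assms in blast)
qed

lemma kronecker_prod_pos:
  assumes "odd m" "finite A" "\<And>i. i \<in> A \<Longrightarrow> t i > 0"
  shows "kronecker (\<Prod>i\<in>A. t i) m = (\<Prod>i\<in>A. kronecker (t i) m)"
  using assms(2,3)
proof (induction A)
  case empty
  show ?case using kronecker_square_pos[of m 1] assms(1) by simp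
next
  case (insert i A)
  thus ?case using kronecker_mult_left_pos[OF assms(1), of "t i" "\<Prod>i\<in>A. t i"] by (simp add: prod_pos)
qed

context lattice_space
begin

definition ti :: "'n \<Rightarrow> int" where "ti i = \<lfloor>tt i\<rfloor>"

lemma of_int_ti: "of_int (ti i) = tt i"
  using tt_Ints[of i] by (auto simp: ti_def elim: Ints_cases)

lemma ti_pos: "ti i > 0"
proof -
  have "(of_int (ti i) :: rat) > 0" using tt_pos[of i] by (simp add: of_int_ti)
  thus ?thesis by (simp only: of_int_0_less_iff)
qed

lemma coset_theta_translate:
  assumes "\<mu> \<in> LL"
  shows "coset_theta a \<mu> (z + of_int j) = coset_theta a \<mu> z"
  unfolding coset_theta_def
proof (rule infsum_cong)
  fix x assume "x \<in> LL"
  hence "smul (of_int a) x + \<mu> \<in> LL" by (intro lattice_of_add lattice_of_smul assms)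
  hence "B (smul (of_int a) x + \<mu>) (smul (of_int a) x + \<mu>) \<in> \<int>" by (intro integral)
  hence "gexp (of_real (of_rat (of_int j))) (B (smul (of_int a) x + \<mu>) (smul (of_int a) x + \<mu>)) = 1"
    unfolding gexp_of_rat by (intro rexp_Ints Ints_mult) auto
  thus "gexp (z + of_int j) (B (smul (of_int a) x + \<mu>) (smul (of_int a) x + \<mu>)) = gexp z (B (smul (of_int a) x + \<mu>) (smul (of_int a) x + \<mu>))"
    by (simp add: gexp_add_left)
qed

text \<open>At z = i all terms are positive. This value is cancelled when two multipliers are
  compared.\<close>

lemma coset_theta_zero_nonzero:
  assumes a: "a \<noteq> 0"
  shows "coset_theta a 0 \<i> \<noteq> 0"
proof -
  define q where "q = (\<lambda>x. exp (- 2 * pi * 1 * of_rat (B (smul (of_int a) x + 0) (smul (of_int a) x + 0))))"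
  have s: "q summable_on LL" unfolding q_def by (rule coset_theta_summable[OF a]) simp
  have "gexp \<i> r = of_real (exp (- 2 * pi * 1 * of_rat r))" for r
    by (simp add: gexp_def qexp_def mult_ac flip: exp_of_real)
  hence "coset_theta a 0 \<i> = (\<Sum>\<^sub>\<infinity>x\<in>LL. of_real (q x))"
    by (simp only: coset_theta_def q_def)
  also have "\<dots> = of_real (\<Sum>\<^sub>\<infinity>x\<in>LL. q x)"
    by (rule infsumI[OF has_sum_of_real_iff[THEN iffD2, OF has_sum_infsum[OF s]]])
  finally have eq: "coset_theta a 0 \<i> = of_real (\<Sum>\<^sub>\<infinity>x\<in>LL. q x)" .
  have "(\<Sum>x\<in>{0}. q x) \<le> (\<Sum>\<^sub>\<infinity>x\<in>LL. q x)"
    by (rule finite_sum_le_infsum[OF s]) (auto simp: q_def)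
  hence "(\<Sum>\<^sub>\<infinity>x\<in>LL. q x) > 0" by (simp add: q_def)
  thus ?thesis unfolding eq by simp
qed

text \<open>Each orthogonal direction contributes the symbol of its norm \<open>ti i\<close>, while
  the square a^2 is invisible to the symbol.\<close>

lemma lattice_gauss_sum_kronecker:
  assumes odd: "odd \<delta>" and den: "coprime \<delta> den" and t: "\<And>i. coprime (ti i) \<delta>"
    and a: "coprime a \<delta>" "a \<noteq> 0" and \<beta>: "coprime \<beta> \<delta>"
  shows "lattice_gauss_sum (\<beta> * a ^ 2) \<delta> = of_int (kronecker (\<Prod>i\<in>UNIV. ti i) \<delta>) * gauss_sum \<beta> \<delta> ^ CARD('n)"
proof -
  have \<delta>: "\<delta> \<noteq> 0" using odd by auto
  have "gauss_sum (\<beta> * a ^ 2 * ti i) \<delta> = of_int (kronecker (ti i) \<delta>) * gauss_sum \<beta> \<delta>" for i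
  proof -
    have "gauss_sum (a ^ 2 * ti i * \<beta>) \<delta> = of_int (kronecker (a ^ 2 * ti i) \<delta>) * gauss_sum \<beta> \<delta>"
      using a t[of i] ti_pos[of i] by (intro gauss_sum_kronecker odd \<beta>) auto
    moreover have "kronecker (a ^ 2 * ti i) \<delta> = kronecker (ti i) \<delta>"
      using kronecker_mult_left_pos[OF odd, of "a ^ 2" "ti i"] kronecker_square_pos[OF odd a] a(2) ti_pos[of i] by simp
    ultimately show ?thesis by (simp add: mult_ac)
  qed
  hence "lattice_gauss_sum (\<beta> * a ^ 2) \<delta> = (\<Prod>i\<in>UNIV. of_int (kronecker (ti i) \<delta>) * gauss_sum \<beta> \<delta>)"
    unfolding lattice_gauss_sum_eq_prod[OF \<delta> den] ti_def[symmetric] by simp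
  also have "\<dots> = of_int (\<Prod>i\<in>UNIV. kronecker (ti i) \<delta>) * gauss_sum \<beta> \<delta> ^ CARD('n)"
    by (simp add: prod.distrib)
  also have "(\<Prod>i\<in>UNIV. kronecker (ti i) \<delta>) = kronecker (\<Prod>i\<in>UNIV. ti i) \<delta>"
    by (rule kronecker_prod_pos[symmetric]) (use odd ti_pos in auto)
  finally show ?thesis .
qed

theorem coset_theta_modular:
  fixes a N s f \<alpha> \<beta> \<delta> c :: int
  assumes det: "\<alpha> * \<delta> - \<beta> * c = 1" and c: "4 * N * a ^ 2 dvd c" and a: "a > 0" and \<mu>: "\<mu> \<in> LL"
    and N: "\<And>y. y \<in> dual_lattice \<Longrightarrow> smul (of_int N) y \<in> LL" and s: "s > 0" "s dvd N"
    and prod: "(\<Prod>i\<in>UNIV. ti i) = s * f ^ 2" and z: "Im z > 0"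
  shows "coset_theta a \<mu> (mobius \<alpha> \<beta> c \<delta> z) =
    of_int (kronecker s \<delta>) * theta_factor \<alpha> \<beta> c \<delta> z ^ CARD('n) * coset_theta a (smul (of_int \<alpha>) \<mu>) z"
proof -
  have dvd: "4 dvd c" "a dvd c" "4 * s dvd c"
  proof -
    have "4 dvd 4 * N * a ^ 2" "a dvd 4 * N * a ^ 2" "4 * s dvd 4 * N * a ^ 2"
      using s(2) by (auto simp: power2_eq_square intro: mult_dvd_mono dvd_mult2)
    thus "4 dvd c" "a dvd c" "4 * s dvd c" using c dvd_trans by blast+
  qed
  \<comment> \<open>The inversion factors of the coset and of the Jacobi theta function cancel;
    \<open>K\<close> is what remains of the multiplier.\<close>
  define K where "K = (\<lambda>\<beta> \<delta>. lattice_gauss_sum (\<beta> * a ^ 2) \<delta> / gauss_sum \<beta> \<delta> ^ CARD('n))"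
  have law: "coset_theta a \<mu> (mobius \<alpha> \<beta> c \<delta> z) = K \<beta> \<delta> * theta_factor \<alpha> \<beta> c \<delta> z ^ CARD('n) * coset_theta a (smul (of_int \<alpha>) \<mu>) z"
    if det: "\<alpha> * \<delta> - \<beta> * c = 1" and z: "Im z > 0" and \<mu>: "\<mu> \<in> LL" for \<beta> \<delta> z \<mu>
  proof -
    have "coset_theta a \<mu> (mobius \<alpha> \<beta> c \<delta> z) =
      lattice_gauss_sum (\<beta> * a ^ 2) \<delta> * inversion_factor c \<delta> z ^ CARD('n) * coset_theta a (smul (of_int \<alpha>) \<mu>) z"
      by (rule coset_theta_transform[OF det c a \<mu> _ z]) (rule N)
    thus ?thesis
      unfolding theta_factor_eq(1)[OF det dvd(1) z] K_def
      using theta_factor_eq(3)[OF det dvd(1) z] by (simp add: power_mult_distrib)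
  qed
  have tp: "(\<Prod>i\<in>UNIV. ti i) > 0" by (intro prod_pos ti_pos)
  have "den * (\<Prod>i\<in>UNIV. ti i) \<noteq> 0"
    using mult_pos_pos[OF den_pos tp] by (rule less_imp_neq[symmetric])
  \<comment> \<open>Being prime to \<open>den\<close> makes the Gauss sum split over the orthogonal
    basis; being prime to the norms makes their symbols non-zero.\<close>
  then obtain j where j: "coprime (\<delta> + j * c) (den * (\<Prod>i\<in>UNIV. ti i))"
    using exists_coprime_translate[OF coprime_of_unimodular(1)[OF det]] by blast
  define \<delta>' \<beta>' where "\<delta>' = \<delta> + j * c" and "\<beta>' = \<beta> + j * \<alpha>"
  have det': "\<alpha> * \<delta>' - \<beta>' * c = 1" using det by (simp add: \<delta>'_def \<beta>'_def algebra_simps)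
  have odd': "odd \<delta>'" by (rule odd_of_unimodular[OF det' dvd(1)])
  have cop_den: "coprime \<delta>' den" and cop_prod: "coprime (\<Prod>i\<in>UNIV. ti i) \<delta>'"
    using j by (simp_all add: \<delta>'_def coprime_commute)
  have cop_ti: "coprime (ti i) \<delta>'" for i
    by (rule coprime_divisors[OF _ dvd_refl cop_prod]) (rule dvd_prodI, auto)
  have cop_a: "coprime a \<delta>'"
    using coprime_of_unimodular(1)[OF det'] dvd(2) by (metis coprime_commute coprime_divisors dvd_refl)
  have f0: "f \<noteq> 0" using tp prod by auto
  have "coprime (s * f ^ 2) \<delta>'" using cop_prod unfolding prod .
  hence cop_f: "coprime f \<delta>'" by simp
  have "K \<beta>' \<delta>' = of_int (kronecker (\<Prod>i\<in>UNIV. ti i) \<delta>')"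
    unfolding K_def using theta_factor_eq(3)[OF det' dvd(1) z] a
    by (subst lattice_gauss_sum_kronecker[OF odd' cop_den cop_ti cop_a _ coprime_of_unimodular(2)[OF det']]) auto
  also have "kronecker (\<Prod>i\<in>UNIV. ti i) \<delta>' = kronecker s \<delta>'"
    unfolding prod using kronecker_mult_left_pos[OF odd', of s "f ^ 2"] kronecker_square_pos[OF odd' cop_f f0] s f0 by simp
  also have "\<dots> = kronecker s \<delta>" unfolding \<delta>'_def by (rule kronecker_translate[OF s(1) det dvd(3)])
  finally have K': "K \<beta>' \<delta>' = of_int (kronecker s \<delta>)" .
  have i: "Im (\<i> + of_int j) > 0" by simp
  \<comment> \<open>The same point is the image of i under the new matrix and of i + j under the old
    one. For \<mu> = 0 the coset is not moved by \<alpha>, so both laws involve the same non-zero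
    theta value and the two multipliers agree.\<close>
  have "K \<beta>' \<delta>' * (theta_factor \<alpha> \<beta> c \<delta> (\<i> + of_int j) ^ CARD('n) * coset_theta a 0 \<i>) = coset_theta a 0 (mobius \<alpha> \<beta> c \<delta> (\<i> + of_int j))"
    using law[OF det', of \<i> 0] by (simp add: mobius_translate theta_factor_translate \<delta>'_def \<beta>'_def mult.assoc)
  also have "\<dots> = K \<beta> \<delta> * (theta_factor \<alpha> \<beta> c \<delta> (\<i> + of_int j) ^ CARD('n) * coset_theta a 0 \<i>)"
    using law[OF det i, of 0] coset_theta_translate[of 0 a \<i> j] by (simp add: mult.assoc)
  finally have "K \<beta>' \<delta>' = K \<beta> \<delta>"
    using theta_factor_eq(2)[OF det dvd(1) i] coset_theta_zero_nonzero[of a] a by simp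
  thus ?thesis using law[OF det z \<mu>] K' by simp
qed

end

subsection \<open>Discriminant and level\<close>

text \<open>A prime of s / gcd(s, N) divides \<open>N\<close> and therefore also the gcd, so its
  square would divide \<open>s\<close>.\<close>

lemma squarefree_dvd_of_dvd_power:
  fixes s N :: int
  assumes s: "squarefree s" and dvd: "s dvd N ^ k"
  shows "s dvd N"
proof -
  have s0: "s \<noteq> 0"
  proof
    assume "s = 0"
    hence "2 ^ 2 dvd s" by simp
    from squarefreeD[OF s this] show False by simp
  qed
  define d where "d = gcd s N"
  obtain m where m: "s = d * m" unfolding d_def by (metis dvdE gcd_dvd1)
  have "is_unit m"
  proof (rule ccontr)
    assume "\<not> is_unit m"
    moreover have "m \<noteq> 0" using s0 m by auto
    ultimately obtain p where p: "prime p" "p dvd m" using prime_divisor_exists by blast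
    have ps: "p dvd s" using p(2) m by simp
    hence "p dvd N ^ k" using dvd dvd_trans by blast
    hence "p dvd N" using p(1) prime_dvd_power by blast
    hence "p dvd d" using ps by (simp add: d_def)
    hence "p ^ 2 dvd s" unfolding m power2_eq_square using p(2) by (rule mult_dvd_mono)
    hence "is_unit p" using s by (rule squarefreeD[rotated])
    thus False using p(1) not_prime_unit by blast
  qed
  hence "s dvd d" unfolding m by (metis dvd_refl mult_unit_dvd_iff)
  thus ?thesis by (simp add: d_def)
qed

lemma Ints_det:
  fixes A :: "rat ^ 'n ^ 'n"
  assumes "\<And>i j. A $ i $ j \<in> \<int>"
  shows "det A \<in> \<int>"
  unfolding det_def by (intro Ints_sum Ints_mult Ints_prod assms) auto

context pos_def_quadratic_space
begin

lemma gram_matrix_comb: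
  fixes P :: "rat ^ 'n ^ 'n"
  assumes T: "\<And>i. T i = comb e (\<lambda>j. P $ i $ j)"
  shows "gram_matrix B T = P ** gram_matrix B e ** transpose P"
proof -
  have "B (T i) (T k) = (\<Sum>l\<in>UNIV. (\<Sum>j\<in>UNIV. P $ i $ j * B (e j) (e l)) * P $ k $ l)" for i k
    unfolding T[of k] B_comb_right by (intro sum.cong) (simp_all add: T[of i] B_comb_left mult.commute)
  thus ?thesis
    by (simp add: vec_eq_iff gram_matrix_def matrix_matrix_mult_def transpose_def)
qed

lemma det_gram_matrix_comb:
  fixes P :: "rat ^ 'n ^ 'n"
  assumes "\<And>i. T i = comb e (\<lambda>j. P $ i $ j)"
  shows "det (gram_matrix B T) = det (gram_matrix B e) * det P ^ 2"
  unfolding gram_matrix_comb[OF assms] det_mul det_transpose by (simp add: power2_eq_square)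

lemma lattice_basis_comb:
  fixes e :: "'n::finite \<Rightarrow> 'v"
  assumes "lattice_basis smul e L"
  shows "L = lattice_of e" and "\<exists>c. x = comb e c" and "comb e c = comb e d \<Longrightarrow> c = d"
proof -
  have inj: "inj e" and indep: "\<not> dependent (range e)" and span: "span (range e) = UNIV"
    and L: "L = {\<Sum>i\<in>UNIV. smul (of_int (c i)) (e i) | c. True}"
    using assms by (auto simp: lattice_basis_def)
  show "L = lattice_of e" unfolding L lattice_of_def comb_def by auto
  have reindex: "(\<Sum>v\<in>range e. smul (u v) v) = comb e (\<lambda>i. u (e i))" for u
    unfolding comb_def by (subst sum.reindex[OF inj]) simp
  have "x \<in> span (range e)" using span by simp
  thus "\<exists>c. x = comb e c" by (subst (asm) span_finite) (auto simp: reindex)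
  show "c = d" if "comb e c = comb e d"
  proof (rule ccontr)
    assume "c \<noteq> d"
    then obtain i where i: "c i \<noteq> d i" by blast
    define u where "u = (\<lambda>v. c (inv_into UNIV e v) - d (inv_into UNIV e v))"
    have "(\<Sum>v\<in>range e. smul (u v) v) = 0"
      unfolding reindex u_def using inj that by (simp add: comb_diff)
    moreover have "u (e i) \<noteq> 0" using i inj by (simp add: u_def)
    ultimately have "dependent (range e)"
      by (subst dependent_finite) (auto intro!: exI[of _ u])
    thus False using indep by contradiction
  qed
qed

text \<open>Both families are independent and spanning, so \<open>W\<close> has as many elements as
  the given basis and can be indexed by the same type.\<close>

lemma orthogonal_basis_exists:
  fixes e :: "'n::finite \<Rightarrow> 'v"
  assumes "lattice_basis smul e L"
  obtains w :: "'n \<Rightarrow> 'v" where "\<And>i j. i \<noteq> j \<Longrightarrow> B (w i) (w j) = 0" "\<And>i. w i \<noteq> 0"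
    "\<And>x. x = comb w (\<lambda>i. B x (w i) / B (w i) (w i))"
proof -
  have inj: "inj e" and indep: "\<not> dependent (range e)" and span: "span (range e) = UNIV"
    using assms by (auto simp: lattice_basis_def)
  obtain W where W: "finite W" "0 \<notin> W" "\<And>x y. x \<in> W \<Longrightarrow> y \<in> W \<Longrightarrow> x \<noteq> y \<Longrightarrow> B x y = 0" "span W = UNIV"
    using orthogonal_spanning_set[of "range e"] span by auto
  have coord: "B (\<Sum>v\<in>W. smul (u v) v) t = u t * B t t" if "t \<in> W" for u t
  proof -
    have "B (\<Sum>v\<in>W. smul (u v) v) t = (\<Sum>v\<in>W. u v * B v t)" by (simp add: B_sum_left B_smul)
    also have "\<dots> = (\<Sum>v\<in>{t}. u v * B v t)"
      by (rule sum.mono_neutral_right) (use W that in auto)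
    finally show ?thesis by simp
  qed
  have Bt: "B t t \<noteq> 0" if "t \<in> W" for t using that W(2) by auto
  have indepW: "\<not> dependent W"
  proof
    assume "dependent W"
    then obtain u v where "v \<in> W" "u v \<noteq> 0" "(\<Sum>v\<in>W. smul (u v) v) = 0"
      using dependent_finite[OF W(1)] by auto
    thus False using coord[of v u] Bt[of v] by simp
  qed
  have "card W \<le> card (range e)"
    by (rule independent_span_bound[THEN conjunct2]) (use indepW span in auto)
  moreover have "card (range e) \<le> card W"
    by (rule independent_span_bound[THEN conjunct2]) (use indep W in auto)
  ultimately have "card (UNIV :: 'n set) = card W" by (simp add: card_image[OF inj])
  then obtain w :: "'n \<Rightarrow> 'v" where w: "bij_betw w UNIV W"
    using finite_same_card_bij[of "UNIV :: 'n set" W] W(1) by auto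
  have wW: "w i \<in> W" for i using w by (auto simp: bij_betw_def)
  show ?thesis
  proof (rule that[of w])
    show "B (w i) (w j) = 0" if "i \<noteq> j" for i j
      using W(3)[OF wW wW] w that by (auto simp: bij_betw_def inj_on_def)
    show "w i \<noteq> 0" for i using wW[of i] W(2) by auto
    fix x
    have "x \<in> span W" using W(4) by simp
    then obtain u where u: "x = (\<Sum>v\<in>W. smul (u v) v)" by (subst (asm) span_finite[OF W(1)]) auto
    have "B x (w i) / B (w i) (w i) = u (w i)" for i
      unfolding u using coord[OF wW] Bt[OF wW] by simp
    moreover have "x = comb w (\<lambda>i. u (w i))"
      unfolding u comb_def using sum.reindex_bij_betw[OF w, of "\<lambda>v. smul (u v) v"] by simp
    ultimately show "x = comb w (\<lambda>i. B x (w i) / B (w i) (w i))" by simp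
  qed
qed

text \<open>Two denominators are cleared: \<open>m\<close> moves the orthogonal basis into the
  lattice, and \<open>den\<close> moves the lattice into the integral span of
  \<open>T\<close>.\<close>

lemma lattice_space_exists:
  fixes e :: "'n::finite \<Rightarrow> 'v"
  assumes basis: "lattice_basis smul e L" and int: "integral_lattice B L"
  obtains T den where "lattice_space smul B e T den"
proof -
  note L = lattice_basis_comb(1)[OF basis] and e_comb = lattice_basis_comb(2)[OF basis]
    and e_inj = lattice_basis_comb(3)[OF basis]
  obtain w :: "'n \<Rightarrow> 'v" where w: "\<And>i j. i \<noteq> j \<Longrightarrow> B (w i) (w j) = 0" "\<And>i. w i \<noteq> 0"
    "\<And>x. x = comb w (\<lambda>i. B x (w i) / B (w i) (w i))"
    using orthogonal_basis_exists[OF basis] by blast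
  have "\<forall>i. \<exists>c. w i = comb e c" using e_comb by blast
  from choice[OF this] obtain c where c: "\<And>i. w i = comb e (c i)" by blast
  obtain m :: int where m: "m > 0" "\<And>x. x \<in> range (\<lambda>(i, j). c i j) \<Longrightarrow> of_int m * x \<in> \<int>"
  proof (rule common_denominator[of "range (\<lambda>(i, j). c i j)"])
    show "finite (range (\<lambda>(i, j). c i j))" by (rule finite_imageI) simp
  qed blast
  define T where "T = (\<lambda>i. smul (of_int m) (w i))"
  have T_lattice: "T i \<in> lattice_of e" for i
  proof -
    have "of_int m * c i j \<in> \<int>" for j by (rule m(2)) auto
    hence fl: "of_int \<lfloor>of_int m * c i j\<rfloor> = of_int m * c i j" for j by (auto elim: Ints_cases)
    have "T i = comb e (\<lambda>j. of_int \<lfloor>of_int m * c i j\<rfloor>)"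
      by (simp only: T_def c comb_smul fl)
    thus ?thesis by (simp only: lattice_ofI)
  qed
  have T_expand: "x = comb T (\<lambda>i. B x (T i) / B (T i) (T i))" for x
  proof -
    have "comb T (\<lambda>i. B x (T i) / B (T i) (T i)) = comb w (\<lambda>i. B x (w i) / B (w i) (w i))"
      unfolding comb_def T_def using m(1) by (intro sum.cong) (simp_all add: B_smul B_smul_right)
    thus ?thesis using w(3)[of x] by simp
  qed
  have "\<forall>i. \<exists>d. e i = comb T d" using T_expand by blast
  from choice[OF this] obtain d where d: "\<And>i. e i = comb T (d i)" by blast
  obtain den :: int where den: "den > 0" "\<And>x. x \<in> range (\<lambda>(i, j). d i j) \<Longrightarrow> of_int den * x \<in> \<int>"
  proof (rule common_denominator[of "range (\<lambda>(i, j). d i j)"])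
    show "finite (range (\<lambda>(i, j). d i j))" by (rule finite_imageI) simp
  qed blast
  have den_e: "smul (of_int den) (e i) \<in> lattice_of T" for i
  proof -
    have "of_int den * d i j \<in> \<int>" for j by (rule den(2)) auto
    hence fl: "of_int \<lfloor>of_int den * d i j\<rfloor> = of_int den * d i j" for j by (auto elim: Ints_cases)
    have "smul (of_int den) (comb T (d i)) = comb T (\<lambda>j. of_int \<lfloor>of_int den * d i j\<rfloor>)"
      by (simp only: comb_smul fl)
    hence "smul (of_int den) (e i) = comb T (\<lambda>j. of_int \<lfloor>of_int den * d i j\<rfloor>)"
      using d[of i] by simp
    thus ?thesis by (simp only: lattice_ofI)
  qed
  have "lattice_space smul B e T den"
  proof
    show "smul (of_int den) x \<in> lattice_of T" if x: "x \<in> lattice_of e" for x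
    proof -
      obtain a where "x = comb e (\<lambda>i. of_int (a i))" using x by (auto simp: lattice_of_def)
      hence eq: "smul (of_int den) x = (\<Sum>i\<in>UNIV. smul (of_int (a i)) (smul (of_int den) (e i)))"
        by (simp add: comb_def scale_sum_right mult.commute)
      show ?thesis unfolding eq by (intro lattice_of_sum lattice_of_smul den_e)
    qed
    show "B x y \<in> \<int>" if "x \<in> lattice_of e" "y \<in> lattice_of e" for x y
      using int that L by (auto simp: integral_lattice_def)
    show "x = comb T (\<lambda>i. B x (T i) / B (T i) (T i))" for x by (rule T_expand)
    show "B (T i) (T j) = 0" if "i \<noteq> j" for i j
      using w(1)[OF that] by (simp add: T_def B_smul B_smul_right)
    show "T i \<noteq> 0" for i using w(2)[of i] m(1) by (simp add: T_def)
  qed (use e_inj T_lattice den(1) in auto)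
  thus ?thesis using that by blast
qed

end

context lattice_space
begin

section \<open>Integrality of discriminant and level\<close>

lemma e_gram_Ints: "gram_matrix B e $ i $ j \<in> \<int>"
  unfolding gram_matrix_def by (simp add: integral lattice_of_base)

lemma of_int_lattice_disc: "of_int (lattice_disc B e) = det (gram_matrix B e)"
proof -
  have "det (gram_matrix B e) \<in> \<int>" by (rule Ints_det) (rule e_gram_Ints)
  thus ?thesis by (auto simp: lattice_disc_def elim: Ints_cases)
qed

text \<open>The Gram matrix of \<open>T\<close> is diagonal and arises from that of \<open>e\<close>
  by an integral change of basis \<open>P\<close>; \<open>m\<close> is the determinant of
  \<open>P\<close>.\<close>

lemma prod_ti_eq_disc: "\<exists>m. (\<Prod>i\<in>UNIV. ti i) = lattice_disc B e * m ^ 2"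
proof -
  have "\<exists>c :: 'n \<Rightarrow> int. T i = comb e (\<lambda>j. of_int (c j))" for i
    using T_lattice[of i] by (auto simp: lattice_of_def)
  then obtain c :: "'n \<Rightarrow> 'n \<Rightarrow> int" where c: "\<And>i. T i = comb e (\<lambda>j. of_int (c i j))" by metis
  define P :: "rat ^ 'n ^ 'n" where "P = (\<chi> i j. of_int (c i j))"
  have "det P \<in> \<int>" by (rule Ints_det) (simp add: P_def)
  then obtain m where m: "det P = of_int m" by (rule Ints_cases)
  have "det (gram_matrix B T) = (\<Prod>i\<in>UNIV. gram_matrix B T $ i $ i)"
    by (rule det_diagonal) (simp add: gram_matrix_def T_orth)
  also have "\<dots> = of_int (\<Prod>i\<in>UNIV. ti i)"
    by (simp add: gram_matrix_def of_int_ti tt_def)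
  finally have "of_int (\<Prod>i\<in>UNIV. ti i) = det (gram_matrix B e) * det P ^ 2"
    using det_gram_matrix_comb[of T e P] c by (simp add: P_def)
  hence "(of_int (\<Prod>i\<in>UNIV. ti i) :: rat) = of_int (lattice_disc B e * m ^ 2)"
    by (simp add: m of_int_lattice_disc)
  thus ?thesis by (metis of_int_eq_iff)
qed

lemma lattice_disc_pos: "lattice_disc B e > 0"
proof -
  obtain m where m: "(\<Prod>i\<in>UNIV. ti i) = lattice_disc B e * m ^ 2" using prod_ti_eq_disc by blast
  have "lattice_disc B e * m ^ 2 > 0" unfolding m[symmetric] by (intro prod_pos ti_pos)
  thus ?thesis using zero_le_power2[of m] by (auto simp: zero_less_mult_iff)
qed

lemma gram_matrix_inverse:
  "gram_matrix B e ** matrix_inv (gram_matrix B e) = mat 1"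
  "matrix_inv (gram_matrix B e) ** gram_matrix B e = mat 1"
proof -
  have "det (gram_matrix B e) \<noteq> 0" using lattice_disc_pos of_int_lattice_disc by (metis less_irrefl of_int_eq_0_iff)
  hence "invertible (gram_matrix B e)" by (simp add: invertible_det_nz)
  then obtain A where "gram_matrix B e ** A = mat 1 \<and> A ** gram_matrix B e = mat 1"
    unfolding invertible_def by blast
  hence "gram_matrix B e ** matrix_inv (gram_matrix B e) = mat 1 \<and> matrix_inv (gram_matrix B e) ** gram_matrix B e = mat 1"
    unfolding matrix_inv_def by (rule someI)
  thus "gram_matrix B e ** matrix_inv (gram_matrix B e) = mat 1"
    "matrix_inv (gram_matrix B e) ** gram_matrix B e = mat 1" by blast+
qed

lemma lattice_level:
  shows "lattice_level B e > 0"
    and "of_nat (lattice_level B e) * matrix_inv (gram_matrix B e) $ i $ j \<in> \<int>"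
proof -
  let ?A = "matrix_inv (gram_matrix B e)"
  let ?Q = "\<lambda>N. N > 0 \<and> (\<forall>i j. of_nat N * ?A $ i $ j \<in> \<int>)"
  obtain m :: int where m: "m > 0" "\<And>x. x \<in> range (\<lambda>(i, j). ?A $ i $ j) \<Longrightarrow> of_int m * x \<in> \<int>"
  proof (rule common_denominator[of "range (\<lambda>(i, j). ?A $ i $ j)"])
    show "finite (range (\<lambda>(i, j). ?A $ i $ j))" by (rule finite_imageI) simp
  qed blast
  have "of_int m * ?A $ i $ j \<in> \<int>" for i j by (rule m(2)) auto
  hence "?Q (nat m)" using m(1) by simp
  hence "?Q (LEAST N. ?Q N)" by (rule LeastI)
  hence Q: "?Q (lattice_level B e)" unfolding lattice_level_def .
  show "lattice_level B e > 0" by (rule Q[THEN conjunct1])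
  show "of_nat (lattice_level B e) * ?A $ i $ j \<in> \<int>" by (rule Q[THEN conjunct2, THEN spec, THEN spec])
qed

text \<open>The coordinates of \<open>y\<close> are the inverse Gram matrix applied to the integers
  B(e_j, y), and the level clears the denominators of that matrix.\<close>

lemma level_smul_dual:
  assumes comb: "\<And>x. \<exists>c. x = comb e c" and y: "y \<in> dual_lattice"
  shows "smul (of_nat (lattice_level B e)) y \<in> LL"
proof -
  let ?G = "gram_matrix B e" and ?N = "of_nat (lattice_level B e) :: rat"
  obtain c where c: "y = comb e c" using comb by blast
  define u where "u = (\<chi> i. c i)"
  define v where "v = (\<chi> j. B (e j) y)"
  have "?G *v u = v"
    unfolding v_def u_def c
    by (simp add: vec_eq_iff matrix_vector_mult_def gram_matrix_def B_comb_right mult.commute)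
  hence "matrix_inv ?G *v v = u"
    using gram_matrix_inverse(2) by (metis matrix_vector_mul_assoc matrix_vector_mul_lid)
  hence ci: "c i = (\<Sum>j\<in>UNIV. matrix_inv ?G $ i $ j * B (e j) y)" for i
    by (auto simp: vec_eq_iff matrix_vector_mult_def u_def v_def)
  have Nc: "?N * c i = (\<Sum>j\<in>UNIV. (?N * matrix_inv ?G $ i $ j) * B (e j) y)" for i
    by (subst ci) (simp only: sum_distrib_left mult.assoc)
  have Be: "B (e j) y \<in> \<int>" for j
    using y lattice_of_base B_sym[of "e j" y] by (auto simp: dual_lattice_def)
  have "?N * c i \<in> \<int>" for i
    unfolding Nc by (intro Ints_sum Ints_mult lattice_level(2) Be)
  hence fl: "of_int \<lfloor>?N * c i\<rfloor> = ?N * c i" for i by (auto elim: Ints_cases)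
  hence "smul ?N y = comb e (\<lambda>i. of_int \<lfloor>?N * c i\<rfloor>)"
    unfolding c by (simp only: comb_smul fl)
  thus ?thesis by (simp only: lattice_ofI)
qed

text \<open>The determinants of the Gram matrix G and of N G^(-1) are integers with product N^n,
  where n is the rank.\<close>

lemma lattice_disc_dvd_level_power: "lattice_disc B e dvd int (lattice_level B e) ^ CARD('n)"
proof -
  let ?G = "gram_matrix B e" and ?N = "of_nat (lattice_level B e) :: rat"
  define A where "A = (\<chi> i j. ?N * matrix_inv ?G $ i $ j)"
  have "det A \<in> \<int>" unfolding A_def by (rule Ints_det) (simp add: lattice_level(2))
  then obtain m where m: "det A = of_int m" by (rule Ints_cases)
  have "?G ** A = mat ?N"
  proof -
    have "(?G ** A) $ i $ j = ?N * (?G ** matrix_inv ?G) $ i $ j" for i j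
      by (simp add: A_def matrix_matrix_mult_def sum_distrib_left mult_ac)
    thus ?thesis unfolding gram_matrix_inverse(1) by (simp add: vec_eq_iff mat_def)
  qed
  hence "det ?G * det A = det (mat ?N :: rat ^ 'n ^ 'n)" by (metis det_mul)
  also have "\<dots> = ?N ^ CARD('n)" by (subst det_diagonal) (simp_all add: mat_def)
  finally have "(of_int (lattice_disc B e * m) :: rat) = of_int (int (lattice_level B e) ^ CARD('n))"
    by (simp add: m of_int_lattice_disc)
  hence "lattice_disc B e * m = int (lattice_level B e) ^ CARD('n)" by (simp only: of_int_eq_iff)
  thus ?thesis by (metis dvd_triv_left)
qed

end

subsection \<open>Hecke operators and character components\<close>

lemma q_pow_eq: "q_pow n z = qexp z ^ n"
  by (simp add: q_pow_def qexp_def exp_of_nat_mult[symmetric] mult_ac)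

lemma q_pow_mult: "q_pow (m * n) z = q_pow n (of_nat m * z)"
  by (simp add: q_pow_def mult_ac)

lemma qexp_surj:
  assumes "w \<noteq> 0" "norm w < 1"
  obtains z where "Im z > 0" "qexp z = w"
proof
  define z where "z = Ln w / (2 * of_real pi * \<i>)"
  have eq: "2 * of_real pi * \<i> * z = Ln w" by (simp add: z_def)
  show q: "qexp z = w" using assms(1) by (simp add: qexp_def eq)
  have "exp (- 2 * pi * Im z) < 1" using assms(2) unfolding q[symmetric] norm_qexp .
  thus "Im z > 0" by (simp add: zero_less_mult_iff)
qed

text \<open>As a power series in q the function vanishes on the punctured unit disc. The centre q =
  0 is not attained in the upper half-plane, so the coefficients are obtained as limits, one after
  the other.\<close>

lemma q_expansion_zero:
  assumes "\<And>z. Im z > 0 \<Longrightarrow> (\<lambda>n. c n * q_pow n z) sums 0"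
  shows "c n = 0"
proof (induction n rule: less_induct)
  case (less n)
  have "(\<lambda>x :: complex. 0 :: complex) \<midarrow>0\<rightarrow> c (0 + n)"
  proof (rule powser_limit_0_strong[of 1 "\<lambda>m. c (m + n)"])
    fix x :: complex assume x: "x \<noteq> 0" "norm x < 1"
    then obtain z where z: "Im z > 0" "qexp z = x" using qexp_surj by blast
    have "(\<lambda>m. c m * x ^ m) sums 0" using assms[OF z(1)] by (simp add: q_pow_eq z(2))
    hence "(\<lambda>m. c (m + n) * x ^ (m + n)) sums (0 - (\<Sum>i<n. c i * x ^ i))"
      by (subst sums_iff_shift) simp
    hence "(\<lambda>m. c (m + n) * x ^ (m + n)) sums 0" using less.IH by simp
    from sums_divide[OF this, of "x ^ n"] show "(\<lambda>m. c (m + n) * x ^ m) sums 0"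
      using x(1) by (simp add: power_add)
  qed simp
  thus ?case using LIM_unique[OF tendsto_const] by fastforce
qed

lemma has_q_expansion_unique:
  assumes "has_q_expansion f c" "has_q_expansion f d"
  shows "c = d"
proof
  fix n
  have "(\<lambda>n. (c n - d n) * q_pow n z) sums 0" if "Im z > 0" for z
    using sums_diff[of "\<lambda>n. c n * q_pow n z" "f z" "\<lambda>n. d n * q_pow n z" "f z"] assms that
    by (simp add: has_q_expansion_def left_diff_distrib)
  from q_expansion_zero[of "\<lambda>n. c n - d n", OF this] show "c n = d n" by simp
qed

lemma q_coeff_eq: "has_q_expansion f c \<Longrightarrow> q_coeff f = c"
  unfolding q_coeff_def by (rule the_equality) (auto intro: has_q_expansion_unique)

text \<open>Convergence at z/2, where |q| is larger, gives absolute convergence at z.\<close>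

lemma q_expansion_abs_summable:
  assumes "has_q_expansion f c" "Im z > 0"
  shows "summable (\<lambda>n. norm (c n * q_pow n z))"
  unfolding q_pow_eq
proof (rule powser_insidea)
  have "Im (z / 2) > 0" using assms(2) by simp
  hence "(\<lambda>n. c n * q_pow n (z / 2)) sums f (z / 2)" using assms(1) by (simp add: has_q_expansion_def)
  thus "summable (\<lambda>n. c n * qexp (z / 2) ^ n)" by (simp add: q_pow_eq sums_iff)
  show "norm (qexp z) < norm (qexp (z / 2))" using assms(2) by (simp add: norm_qexp)
qed

lemma kronecker_prime_arg: "prime p \<Longrightarrow> kronecker m p = kronecker_prime m p"
  using kronecker_prime_mult_right[of p 1 m] by simp

lemma abs_kronecker_le:
  assumes "prime p"
  shows "\<bar>kronecker m p\<bar> \<le> 1"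
  unfolding kronecker_prime_arg[OF assms] by (auto simp: kronecker_prime_def Legendre_def)

lemma shimura_series_summable:
  assumes f: "has_q_expansion f c" and z: "Im z > 0" and p: "prime p"
  shows "summable (\<lambda>n. shimura_coeff k \<psi> p c n * q_pow n z)"
proof -
  define P where "P = p ^ 2"
  have P: "P > 0" using p by (simp add: P_def prime_gt_0_nat)
  have 1: "summable (\<lambda>n. c (P * n) * q_pow n z)"
  proof (rule summable_norm_cancel)
    \<comment> \<open>The series with coefficients c(P n) is the part of the expansion at z / P that
      is indexed by multiples of \<open>P\<close>.\<close>
    have "Im (z / of_nat P) > 0" using z P by simp
    from q_expansion_abs_summable[OF f this]
    have "summable ((\<lambda>n. norm (c n * q_pow n (z / of_nat P))) \<circ> (\<lambda>n. P * n))"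
      by (rule summable_reindex) (use P in \<open>auto simp: inj_on_def\<close>)
    thus "summable (\<lambda>n. norm (c (P * n) * q_pow n z))"
      using P by (simp add: o_def q_pow_mult)
  qed
  have 2: "summable (\<lambda>n. of_int (kronecker (int n) (int p)) * (c n * q_pow n z))"
  proof (rule summable_norm_cancel, rule summable_comparison_test'[OF q_expansion_abs_summable[OF f z]])
    fix n
    have "\<bar>real_of_int (kronecker (int n) (int p))\<bar> \<le> 1"
      using abs_kronecker_le[of "int p" "int n"] p by (metis of_int_1 of_int_abs of_int_le_iff prime_nat_int_transfer)
    thus "norm (norm (of_int (kronecker (int n) (int p)) * (c n * q_pow n z))) \<le> norm (c n * q_pow n z)"
      unfolding norm_mult[of "of_int (kronecker (int n) (int p))"] by (simp add: mult_left_le_one_le)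
  qed
  have 3: "summable (\<lambda>n. (if P dvd n then c (n div P) else 0) * q_pow n z)"
  proof -
    \<comment> \<open>Along the multiples of \<open>P\<close> the terms are those of the expansion
      at P z; the others vanish.\<close>
    have "Im (of_nat P * z) > 0" using z P by simp
    from summable_norm_cancel[OF q_expansion_abs_summable[OF f this]]
    have "summable (\<lambda>n. (if P dvd P * n then c (P * n div P) else 0) * q_pow (P * n) z)"
      using P by (simp add: q_pow_mult)
    thus ?thesis
      by (subst (asm) summable_mono_reindex[of "\<lambda>n. P * n"]) (use P in \<open>auto simp: strict_mono_def\<close>)
  qed
  define lam where "lam = (k - 1) div 2"
  define A where "A = \<psi> (int p) * of_int (kronecker (-1) (int p)) ^ lam * of_nat p ^ (lam - 1)"
  define D where "D = \<psi> (int (p ^ 2)) * of_nat p ^ (k - 2)"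
  have "summable (\<lambda>n. c (P * n) * q_pow n z + A * (of_int (kronecker (int n) (int p)) * (c n * q_pow n z))
      + D * ((if P dvd n then c (n div P) else 0) * q_pow n z))"
    by (intro summable_add summable_mult 1 2 3)
  thus ?thesis
    unfolding shimura_coeff_def Let_def P_def A_def D_def lam_def by (simp add: algebra_simps)
qed

lemma half_weight_formsD:
  assumes "h \<in> half_weight_forms k N \<phi>" "\<alpha> * \<delta> - \<beta> * c = 1" "int N dvd c" "Im z > 0"
  shows "h (mobius \<alpha> \<beta> c \<delta> z) = \<phi> \<delta> * theta_factor \<alpha> \<beta> c \<delta> z ^ k * h z"
  using assms by (simp add: half_weight_forms_def)

text \<open>In the application \<open>N\<close> and \<open>d\<close> are level and discriminant, and \<open>s\<close> is the squarefree part of \<open>d\<close>. Only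
  \<open>s\<close>, which divides \<open>N\<close>, enters the multiplier, so that no periodicity of \<open>kronecker (4 * d)\<close> is needed.\<close>

locale theta_coset = lattice_space smul B e T den
  for smul :: "rat \<Rightarrow> 'v::ab_group_add \<Rightarrow> 'v" and B :: "'v \<Rightarrow> 'v \<Rightarrow> rat"
    and e T :: "'n::finite \<Rightarrow> 'v" and den :: int +
  fixes a N :: nat and \<nu> :: 'v and d s f g :: int
  assumes a_pos: "a > 0" and N_pos: "N > 0" and nu: "\<nu> \<in> lattice_of e"
    and N_dual: "y \<in> dual_lattice \<Longrightarrow> smul (of_int (int N)) y \<in> lattice_of e"
    and s_pos: "s > 0" and s_dvd: "s dvd int N" and prod_ti: "(\<Prod>i\<in>UNIV. ti i) = s * f ^ 2"
    and d_eq: "d = s * g ^ 2" and g_nonzero: "g \<noteq> 0"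
    and g_coprime: "coprime (int N) \<delta> \<Longrightarrow> coprime g \<delta>"
begin

abbreviation "level \<equiv> 4 * N * a ^ 2"
abbreviation "coset m \<equiv> lattice_coset smul a LL (smul (of_int m) \<nu>)"
abbreviation "dchar \<equiv> \<lambda>n. complex_of_int (kronecker (4 * d) n)"
abbreviation "\<Theta> m \<equiv> coset_theta (int a) (smul (of_int m) \<nu>)"
abbreviation "rr m n \<equiv> complex_of_nat (rep_num B (of_nat n) (coset m))"

section \<open>Theta series of the cosets aL + m \<nu>\<close>

lemma nu_smul: "smul (of_int m) \<nu> \<in> LL"
  by (intro lattice_of_smul nu)

lemma coset_cong:
  assumes "[m = m'] (mod int a)"
  shows "coset m = coset m'"
proof -
  have sub: "coset m \<subseteq> coset m'" if c: "[m = m'] (mod int a)" for m m'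
  proof
    fix v assume "v \<in> coset m"
    then obtain x where x: "x \<in> LL" "v = smul (of_nat a) x + smul (of_int m) \<nu>"
      by (auto simp: lattice_coset_def)
    obtain t where t: "m = m' + int a * t" using c by (metis cong_iff_lin cong_sym)
    have "v = smul (of_nat a) (x + smul (of_int t) \<nu>) + smul (of_int m') \<nu>"
      unfolding x(2) t by (simp add: scale_left_distrib scale_right_distrib add_ac)
    moreover have "x + smul (of_int t) \<nu> \<in> LL" by (intro lattice_of_add x nu_smul)
    ultimately show "v \<in> coset m'" unfolding lattice_coset_def by blast
  qed
  show ?thesis using sub[OF assms] sub[OF cong_sym[OF assms]] by blast
qed

lemma coset_subset: "coset m \<subseteq> LL"
proof
  fix v assume "v \<in> coset m"
  then obtain x where x: "x \<in> LL" "v = smul (of_nat a) x + smul (of_int m) \<nu>"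
    by (auto simp: lattice_coset_def)
  have "smul (of_nat a) x \<in> LL" using lattice_of_smul[OF x(1), of "int a"] by simp
  thus "v \<in> LL" unfolding x(2) by (intro lattice_of_add nu_smul)
qed

lemma theta_sums:
  assumes z: "Im z > 0"
  shows "(\<lambda>n. rr m n * q_pow n z) sums \<Theta> m z"
proof -
  define nq where "nq = (\<lambda>v. nat \<lfloor>B v v\<rfloor>)"
  have nq: "of_nat (nq v) = B v v" if "v \<in> coset m" for v
  proof -
    have "B v v \<in> \<int>" using integral coset_subset that by blast
    then obtain i where i: "B v v = of_int i" by (rule Ints_cases)
    hence "i \<ge> 0" using B_nonneg[of v] by simp
    thus ?thesis by (simp add: nq_def i)
  qed
  define h where "h = (\<lambda>x. smul (of_int (int a)) x + smul (of_int m) \<nu>)"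
  have bij: "bij_betw h LL (coset m)"
    unfolding bij_betw_def
  proof
    show "inj_on h LL" using a_pos by (auto simp: inj_on_def h_def)
    show "h ` LL = coset m" by (auto simp: h_def lattice_coset_def)
  qed
  have a0: "int a \<noteq> 0" using a_pos by simp
  have sm: "(\<lambda>v. exp (- 2 * pi * y * of_rat (B v v))) summable_on coset m" if "y > 0" for y
    using coset_theta_summable[OF a0 that, of "smul (of_int m) \<nu>"]
      summable_on_reindex_bij_betw[OF bij, of "\<lambda>v. exp (- 2 * pi * y * of_rat (B v v))"]
    by (simp add: h_def)
  define F where "F = (\<lambda>n. {v \<in> coset m. nq v = n})"
  \<comment> \<open>Infinitely many vectors of norm \<open>n\<close> would each add the same
    positive amount to a convergent sum. Finiteness matters because \<open>card\<close> of an
    infinite set is 0.\<close>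
  have finF: "finite (F n)" for n
  proof (rule ccontr)
    assume inf: "infinite (F n)"
    define \<epsilon> where "\<epsilon> = exp (- 2 * pi * 1 * real n)"
    define K where "K = (\<Sum>\<^sub>\<infinity>v\<in>coset m. exp (- 2 * pi * 1 * of_rat (B v v)))"
    obtain G where G: "finite G" "card G = nat \<lceil>K / \<epsilon>\<rceil> + 1" "G \<subseteq> F n"
      using infinite_arbitrarily_large[OF inf] by blast
    have "real (card G) * \<epsilon> = (\<Sum>v\<in>G. exp (- 2 * pi * 1 * of_rat (B v v)))"
    proof -
      have "exp (- 2 * pi * 1 * of_rat (B v v)) = \<epsilon>" if "v \<in> G" for v
      proof -
        have "v \<in> coset m" "nq v = n" using that G(3) by (auto simp: F_def)
        hence "B v v = of_nat n" using nq by metis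
        thus ?thesis by (simp add: \<epsilon>_def)
      qed
      thus ?thesis by simp
    qed
    also have "\<dots> \<le> K" unfolding K_def
      by (rule finite_sum_le_infsum[OF sm]) (use G in \<open>auto simp: F_def\<close>)
    finally have "real (card G) \<le> K / \<epsilon>" by (simp add: \<epsilon>_def field_simps)
    thus False unfolding G(2) by linarith
  qed
  have gexp_nq: "gexp z (B v v) = q_pow (nq v) z" if "v \<in> coset m" for v
    by (simp add: nq[OF that, symmetric] gexp_def q_pow_def qexp_def mult_ac)
  have sc: "(\<lambda>v. gexp z (B v v)) summable_on coset m"
    by (rule abs_summable_summable) (use sm[OF z] in \<open>simp add: norm_gexp\<close>)
  have "\<Theta> m z = (\<Sum>\<^sub>\<infinity>v\<in>coset m. gexp z (B v v))"
    unfolding coset_theta_def h_def[THEN fun_cong, symmetric]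
    by (rule infsum_reindex_bij_betw[OF bij])
  hence hs: "((\<lambda>v. gexp z (B v v)) has_sum \<Theta> m z) (coset m)"
    using has_sum_infsum[OF sc] by simp
  have bij2: "bij_betw snd (Sigma UNIV F) (coset m)"
    unfolding bij_betw_def by (auto simp: inj_on_def F_def image_iff)
  have "((\<lambda>p. gexp z (B (snd p) (snd p))) has_sum \<Theta> m z) (Sigma UNIV F)"
    using has_sum_reindex_bij_betw[OF bij2, of "\<lambda>v. gexp z (B v v)" "\<Theta> m z"] hs by simp
  hence "((\<lambda>n. of_nat (card (F n)) * q_pow n z) has_sum \<Theta> m z) UNIV"
  proof (rule has_sum_SigmaD)
    fix n :: nat
    have "gexp z (B v v) = q_pow n z" if "v \<in> F n" for v
      using gexp_nq[of v] that by (simp add: F_def)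
    hence "(\<Sum>v\<in>F n. gexp z (B v v)) = of_nat (card (F n)) * q_pow n z" by simp
    thus "((\<lambda>v. gexp z (B (snd (n, v)) (snd (n, v)))) has_sum of_nat (card (F n)) * q_pow n z) (F n)"
      using finF[of n] by (intro has_sum_finiteI) auto
  qed
  moreover have "rep_num B (of_nat n) (coset m) = card (F n)" for n
  proof -
    have "F n = {v \<in> coset m. B v v = of_nat n}"
      using nq by (auto simp: F_def) (metis of_nat_eq_iff)
    thus ?thesis by (simp add: rep_num_def)
  qed
  ultimately show ?thesis by (intro has_sum_imp_sums) simp
qed

lemma theta_series_eq: "Im z > 0 \<Longrightarrow> theta_series B (coset m) z = \<Theta> m z"
  using sums_unique[OF theta_sums[of z m]] by (simp add: theta_series_def)

lemma Theta_cong: "[m = m'] (mod int a) \<Longrightarrow> Im z > 0 \<Longrightarrow> \<Theta> m z = \<Theta> m' z"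
  using theta_series_eq[of z m] theta_series_eq[of z m'] coset_cong[of m m'] by simp

lemma Theta_holomorphic: "\<Theta> m holomorphic_on uhp"
proof -
  define q where "q = (\<lambda>x. B (smul (of_int (int a)) x + smul (of_int m) \<nu>) (smul (of_int (int a)) x + smul (of_int m) \<nu>))"
  have "(\<lambda>z. \<Sum>\<^sub>\<infinity>x\<in>LL. 1 * qexp (z * of_real (of_rat (q x)))) holomorphic_on uhp"
  proof (rule holomorphic_qexp_sum)
    show "real_of_rat (q x) \<ge> 0" for x by (simp add: q_def B_nonneg)
    fix y :: real assume "y > 0"
    thus "(\<lambda>x. norm (1 :: complex) * exp (- 2 * pi * y * of_rat (q x))) summable_on LL"
      using coset_theta_summable[of "int a" y "smul (of_int m) \<nu>"] a_pos by (simp add: q_def)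
  qed
  thus ?thesis by (simp add: coset_theta_def[abs_def] gexp_def q_def)
qed

text \<open>Here 4d = s (2g)^2, and 2g is prime to \<delta>, so the square drops out of the
  symbol.\<close>

lemma chi_eq:
  assumes "odd \<delta>" "coprime \<delta> (int N)"
  shows "dchar \<delta> = of_int (kronecker s \<delta>)" and "dchar \<delta> \<noteq> 0"
proof -
  have cg: "coprime (2 * g) \<delta>" using assms g_coprime[of \<delta>] by (simp add: coprime_commute)
  have eq: "4 * d = s * (2 * g) ^ 2" by (simp add: d_eq power_mult_distrib)
  show *: "dchar \<delta> = of_int (kronecker s \<delta>)"
    unfolding eq using kronecker_mult_left_pos[OF assms(1) s_pos, of "(2 * g) ^ 2"]
      kronecker_square_pos[OF assms(1) cg] g_nonzero by simp
  have cs: "coprime s \<delta>"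
    using assms(2) s_dvd by (metis coprime_commute coprime_divisors dvd_refl)
  have "kronecker s \<delta> \<noteq> 0"
  proof (cases "\<delta> > 0")
    case True
    thus ?thesis using kronecker_square_coprime[OF assms(1) True cs] by auto
  next
    case False
    hence "- \<delta> > 0" using assms(1) by (cases "\<delta> = 0") auto
    thus ?thesis using kronecker_square_coprime[of "- \<delta>" s] assms(1) cs kronecker_uminus_right[OF s_pos, of "- \<delta>"] by auto
  qed
  thus "dchar \<delta> \<noteq> 0" unfolding * by simp
qed

lemma level_facts:
  assumes "int level dvd c" "\<alpha> * \<delta> - \<beta> * c = 1"
  shows "4 dvd c" "odd \<delta>" "coprime \<delta> (int N)" "coprime \<delta> (int level)" "[\<alpha> * \<delta> = 1] (mod int a)"
proof -
  have cop: "coprime \<delta> c" by (rule coprime_of_unimodular(1)[OF assms(2)])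
  show c4: "4 dvd c" using assms(1) by (metis dvd_mult_left of_nat_mult of_nat_numeral mult.assoc)
  show "odd \<delta>" by (rule odd_of_unimodular[OF assms(2) c4])
  show cl: "coprime \<delta> (int level)" by (rule coprime_divisors[OF dvd_refl assms(1) cop])
  thus "coprime \<delta> (int N)" by simp
  have "int a dvd int level" by (simp add: power2_eq_square)
  hence "int a dvd \<alpha> * \<delta> - 1" using assms dvd_trans by (metis add.commute add_diff_cancel_right' diff_add_cancel dvd_mult)
  thus "[\<alpha> * \<delta> = 1] (mod int a)" by (simp add: cong_iff_dvd_diff)
qed

lemma Theta_transform:
  assumes det: "\<alpha> * \<delta> - \<beta> * c = 1" and c: "int level dvd c" and z: "Im z > 0"
  shows "\<Theta> m (mobius \<alpha> \<beta> c \<delta> z) = dchar \<delta> * theta_factor \<alpha> \<beta> c \<delta> z ^ CARD('n) * \<Theta> (\<alpha> * m) z"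
proof -
  have "\<Theta> m (mobius \<alpha> \<beta> c \<delta> z) = of_int (kronecker s \<delta>) * theta_factor \<alpha> \<beta> c \<delta> z ^ CARD('n)
      * coset_theta (int a) (smul (of_int \<alpha>) (smul (of_int m) \<nu>)) z"
    by (rule coset_theta_modular[OF det _ _ nu_smul _ s_pos s_dvd prod_ti z])
       (use c a_pos N_dual in auto)
  thus ?thesis using chi_eq(1)[of \<delta>] level_facts[OF c det] by simp
qed

text \<open>The weight is \<phi> itself and not its conjugate: the transformation law moves m to
  \<alpha> m, and \<phi>(\<alpha>) is the inverse of \<phi>(\<delta>), so the average acquires the
  factor \<phi>(\<delta>).\<close>

definition comp :: "(int \<Rightarrow> complex) \<Rightarrow> complex \<Rightarrow> complex" where
  "comp \<phi> z = (\<Sum>m\<in>units_mod a. \<phi> m * \<Theta> m z) / of_nat (card (units_mod a))"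

definition comp_coeff :: "(int \<Rightarrow> complex) \<Rightarrow> nat \<Rightarrow> complex" where
  "comp_coeff \<phi> n = (\<Sum>m\<in>units_mod a. \<phi> m * rr m n) / of_nat (card (units_mod a))"

lemma comp_q_expansion:
  assumes "\<And>z. Im z > 0 \<Longrightarrow> F z = comp \<phi> z"
  shows "has_q_expansion F (comp_coeff \<phi>)"
  unfolding has_q_expansion_def
proof
  fix z assume "z \<in> uhp"
  hence z: "Im z > 0" by simp
  have "(\<lambda>n. (\<Sum>m\<in>units_mod a. \<phi> m * (rr m n * q_pow n z)) / of_nat (card (units_mod a))) sums
    ((\<Sum>m\<in>units_mod a. \<phi> m * \<Theta> m z) / of_nat (card (units_mod a)))"
    by (intro sums_divide sums_sum sums_mult theta_sums z)
  thus "(\<lambda>n. comp_coeff \<phi> n * q_pow n z) sums F z"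
    unfolding assms[OF z] comp_def comp_coeff_def by (simp add: sum_distrib_right mult.assoc)
qed

lemma card_units_nonzero: "complex_of_nat (card (units_mod a)) \<noteq> 0"
  unfolding of_nat_eq_0_iff using card_units_mod[OF a_pos] by (rule less_imp_neq[symmetric])

text \<open>Fourier inversion on the units: summing \<phi>(t m) over all \<phi> leaves only the
  class of m inverse to \<open>t\<close>. It is applied to theta values and to Fourier coefficients
  alike.\<close>

lemma character_average:
  fixes w :: "int \<Rightarrow> complex"
  assumes w: "\<And>m m'. [m = m'] (mod int a) \<Longrightarrow> w m = w m'" and tu: "[t * u = 1] (mod int a)"
  shows "(\<Sum>\<phi>\<in>dirichlet_characters a. \<phi> t * ((\<Sum>m\<in>units_mod a. \<phi> m * w m) / of_nat (card (units_mod a)))) = w u"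
proof -
  let ?U = "units_mod a" and ?c = "of_nat (card (units_mod a)) :: complex"
  have c0: "?c \<noteq> 0" by (rule card_units_nonzero)
  have ct: "coprime t (int a)"
    using tu by (metis coprime_iff_invertible_int)
  have cu: "coprime u (int a)"
    using tu by (metis coprime_iff_invertible_int mult.commute)
  have um: "u mod int a \<in> ?U" using a_pos cu by (auto simp: units_mod_def coprime_mod_left_iff)
  have eq: "(\<Sum>\<phi>\<in>dirichlet_characters a. \<phi> t * \<phi> m) = (if m = u mod int a then ?c else 0)" if m: "m \<in> ?U" for m
  proof -
    have cm: "coprime m (int a)" "0 \<le> m" "m < int a" using m by (auto simp: units_mod_def)
    have "(\<Sum>\<phi>\<in>dirichlet_characters a. \<phi> t * \<phi> m) = (\<Sum>\<phi>\<in>dirichlet_characters a. \<phi> (t * m))"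
      by (intro sum.cong refl) (simp add: dirichlet_characterD)
    also have "\<dots> = (if [t * m = 1] (mod int a) then ?c else 0)"
      by (rule sum_dirichlet_characters[OF a_pos]) (use ct cm in simp)
    also have "[t * m = 1] (mod int a) \<longleftrightarrow> m = u mod int a"
    proof -
      have "[t * m = 1] (mod int a) \<longleftrightarrow> [t * m = t * u] (mod int a)"
        using tu cong_sym cong_trans by blast
      also have "\<dots> \<longleftrightarrow> [m = u] (mod int a)" using ct by (simp add: cong_mult_lcancel)
      also have "\<dots> \<longleftrightarrow> m = u mod int a" using cm by (simp add: cong_def)
      finally show ?thesis .
    qed
    finally show ?thesis .
  qed
  have "(\<Sum>\<phi>\<in>dirichlet_characters a. \<phi> t * ((\<Sum>m\<in>?U. \<phi> m * w m) / ?c))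
    = (\<Sum>m\<in>?U. (\<Sum>\<phi>\<in>dirichlet_characters a. \<phi> t * \<phi> m) * w m) / ?c"
    unfolding times_divide_eq_right sum_divide_distrib[symmetric] sum_distrib_left sum_distrib_right
    by (subst sum.swap) (simp only: mult.assoc)
  also have "(\<Sum>m\<in>?U. (\<Sum>\<phi>\<in>dirichlet_characters a. \<phi> t * \<phi> m) * w m) = (\<Sum>m\<in>?U. if m = u mod int a then ?c * w m else 0)"
    by (intro sum.cong refl) (simp add: eq)
  also have "\<dots> = ?c * w (u mod int a)" using um by (simp add: sum.delta)
  also have "\<dots> / ?c = w u" using c0 w[of "u mod int a" u] by (simp add: cong_def)
  finally show ?thesis .
qed

lemma comp_transform:
  assumes \<phi>: "\<phi> \<in> dirichlet_characters a" and det: "\<alpha> * \<delta> - \<beta> * c = 1" and c: "int level dvd c" and z: "Im z > 0"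
  shows "comp \<phi> (mobius \<alpha> \<beta> c \<delta> z) = \<phi> \<delta> * dchar \<delta> * theta_factor \<alpha> \<beta> c \<delta> z ^ CARD('n) * comp \<phi> z"
proof -
  note lf = level_facts[OF c det]
  let ?K = "dchar \<delta> * theta_factor \<alpha> \<beta> c \<delta> z ^ CARD('n)"
  have c\<alpha>: "coprime \<alpha> (int a)" using lf(5) by (metis coprime_iff_invertible_int)
  have one: "\<phi> \<delta> * \<phi> \<alpha> = 1"
    using dirichlet_characterD(2)[OF \<phi> lf(5)] dirichlet_characterD(4)[OF \<phi>] dirichlet_characterD(1)[OF \<phi>, of \<alpha> \<delta>]
    by (simp add: mult.commute)
  have "(\<Sum>m\<in>units_mod a. \<phi> m * \<Theta> m (mobius \<alpha> \<beta> c \<delta> z)) = (\<Sum>m\<in>units_mod a. \<phi> \<delta> * ?K * (\<phi> (\<alpha> * m) * \<Theta> (\<alpha> * m) z))"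
  proof (rule sum.cong[OF refl])
    fix m
    have eq: "\<phi> m = \<phi> \<delta> * \<phi> (\<alpha> * m)"
      using one dirichlet_characterD(1)[OF \<phi>, of \<alpha> m] by (simp flip: mult.assoc)
    show "\<phi> m * \<Theta> m (mobius \<alpha> \<beta> c \<delta> z) = \<phi> \<delta> * ?K * (\<phi> (\<alpha> * m) * \<Theta> (\<alpha> * m) z)"
      unfolding Theta_transform[OF det c z] by (subst eq) (simp only: mult_ac)
  qed
  also have "\<dots> = \<phi> \<delta> * ?K * (\<Sum>m\<in>units_mod a. \<phi> (\<alpha> * m) * \<Theta> (\<alpha> * m) z)"
    by (simp only: sum_distrib_left)
  also have "(\<Sum>m\<in>units_mod a. \<phi> (\<alpha> * m) * \<Theta> (\<alpha> * m) z) = (\<Sum>m\<in>units_mod a. \<phi> m * \<Theta> m z)"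
    by (rule sum_units_mod_reindex[OF a_pos _ c\<alpha>])
       (use dirichlet_characterD(2)[OF \<phi>] Theta_cong[OF _ z] in metis)
  finally show ?thesis by (simp add: comp_def)
qed

lemma comp_in_forms:
  assumes \<phi>: "\<phi> \<in> dirichlet_characters a"
  shows "comp \<phi> \<in> half_weight_forms CARD('n) level (char_mod level (\<lambda>n. \<phi> n * dchar n))"
proof -
  have 1: "comp \<phi> holomorphic_on uhp"
    unfolding comp_def[abs_def] by (intro holomorphic_intros Theta_holomorphic card_units_nonzero)
  have 2: "comp \<phi> (mobius \<alpha> \<beta> c \<delta> z) = char_mod level (\<lambda>n. \<phi> n * dchar n) \<delta> * theta_factor \<alpha> \<beta> c \<delta> z ^ CARD('n) * comp \<phi> z"
    if "\<alpha> * \<delta> - \<beta> * c = 1" "int level dvd c" "Im z > 0" for \<alpha> \<beta> c \<delta> z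
    using comp_transform[OF \<phi> that] level_facts(4)[OF that(2,1)] by (simp add: char_mod_def)
  have 3: "\<exists>C Y. \<forall>z\<in>uhp. Im z \<ge> Y \<longrightarrow>
      norm (comp \<phi> (mobius \<alpha> \<beta> c \<delta> z) / csqrt (of_int c * z + of_int \<delta>) ^ CARD('n)) \<le> C"
    if det: "\<alpha> * \<delta> - \<beta> * c = 1" for \<alpha> \<beta> c \<delta> :: int
  proof -
  have "\<forall>m. \<exists>K. \<forall>z. Im z \<ge> 1 \<longrightarrow> norm (\<Theta> m (mobius \<alpha> \<beta> c \<delta> z)) \<le> K * sqrt (norm (of_int c * z + of_int \<delta>)) ^ CARD('n)"
    using coset_theta_cusp_bound[OF det _ nu_smul, of "int a"] a_pos by simp
  from choice[OF this] obtain K where K: "\<And>m z. Im z \<ge> 1 \<Longrightarrow>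
      norm (\<Theta> m (mobius \<alpha> \<beta> c \<delta> z)) \<le> K m * sqrt (norm (of_int c * z + of_int \<delta>)) ^ CARD('n)" by blast
  define C where "C = (\<Sum>m\<in>units_mod a. norm (\<phi> m) * \<bar>K m\<bar>) / real (card (units_mod a))"
  show ?thesis
  proof (rule exI[of _ C], rule exI[of _ 1], intro ballI impI)
    fix z assume z: "z \<in> uhp" "Im z \<ge> 1"
    define S where "S = sqrt (norm (of_int c * z + of_int \<delta>)) ^ CARD('n)"
    have S0: "S \<ge> 0" by (simp add: S_def)
    have "norm (\<Sum>m\<in>units_mod a. \<phi> m * \<Theta> m (mobius \<alpha> \<beta> c \<delta> z)) \<le> (\<Sum>m\<in>units_mod a. norm (\<phi> m) * \<bar>K m\<bar> * S)"
    proof (rule sum_norm_le)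
      fix m
      have "norm (\<Theta> m (mobius \<alpha> \<beta> c \<delta> z)) \<le> K m * S" unfolding S_def by (rule K[OF z(2)])
      also have "\<dots> \<le> \<bar>K m\<bar> * S" by (intro mult_right_mono S0) auto
      finally have "norm (\<phi> m) * norm (\<Theta> m (mobius \<alpha> \<beta> c \<delta> z)) \<le> norm (\<phi> m) * (\<bar>K m\<bar> * S)"
        by (intro mult_left_mono) auto
      thus "norm (\<phi> m * \<Theta> m (mobius \<alpha> \<beta> c \<delta> z)) \<le> norm (\<phi> m) * \<bar>K m\<bar> * S"
        by (simp only: norm_mult mult.assoc)
    qed
    hence "norm (comp \<phi> (mobius \<alpha> \<beta> c \<delta> z)) \<le> C * S"
      unfolding comp_def C_def norm_divide norm_of_nat sum_distrib_right[symmetric] times_divide_eq_left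
      by (rule divide_right_mono) simp
    hence le: "norm (comp \<phi> (mobius \<alpha> \<beta> c \<delta> z)) / S \<le> C * S / S"
      using S0 by (rule divide_right_mono)
    have C0: "C \<ge> 0" unfolding C_def by (intro divide_nonneg_nonneg sum_nonneg mult_nonneg_nonneg) auto
    \<comment> \<open>For S = 0 the quotient is 0 by convention, and the bound then rests on
      \<open>C0\<close>.\<close>
    have "C * S / S \<le> C" using C0 by (cases "S = 0") auto
    with le have "norm (comp \<phi> (mobius \<alpha> \<beta> c \<delta> z)) / S \<le> C" by linarith
    thus "norm (comp \<phi> (mobius \<alpha> \<beta> c \<delta> z) / csqrt (of_int c * z + of_int \<delta>) ^ CARD('n)) \<le> C"
      by (simp add: norm_divide norm_power S_def)
  qed
qed
  show ?thesis
    unfolding half_weight_forms_def mem_Collect_eq using 1 2 3 by simp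
qed

lemma sum_comp:
  assumes z: "Im z > 0"
  shows "(\<Sum>\<phi>\<in>dirichlet_characters a. comp \<phi> z) = \<Theta> 1 z"
proof -
  have "(\<Sum>\<phi>\<in>dirichlet_characters a. comp \<phi> z) = (\<Sum>\<phi>\<in>dirichlet_characters a. \<phi> 1 * comp \<phi> z)"
    by (intro sum.cong refl) (simp add: dirichlet_characterD)
  also have "\<dots> = \<Theta> 1 z"
    unfolding comp_def by (rule character_average[where w = "\<lambda>m. \<Theta> m z"]) (use Theta_cong[OF _ z] in auto)
  finally show ?thesis .
qed

text \<open>Every unit \<open>m\<close> modulo \<open>a\<close> is the class of the lower right
  entry of some matrix of the level. Applying that matrix to the difference of two decompositions
  shows that the sum of \<phi>(m) E(\<phi>) vanishes for all \<open>m\<close>, and orthogonality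
  isolates E(\<psi>).\<close>

lemma components_unique:
  assumes F: "\<And>\<phi>. \<phi> \<in> dirichlet_characters a \<Longrightarrow> F \<phi> \<in> half_weight_forms CARD('n) level (char_mod level (\<lambda>n. \<phi> n * dchar n))"
    and F_sum: "\<And>z. Im z > 0 \<Longrightarrow> (\<Sum>\<phi>\<in>dirichlet_characters a. F \<phi> z) = \<Theta> 1 z"
    and \<psi>: "\<psi> \<in> dirichlet_characters a" and z: "Im z > 0"
  shows "F \<psi> z = comp \<psi> z"
proof -
  let ?D = "dirichlet_characters a"
  have fin: "finite ?D" by (rule finite_dirichlet_characters[OF a_pos])
  define E where "E = (\<lambda>\<phi>. F \<phi> z - comp \<phi> z)"
  have zero: "(\<Sum>\<phi>\<in>?D. \<phi> m * E \<phi>) = 0" if m: "coprime m (int a)" for m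
  proof -
    \<comment> \<open>The entry has to be prime to the level in order to be completed to a matrix of
      determinant 1.\<close>
    obtain j where j: "coprime (m + j * int a) (int level)"
      using exists_coprime_translate[OF m, of "int level"] a_pos N_pos by auto
    define \<delta> where "\<delta> = m + j * int a"
    have m\<delta>: "[\<delta> = m] (mod int a)" by (simp add: \<delta>_def cong_iff_dvd_diff)
    obtain u w where "u * \<delta> + w * int level = 1"
      using j unfolding \<delta>_def by (metis bezout_int coprime_imp_gcd_eq_1)
    hence det: "u * \<delta> - (- w) * int level = 1" by simp
    note lf = level_facts[OF dvd_refl det]
    let ?M = "mobius u (- w) (int level) \<delta> z" and ?t = "theta_factor u (- w) (int level) \<delta> z ^ CARD('n)"
    have \<delta>0: "\<delta> \<noteq> 0" using lf(2) by auto
    have M: "Im ?M > 0" by (rule Im_mobius_pos[OF det \<delta>0 z])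
    have tr: "H \<phi> ?M = \<phi> m * (dchar \<delta> * ?t) * H \<phi> z"
      if H: "H \<phi> \<in> half_weight_forms CARD('n) level (char_mod level (\<lambda>n. \<phi> n * dchar n))" and \<phi>: "\<phi> \<in> ?D" for H \<phi>
    proof -
      have "H \<phi> ?M = char_mod level (\<lambda>n. \<phi> n * dchar n) \<delta> * ?t * H \<phi> z"
        by (rule half_weight_formsD[OF H det dvd_refl z])
      thus ?thesis using lf(4) dirichlet_characterD(2)[OF \<phi> m\<delta>] by (simp add: char_mod_def mult.assoc)
    qed
    have "0 = (\<Sum>\<phi>\<in>?D. F \<phi> ?M) - (\<Sum>\<phi>\<in>?D. comp \<phi> ?M)"
      using F_sum[OF M] sum_comp[OF M] by simp
    also have "\<dots> = (\<Sum>\<phi>\<in>?D. (dchar \<delta> * ?t) * (\<phi> m * E \<phi>))"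
      unfolding sum_subtractf[symmetric]
    proof (rule sum.cong[OF refl])
      fix \<phi> assume \<phi>: "\<phi> \<in> ?D"
      show "F \<phi> ?M - comp \<phi> ?M = (dchar \<delta> * ?t) * (\<phi> m * E \<phi>)"
        unfolding tr[of F, OF F[OF \<phi>] \<phi>] tr[of comp, OF comp_in_forms[OF \<phi>] \<phi>] E_def by (simp add: algebra_simps)
    qed
    also have "\<dots> = (dchar \<delta> * ?t) * (\<Sum>\<phi>\<in>?D. \<phi> m * E \<phi>)" by (simp only: sum_distrib_left)
    finally show ?thesis
      using chi_eq(2)[OF lf(2,3)] theta_factor_eq(2)[OF det lf(1) z] by simp
  qed
  have "0 = (\<Sum>m\<in>units_mod a. (\<Sum>\<phi>\<in>?D. \<phi> m * E \<phi>) * cnj (\<psi> m))"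
    by (simp add: zero units_mod_def)
  also have "\<dots> = (\<Sum>\<phi>\<in>?D. (\<Sum>m\<in>units_mod a. \<phi> m * cnj (\<psi> m)) * E \<phi>)"
    unfolding sum_distrib_right by (subst sum.swap) (simp add: mult_ac)
  also have "\<dots> = (\<Sum>\<phi>\<in>?D. if \<phi> = \<psi> then of_nat (card (units_mod a)) * E \<phi> else 0)"
    by (intro sum.cong refl) (simp add: dirichlet_character_orthogonal[OF a_pos _ \<psi>])
  also have "\<dots> = of_nat (card (units_mod a)) * E \<psi>" using fin \<psi> by (simp add: sum.delta)
  finally have "E \<psi> = 0" using card_units_nonzero by simp
  thus ?thesis by (simp add: E_def)
qed

text \<open>\<open>character_components\<close> chooses among all decompositions; existence is
  witnessed by \<open>comp\<close>, and uniqueness identifies the chosen one with it on the upper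
  half-plane.\<close>

lemma character_components_eq:
  assumes \<psi>: "\<psi> \<in> dirichlet_characters a" and z: "Im z > 0"
  shows "character_components CARD('n) level a dchar (theta_series B (coset 1)) \<psi> z = comp \<psi> z"
proof -
  let ?P = "\<lambda>F. (\<forall>\<phi>\<in>dirichlet_characters a. F \<phi> \<in> half_weight_forms CARD('n) level (char_mod level (\<lambda>n. \<phi> n * dchar n))) \<and>
     (\<forall>z\<in>uhp. theta_series B (coset 1) z = (\<Sum>\<phi>\<in>dirichlet_characters a. F \<phi> z))"
  have "?P comp" using comp_in_forms sum_comp theta_series_eq[of _ 1] by auto
  hence "?P (SOME F. ?P F)" by (rule someI[where P = ?P])
  hence P: "?P (character_components CARD('n) level a dchar (theta_series B (coset 1)))"
    unfolding character_components_def .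
  show ?thesis
    by (rule components_unique[OF _ _ \<psi> z]) (use P theta_series_eq[of _ 1] in auto)
qed

section \<open>Fourier coefficients of the Hecke image\<close>

definition hecke_coeff :: "nat \<Rightarrow> nat \<Rightarrow> complex" where
  "hecke_coeff p n = (\<Sum>\<phi>\<in>dirichlet_characters a.
     shimura_coeff CARD('n) (char_mod level (\<lambda>n. \<phi> n * dchar n)) p (comp_coeff \<phi>) n)"

lemma hecke_q_expansion:
  assumes p: "prime p"
  shows "has_q_expansion (hecke_T_sq CARD('n) level a dchar p (theta_series B (coset 1))) (hecke_coeff p)"
  unfolding has_q_expansion_def
proof
  fix z assume "z \<in> uhp"
  hence z: "Im z > 0" by simp
  let ?F = "character_components CARD('n) level a dchar (theta_series B (coset 1))"
  let ?\<psi> = "\<lambda>\<phi>. char_mod level (\<lambda>n. \<phi> n * dchar n)"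
  have "(\<lambda>n. \<Sum>\<phi>\<in>dirichlet_characters a. shimura_coeff CARD('n) (?\<psi> \<phi>) p (comp_coeff \<phi>) n * q_pow n z) sums
    (\<Sum>\<phi>\<in>dirichlet_characters a. shimura_hecke CARD('n) (?\<psi> \<phi>) p (?F \<phi>) z)"
  proof (rule sums_sum)
    fix \<phi> assume \<phi>: "\<phi> \<in> dirichlet_characters a"
    have exp: "has_q_expansion (?F \<phi>) (comp_coeff \<phi>)"
      by (rule comp_q_expansion) (rule character_components_eq[OF \<phi>])
    show "(\<lambda>n. shimura_coeff CARD('n) (?\<psi> \<phi>) p (comp_coeff \<phi>) n * q_pow n z) sums
        shimura_hecke CARD('n) (?\<psi> \<phi>) p (?F \<phi>) z"
      unfolding shimura_hecke_def q_coeff_eq[OF exp] by (rule summable_sums[OF shimura_series_summable[OF exp z p]])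
  qed
  thus "(\<lambda>n. hecke_coeff p n * q_pow n z) sums hecke_T_sq CARD('n) level a dchar p (theta_series B (coset 1)) z"
    by (simp add: hecke_T_sq_def hecke_coeff_def sum_distrib_right)
qed

lemma sum_comp_coeff:
  assumes "[t * u = 1] (mod int a)"
  shows "(\<Sum>\<phi>\<in>dirichlet_characters a. \<phi> t * comp_coeff \<phi> n) = rr u n"
  unfolding comp_coeff_def by (rule character_average[where w = "\<lambda>m. rr m n"]) (use assms coset_cong in auto)

lemma sum_comp_coeff_1: "(\<Sum>\<phi>\<in>dirichlet_characters a. comp_coeff \<phi> n) = rr 1 n"
proof -
  have "(\<Sum>\<phi>\<in>dirichlet_characters a. comp_coeff \<phi> n) = (\<Sum>\<phi>\<in>dirichlet_characters a. \<phi> 1 * comp_coeff \<phi> n)"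
    by (intro sum.cong refl) (simp add: dirichlet_characterD)
  thus ?thesis using sum_comp_coeff[of 1 1 n] by simp
qed

text \<open>Characters modulo the level vanish at p and at p^2, so only the first term of Shimura's
  formula survives.\<close>

lemma hecke_coeff_dvd:
  assumes "prime p" "p dvd level"
  shows "hecke_coeff p n = rr 1 (p ^ 2 * n)"
proof -
  have nc: "\<not> coprime (int p) (int level)" "\<not> coprime (int (p ^ 2)) (int level)"
  proof -
    have "int p dvd int level" "\<not> is_unit (int p)" using assms by (simp_all only: int_dvd_int_iff) auto
    moreover have "int p dvd int (p ^ 2)" by (simp add: power2_eq_square)
    ultimately show "\<not> coprime (int p) (int level)" "\<not> coprime (int (p ^ 2)) (int level)"
      using not_coprimeI[of "int p" "int p" "int level"] not_coprimeI[of "int p" "int (p ^ 2)" "int level"]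
      by (blast intro: dvd_refl)+
  qed
  have "hecke_coeff p n = (\<Sum>\<phi>\<in>dirichlet_characters a. comp_coeff \<phi> (p ^ 2 * n))"
    unfolding hecke_coeff_def shimura_coeff_def Let_def char_mod_def if_not_P[OF nc(1)] if_not_P[OF nc(2)] by simp
  thus ?thesis by (simp only: sum_comp_coeff_1)
qed

lemma hecke_coeff_coprime:
  assumes p: "prime p" "\<not> p dvd level" and pbar: "[int p * pbar = 1] (mod int a)"
  defines "lam \<equiv> (CARD('n) - 1) div 2"
  shows "hecke_coeff p n = rr 1 (p ^ 2 * n)
     + of_int (kronecker (-1) (int p) ^ lam * kronecker (4 * d * int n) (int p)) * of_nat p ^ (lam - 1) * rr pbar n
     + of_int (kronecker (4 * d) (int (p ^ 2))) * of_nat p ^ (CARD('n) - 2)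
        * of_nat (rep_num B (of_nat n / of_nat (p ^ 2)) (coset (pbar ^ 2)))"
proof -
  let ?D = "dirichlet_characters a"
  have cop: "coprime (int p) (int level)" "coprime (int (p ^ 2)) (int level)"
  proof -
    have "\<not> int p dvd int level" using p(2) by (simp only: int_dvd_int_iff) simp
    with p(1) show *: "coprime (int p) (int level)" by (intro prime_imp_coprime) auto
    show "coprime (int (p ^ 2)) (int level)" unfolding of_nat_power by (rule coprime_power_left_iff[THEN iffD2]) (use * in blast)
  qed
  \<comment> \<open>As 4 divides the level, p is not 2; multiplicativity of the symbol in its upper
    argument is available for odd p.\<close>
  have p2: "odd (int p)" using p(2) proof -
    have "p \<noteq> 2" using p(2) by auto
    thus ?thesis using p(1) primes_dvd_imp_eq[OF two_is_prime_nat, of p] by auto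
  qed
  have pp: "prime (int p)" using p(1) by simp
  have k1: "kronecker (4 * d * int n) (int p) = kronecker (4 * d) (int p) * kronecker (int n) (int p)"
    by (rule kronecker_mult_left) (use p2 p(1) prime_gt_0_nat in auto)
  have pbar2: "[int (p ^ 2) * pbar ^ 2 = 1] (mod int a)"
    using cong_pow[OF pbar, of 2] by (simp add: power_mult_distrib)
  define A where "A = dchar (int p) * of_int (kronecker (-1) (int p)) ^ lam * of_int (kronecker (int n) (int p)) * of_nat p ^ (lam - 1)"
  define E where "E = dchar (int (p ^ 2)) * of_nat p ^ (CARD('n) - 2)"
  have "hecke_coeff p n = (\<Sum>\<phi>\<in>?D. comp_coeff \<phi> (p ^ 2 * n) + A * (\<phi> (int p) * comp_coeff \<phi> n)
      + E * (if p ^ 2 dvd n then \<phi> (int (p ^ 2)) * comp_coeff \<phi> (n div p ^ 2) else 0))"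
    unfolding hecke_coeff_def
  proof (rule sum.cong[OF refl])
    fix \<phi> assume "\<phi> \<in> ?D"
    show "shimura_coeff CARD('n) (char_mod level (\<lambda>n. \<phi> n * dchar n)) p (comp_coeff \<phi>) n =
      comp_coeff \<phi> (p ^ 2 * n) + A * (\<phi> (int p) * comp_coeff \<phi> n)
      + E * (if p ^ 2 dvd n then \<phi> (int (p ^ 2)) * comp_coeff \<phi> (n div p ^ 2) else 0)"
      unfolding shimura_coeff_def Let_def char_mod_def lam_def[symmetric] A_def E_def using cop by simp
  qed
  also have "\<dots> = (\<Sum>\<phi>\<in>?D. comp_coeff \<phi> (p ^ 2 * n)) + A * (\<Sum>\<phi>\<in>?D. \<phi> (int p) * comp_coeff \<phi> n)
      + E * (if p ^ 2 dvd n then (\<Sum>\<phi>\<in>?D. \<phi> (int (p ^ 2)) * comp_coeff \<phi> (n div p ^ 2)) else 0)"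
    by (simp add: sum.distrib sum_distrib_left)
  also have "\<dots> = rr 1 (p ^ 2 * n) + A * rr pbar n + E * (if p ^ 2 dvd n then rr (pbar ^ 2) (n div p ^ 2) else 0)"
    unfolding sum_comp_coeff_1 sum_comp_coeff[OF pbar] sum_comp_coeff[OF pbar2] ..
  \<comment> \<open>If p^2 does not divide \<open>n\<close>, the quotient is not an integer and
    \<open>rep_num\<close> is 0 by definition, in agreement with the third term of Shimura's
    formula.\<close>
  also have "(if p ^ 2 dvd n then rr (pbar ^ 2) (n div p ^ 2) else 0) = of_nat (rep_num B (of_nat n / of_nat (p ^ 2)) (coset (pbar ^ 2)))"
  proof (cases "p ^ 2 dvd n")
    case True
    then obtain m where m: "n = p ^ 2 * m" by auto
    have "p > 0" using p(1) prime_gt_0_nat by blast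
    hence "(of_nat n / of_nat (p ^ 2) :: rat) = of_nat m" "n div p ^ 2 = m" by (simp_all add: m)
    thus ?thesis using True by simp
  next
    case False
    have "(of_nat n / of_nat (p ^ 2) :: rat) \<notin> \<int>"
    proof
      assume "(of_nat n / of_nat (p ^ 2) :: rat) \<in> \<int>"
      then obtain i where "(of_nat n / of_nat (p ^ 2) :: rat) = of_int i" by (rule Ints_cases)
      moreover have "p > 0" using p(1) prime_gt_0_nat by blast
      ultimately have "(of_int (int n) :: rat) = of_int (i * int (p ^ 2))" by (simp add: field_simps)
      hence "int n = i * int (p ^ 2)" by (simp only: of_int_eq_iff)
      hence "int (p ^ 2) dvd int n" by simp
      hence "p ^ 2 dvd n" by (simp only: int_dvd_int_iff)
      with False show False by contradiction
    qed
    thus ?thesis using False by (simp add: rep_num_def)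
  qed
  finally show ?thesis unfolding A_def E_def k1 by (simp only: of_int_mult of_int_power mult_ac)
qed

end

theorem theorem2p5:
  fixes smul :: "rat \<Rightarrow> 'v::ab_group_add \<Rightarrow> 'v"
    and B :: "'v \<Rightarrow> 'v \<Rightarrow> rat"
    and e :: "'n::finite \<Rightarrow> 'v"
    and L :: "'v set" and \<nu> :: 'v
    and k a p N\<^sub>L lam :: nat and d\<^sub>L :: int
  assumes "pos_def_quadratic_space smul B"
    and "k = CARD('n)" and "k \<ge> 3" and "odd k"
    and "lattice_basis smul e L" and "integral_lattice B L"
    and "N\<^sub>L = lattice_level B e" and "d\<^sub>L = lattice_disc B e"
    and "a \<ge> 1" and "\<nu> \<in> L" and "coset_conductor smul a L \<nu> = a"
    and "prime p"
    and "lam = (k - 1) div 2"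
  shows "\<exists>b. has_q_expansion
            (hecke_T_sq k (4 * N\<^sub>L * a ^ 2) a (\<lambda>n. of_int (kronecker (4 * d\<^sub>L) n)) p
               (theta_series B (lattice_coset smul a L \<nu>))) b \<and>
          (p dvd 4 * N\<^sub>L * a ^ 2 \<longrightarrow>
             (\<forall>n. b n = of_nat (rep_num B (of_nat (p ^ 2 * n)) (lattice_coset smul a L \<nu>)))) \<and>
          (\<not> p dvd 4 * N\<^sub>L * a ^ 2 \<longrightarrow>
             (\<forall>pbar :: int. [int p * pbar = 1] (mod int a) \<longrightarrow>
               (\<forall>n. b n =
                    of_nat (rep_num B (of_nat (p ^ 2 * n)) (lattice_coset smul a L \<nu>))
                  + of_int (kronecker (-1) (int p) ^ lam * kronecker (4 * d\<^sub>L * int n) (int p))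
                      * of_nat p ^ (lam - 1)
                      * of_nat (rep_num B (of_nat n)
                          (lattice_coset smul a L (smul (of_int pbar) \<nu>)))
                  + of_int (kronecker (4 * d\<^sub>L) (int (p ^ 2))) * of_nat p ^ (k - 2)
                      * of_nat (rep_num B (of_nat n / of_nat (p ^ 2))
                          (lattice_coset smul a L (smul (of_int (pbar ^ 2)) \<nu>))))))"
proof -
  interpret pos_def_quadratic_space smul B by fact
  note basis = \<open>lattice_basis smul e L\<close>
  obtain T den where "lattice_space smul B e T den"
    using lattice_space_exists[OF basis \<open>integral_lattice B L\<close>] by blast
  then interpret lattice_space smul B e T den .
  have L: "L = lattice_of e" by (rule lattice_basis_comb(1)[OF basis])
  \<comment> \<open>\<open>d\<^sub>L\<close> divides a power of the level, so its squarefree part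
    divides the level itself, as the periodicity of the symbol requires.\<close>
  define s g where "s = squarefree_part d\<^sub>L" and "g = square_part d\<^sub>L"
  have d: "d\<^sub>L = s * g ^ 2" unfolding s_def g_def by (rule squarefree_decompose)
  have d_pos: "d\<^sub>L > 0" using lattice_disc_pos assms(8) by simp
  have N_pos: "N\<^sub>L > 0" using lattice_level(1) assms(7) by simp
  have d_dvd: "d\<^sub>L dvd int N\<^sub>L ^ CARD('n)"
    using lattice_disc_dvd_level_power assms(7,8) by simp
  have g0: "g \<noteq> 0" using d d_pos by auto
  have s_pos: "s > 0" using d d_pos g0 by (auto simp: zero_less_mult_iff)
  have s_dvd: "s dvd int N\<^sub>L"
  proof (rule squarefree_dvd_of_dvd_power)
    show "squarefree s" unfolding s_def by (rule squarefree_squarefree_part)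
    show "s dvd int N\<^sub>L ^ CARD('n)" using d d_dvd by (metis dvd_mult_left)
  qed
  obtain m where m: "(\<Prod>i\<in>UNIV. ti i) = d\<^sub>L * m ^ 2" using prod_ti_eq_disc assms(8) by auto
  \<comment> \<open>The product of the orthogonal norms is d m^2 = s (g m)^2, which gives
    \<open>g * m\<close> as the value of \<open>f\<close>.\<close>
  interpret theta_coset smul B e T den a N\<^sub>L \<nu> d\<^sub>L s "g * m" g
  proof
    show "smul (of_int (int N\<^sub>L)) y \<in> lattice_of e" if "y \<in> dual_lattice" for y
      using level_smul_dual[OF lattice_basis_comb(2)[OF basis] that] assms(7) by simp
    show "(\<Prod>i\<in>UNIV. ti i) = s * (g * m) ^ 2" unfolding m d by (simp add: power_mult_distrib)
    \<comment> \<open>As \<open>g\<close> divides the discriminant, it divides a power of the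
      level.\<close>
    show "coprime g \<delta>" if "coprime (int N\<^sub>L) \<delta>" for \<delta>
    proof (rule coprime_divisors[OF _ dvd_refl])
      show "g dvd int N\<^sub>L ^ CARD('n)"
        using d d_dvd by (metis dvd_mult_left dvd_mult_right power2_eq_square)
      show "coprime (int N\<^sub>L ^ CARD('n)) \<delta>" using that by simp
    qed
  qed (use assms(9,10) L N_pos s_pos s_dvd d g0 in auto)
  have coset1: "coset 1 = lattice_coset smul a L \<nu>" using L by simp
  note q_exp = hecke_q_expansion[OF \<open>prime p\<close>]
  show ?thesis
    unfolding \<open>k = CARD('n)\<close> \<open>lam = (k - 1) div 2\<close>
  proof (intro exI[of _ "hecke_coeff p"] conjI impI allI)
    show "has_q_expansion (hecke_T_sq CARD('n) (4 * N\<^sub>L * a ^ 2) a (\<lambda>n. of_int (kronecker (4 * d\<^sub>L) n)) p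
        (theta_series B (lattice_coset smul a L \<nu>))) (hecke_coeff p)"
      using q_exp unfolding coset1 .
  next
    fix n assume "p dvd 4 * N\<^sub>L * a ^ 2"
    thus "hecke_coeff p n = of_nat (rep_num B (of_nat (p ^ 2 * n)) (lattice_coset smul a L \<nu>))"
      using hecke_coeff_dvd[OF \<open>prime p\<close>] unfolding coset1 by blast
  next
    fix pbar :: int and n
    assume *: "\<not> p dvd 4 * N\<^sub>L * a ^ 2" "[int p * pbar = 1] (mod int a)"
    show "hecke_coeff p n =
        of_nat (rep_num B (of_nat (p ^ 2 * n)) (lattice_coset smul a L \<nu>))
      + of_int (kronecker (-1) (int p) ^ ((CARD('n) - 1) div 2) * kronecker (4 * d\<^sub>L * int n) (int p))
          * of_nat p ^ ((CARD('n) - 1) div 2 - 1)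
          * of_nat (rep_num B (of_nat n) (lattice_coset smul a L (smul (of_int pbar) \<nu>)))
      + of_int (kronecker (4 * d\<^sub>L) (int (p ^ 2))) * of_nat p ^ (CARD('n) - 2)
          * of_nat (rep_num B (of_nat n / of_nat (p ^ 2)) (lattice_coset smul a L (smul (of_int (pbar ^ 2)) \<nu>)))"
      using hecke_coeff_coprime[OF \<open>prime p\<close> *, of n] unfolding coset1 unfolding L[symmetric] .
  qed
qed

end
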